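(* Let $\Xi\subset\mathcal V_{\rm nc}$ be a full nc subset, $\mathcal R$ a Hilbert space, $Q_0\in\mathcal T(\Xi;\mathcal L(\mathcal R,\mathbb C)_{\rm nc})$ and $\mathbb D_{Q_0}=\{Z\in\Xi:\|Q_0(Z)\|<1\}$. Then the scalar kernel $$k_{Q_0}(Z,W)(P)=\sum_{k=0}^\infty(L_{Q_0(Z)^*})^{(k)*}(P\otimes I_{\mathcal R^{\otimes k}})(L_{Q_0(W)^*})^{(k)}$$ on $\mathbb D_{Q_0}$ is a complete Pick nc kernel.
   Context: All vector spaces are over $\mathbb C$. $\mathcal L(\mathcal H,\mathcal K)^{n\times m}\cong\mathcal L(\mathcal H^m,\mathcal K^n)$ for Hilbert spaces. For $P\in\mathbb C^{n\times m}$, $P\otimes I_{\mathcal H}\in\mathcal L(\mathcal H^m,\mathcal H^n)$. nc functions. $\mathcal V_{\rm nc}=\coprod_{n\ge1}\mathcal V^{n\times n}$, $\Omega_n=\Omega\cap\mathcal V^{n\times n}$. A function $f:\Omega\to\mathcal V_{0,{\rm nc}}$ ($\Omega\subset\mathcal V_{\rm nc}$) is graded if $f(\Omega_n)\subset\mathcal V_0^{n\times n}$; it is an nc function if graded and $Z\in\Omega_n$, $\widetilde Z\in\Omega_m$, $\alpha\in\mathbb C^{m\times n}$, $\alpha Z=\widetilde Z\alpha$ imply $\alpha f(Z)=f(\widetilde Z)\alpha$. $\mathcal T(\Omega;\mathcal V_{0,{\rm nc}})$ is the set of nc functions. Full nc sets. $\Xi\subset\mathcal V_{\rm nc}$ is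 a full nc subset if it is closed under direct sums and $Z\in\Xi_n$, $\widetilde Z\in\mathcal V^{m\times m}$, $\mathcal I\widetilde Z=Z\mathcal I$ with $\mathcal I\in\mathbb C^{n\times m}$ injective imply $\widetilde Z\in\Xi_m$. Notation in $k_{Q_0}$. For $W\in\mathbb D_{Q_0,m}$, $Q_0(W)^*:\mathbb C^m\to\mathbb C^m\otimes\mathcal R\cong\mathcal R^m$; $(L_{Q_0(W)^*})^{(0)}=I_{\mathbb C^m}$ and $(L_{Q_0(W)^*})^{(k)}=(Q_0(W)^*\otimes I_{\mathcal R^{\otimes(k-1)}})\cdots(Q_0(W)^*\otimes I_{\mathcal R})Q_0(W)^*:\mathbb C^m\to\mathbb C^m\otimes\mathcal R^{\otimes k}$ for $k\ge1$. cp nc kernels. For a Hilbert space $\mathcal H$, an nc kernel $K:\Omega\times\Omega\to\mathcal L(\mathbb C,\mathcal L(\mathcal H))_{\rm nc}$ assigns to $Z\in\Omega_n,W\in\Omega_m$ a linear map $K(Z,W):\mathbb C^{n\times m}\to\mathcal L(\mathcal H)^{n\times m}$ such that $\alpha K(Z,W)(P)\beta^*=K(\widetilde Z,\widetilde W)(\alpha P\beta^* )$ whenever $\alpha Z=\widetilde Z\alpha$, $\beta W=\widetilde W\beta$ ($Z,\widetilde Z,W,\widetilde W\in\Omega$, $\alpha,\beta$ complex matrices of suitable sizes) and $P\in\mathbb C^{n\times m}$. It is cp if for all $Z^{(i)}\in\Omega_{m_i}$, $i=1,\dots,n$, the map $[P_{ij}]\mapsto[K(Z^{(i)},Z^{(j)})(P_{ij})]$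 from $\mathbb C^{N\times N}$ to $\mathcal L(\mathcal H)^{N\times N}$, $N=\sum m_i$, is positive. Multipliers. For a cp nc kernel $K:\mathbb D\times\mathbb D\to\mathcal L(\mathbb C,\mathcal L(\mathcal H))_{\rm nc}$ on a set $\mathbb D\subset\mathcal V_{\rm nc}$ closed under direct sums, $\mathcal H(K)$ is the unique Hilbert space of nc functions $f:\mathbb D\to\mathcal L(\mathbb C,\mathcal H)_{\rm nc}$ that contains the functions $K_{W,v,y}(Z)u=K(Z,W)(uv)y$ ($W\in\mathbb D_m$, $v\in\mathbb C^{1\times m}$, $y\in\mathcal H^m$, $Z\in\mathbb D_n$, $u\in\mathbb C^n$) and satisfies $\langle f(W)v^*,y\rangle_{\mathcal H^m}=\langle f,K_{W,v,y}\rangle_{\mathcal H(K)}$. An nc function $S:\mathbb D\to\mathcal L(\mathcal U,\mathcal Y)_{\rm nc}$ belongs to $\overline{\mathcal B}\mathcal M(K',K)$ if $(M_Sf)(W)=S(W)f(W)$ defines an operator $M_S:\mathcal H(K')\to\mathcal H(K)$ with $\|M_S\|\le1$. Complete Pick nc kernel. A scalar cp nc kernel $k:\mathbb D\times\mathbb D\to\mathcal L(\mathbb C,\mathbb C)_{\rm nc}$ is a complete Pick nc kernel if for any Hilbert spaces $\mathcal U,\mathcal Y$, any subset $\Omega\subset\mathbb D$ and any graded function $S_0:\Omega\to\mathcal L(\mathcal U,\mathcal Y)_{\rm nc}$, the following are equivalent: (i) there is an nc function $S:\mathbb D\to\mathcal L(\mathcal U,\mathcal Y)_{\rm nc}$ in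 $\overline{\mathcal B}\mathcal M(k\otimes I_{\mathcal U},k\otimes I_{\mathcal Y})$ with $S|_\Omega=S_0$; (ii) the kernel $K_{S_0}(Z,W)(P)=k(Z,W)(P)\otimes I_{\mathcal Y}-S_0(Z)(k(Z,W)(P)\otimes I_{\mathcal U})S_0(W)^*$ is a cp nc kernel on $\Omega$. Here $(k\otimes I_{\mathcal H})(Z,W)(P)=k(Z,W)(P)\otimes I_{\mathcal H}$. *)

theory Defs
  imports
    "Jordan_Normal_Form.Schur_Decomposition"
    "HOL-Analysis.Infinite_Sum"
    "HOL-Analysis.L2_Norm"
    "HOL-Library.Nonpos_Ints"
begin

section \<open>Complex Hilbert spaces\<close>

text \<open>Inner products are linear in the first argument.\<close>

class chilbert = banach +
  fixes scaleC :: "complex \<Rightarrow> 'a \<Rightarrow> 'a"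
    and cinner :: "'a \<Rightarrow> 'a \<Rightarrow> complex"
  assumes scaleC_add_right: "scaleC a (x + y) = scaleC a x + scaleC a y"
    and scaleC_add_left: "scaleC (a + b) x = scaleC a x + scaleC b x"
    and scaleC_scaleC: "scaleC a (scaleC b x) = scaleC (a * b) x"
    and scaleC_one: "scaleC 1 x = x"
    and scaleR_scaleC: "r *\<^sub>R x = scaleC (complex_of_real r) x"
    and cinner_commute: "cinner x y = cnj (cinner y x)"
    and cinner_add_left: "cinner (x + y) z = cinner x z + cinner y z"
    and cinner_scaleC_left: "cinner (scaleC a x) y = a * cinner x y"
    and norm_eq_sqrt_cinner: "norm x = sqrt (Re (cinner x x))"
begin

lemma scaleC_zero_right: "scaleC a 0 = 0"
  using scaleC_add_right[of a 0 0] by simp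

lemma scaleC_zero_left: "scaleC 0 x = 0"
  using scaleC_add_left[of 0 0 x] by simp

lemma scaleC_minus_right: "scaleC a (- x) = - scaleC a x"
  by (rule minus_unique[symmetric]) (simp add: scaleC_zero_right scaleC_add_right[symmetric])

lemma scaleC_sum_right: "scaleC a (sum f A) = (\<Sum>i\<in>A. scaleC a (f i))"
  by (induction A rule: infinite_finite_induct) (auto simp: scaleC_zero_right scaleC_add_right)

lemma cinner_zero_left: "cinner 0 y = 0"
  using cinner_add_left[of 0 0 y] by simp

lemma cinner_minus_left: "cinner (- x) y = - cinner x y"
proof -
  have "cinner x y + cinner (- x) y = 0"
    by (simp add: cinner_add_left[symmetric] cinner_zero_left)
  thus ?thesis by (simp add: group_add_class.add_eq_0_iff)
qed

lemma cinner_diff_left: "cinner (x - y) z = cinner x z - cinner y z"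
  using cinner_add_left[of x "- y" z] by (simp add: cinner_minus_left)

lemma cinner_add_right: "cinner x (y + z) = cinner x y + cinner x z"
  by (metis cinner_add_left cinner_commute complex_cnj_add)

lemma cinner_diff_right: "cinner x (y - z) = cinner x y - cinner x z"
  by (metis cinner_diff_left cinner_commute complex_cnj_diff)

lemma cinner_scaleC_right: "cinner x (scaleC a y) = cnj a * cinner x y"
  by (metis cinner_scaleC_left cinner_commute complex_cnj_mult)

lemma cinner_sum_left: "cinner (sum f A) y = (\<Sum>i\<in>A. cinner (f i) y)"
  by (induction A rule: infinite_finite_induct) (auto simp: cinner_zero_left cinner_add_left)

lemma cinner_sum_right: "cinner x (sum f A) = (\<Sum>i\<in>A. cinner x (f i))"
  by (subst cinner_commute) (simp add: cinner_sum_left cinner_commute[symmetric])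

lemma cinner_self: "cinner x x = complex_of_real ((norm x)\<^sup>2)"
proof -
  have "0 \<le> sqrt (Re (cinner x x))"
    using norm_ge_zero[of x] by (simp only: norm_eq_sqrt_cinner)
  hence "0 \<le> Re (cinner x x)" by simp
  moreover have "Im (cinner x x) = 0"
    using arg_cong[OF cinner_commute[of x x], of Im] by simp
  ultimately show ?thesis
    by (simp add: norm_eq_sqrt_cinner complex_eq_iff)
qed

lemma norm_scaleC: "norm (scaleC a x) = cmod a * norm x"
proof -
  have "complex_of_real ((norm (scaleC a x))\<^sup>2) = (a * cnj a) * complex_of_real ((norm x)\<^sup>2)"
    by (simp only: cinner_self[symmetric] cinner_scaleC_left cinner_scaleC_right mult_ac)
  also have "\<dots> = complex_of_real ((cmod a * norm x)\<^sup>2)"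
    by (simp add: complex_norm_square[symmetric] power_mult_distrib)
  finally have "complex_of_real ((norm (scaleC a x))\<^sup>2) = complex_of_real ((cmod a * norm x)\<^sup>2)" .
  hence "(norm (scaleC a x))\<^sup>2 = (cmod a * norm x)\<^sup>2" using of_real_eq_iff by blast
  thus ?thesis by (simp add: power2_eq_iff_nonneg)
qed

end

instantiation complex :: chilbert
begin
definition "scaleC (a::complex) (x::complex) = a * x"
definition "cinner (x::complex) (y::complex) = x * cnj y"
instance
  by standard
    (auto simp: scaleC_complex_def cinner_complex_def algebra_simps scaleR_conv_of_real cmod_def
      power2_eq_square)
end

subsection \<open>Square-summable families\<close>

typedef 'a ell2 = "{f :: 'a \<Rightarrow> complex. (\<lambda>i. (cmod (f i))\<^sup>2) summable_on UNIV}"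
  morphisms ell2_coeff Abs_ell2
  by (rule exI[of _ "\<lambda>_. 0"]) simp

setup_lifting type_definition_ell2

lemma ell2_iff_bounded:
  "(\<lambda>i. (cmod (f i))\<^sup>2) summable_on UNIV \<longleftrightarrow> (\<exists>C. \<forall>F. finite F \<longrightarrow> L2_set (\<lambda>i. cmod (f i)) F \<le> C)"
proof
  assume s: "(\<lambda>i. (cmod (f i))\<^sup>2) summable_on UNIV"
  have "L2_set (\<lambda>i. cmod (f i)) F \<le> sqrt (\<Sum>\<^sub>\<infinity>i. (cmod (f i))\<^sup>2)" if "finite F" for F
    unfolding L2_set_def by (rule real_sqrt_le_mono, rule finite_sum_le_infsum[OF s that]) auto
  thus "\<exists>C. \<forall>F. finite F \<longrightarrow> L2_set (\<lambda>i. cmod (f i)) F \<le> C" by blast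
next
  assume "\<exists>C. \<forall>F. finite F \<longrightarrow> L2_set (\<lambda>i. cmod (f i)) F \<le> C"
  then obtain C where C: "\<And>F. finite F \<Longrightarrow> L2_set (\<lambda>i. cmod (f i)) F \<le> C" by blast
  have "(\<Sum>i\<in>F. (cmod (f i))\<^sup>2) \<le> C\<^sup>2" if "finite F" for F
    using C[OF that] unfolding L2_set_def
    by (metis real_sqrt_le_iff real_sqrt_abs abs_ge_self order_trans)
  thus "(\<lambda>i. (cmod (f i))\<^sup>2) summable_on UNIV"
    by (intro nonneg_bdd_above_summable_on bdd_aboveI[where M="C\<^sup>2"]) auto
qed

lemma infsum_le_of_L2:
  assumes "\<And>F. finite F \<Longrightarrow> L2_set (\<lambda>i. cmod (f i)) F \<le> C"
  shows "sqrt (\<Sum>\<^sub>\<infinity>i. (cmod (f i))\<^sup>2) \<le> C"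
proof -
  have C0: "0 \<le> C" using assms[of "{}"] by simp
  have "(\<Sum>\<^sub>\<infinity>i. (cmod (f i))\<^sup>2) \<le> C\<^sup>2"
  proof (rule infsum_le_finite_sums)
    show "(\<lambda>i. (cmod (f i))\<^sup>2) summable_on UNIV" using assms ell2_iff_bounded by blast
    show "(\<Sum>i\<in>F. (cmod (f i))\<^sup>2) \<le> C\<^sup>2" if "finite F" for F
      using assms[OF that] unfolding L2_set_def
      by (metis real_sqrt_le_iff real_sqrt_abs abs_ge_self order_trans)
  qed
  thus ?thesis using C0 by (simp add: real_le_lsqrt real_sqrt_le_iff)
qed

lemma L2_add: "L2_set (\<lambda>i. cmod (f i + g i)) F \<le> L2_set (\<lambda>i. cmod (f i)) F + L2_set (\<lambda>i. cmod (g i)) F"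
  by (rule order_trans[OF _ L2_set_triangle_ineq]) (intro L2_set_mono norm_triangle_ineq norm_ge_zero)

lemma L2_scale: "L2_set (\<lambda>i. cmod (a * f i)) F = cmod a * L2_set (\<lambda>i. cmod (f i)) F"
  unfolding norm_mult by (simp add: L2_set_right_distrib)

lemma ell2_add:
  assumes "(\<lambda>i. (cmod (f i))\<^sup>2) summable_on UNIV" "(\<lambda>i. (cmod (g i))\<^sup>2) summable_on UNIV"
  shows "(\<lambda>i. (cmod (f i + g i))\<^sup>2) summable_on UNIV"
proof -
  obtain C D where "\<And>F. finite F \<Longrightarrow> L2_set (\<lambda>i. cmod (f i)) F \<le> C"
      "\<And>F. finite F \<Longrightarrow> L2_set (\<lambda>i. cmod (g i)) F \<le> D"
    using assms unfolding ell2_iff_bounded by blast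
  hence "\<forall>F. finite F \<longrightarrow> L2_set (\<lambda>i. cmod (f i + g i)) F \<le> C + D"
    by (metis L2_add add_mono order_trans)
  thus ?thesis unfolding ell2_iff_bounded by blast
qed

lemma ell2_scale:
  assumes "(\<lambda>i. (cmod (f i))\<^sup>2) summable_on UNIV"
  shows "(\<lambda>i. (cmod (a * f i))\<^sup>2) summable_on UNIV"
  unfolding norm_mult power_mult_distrib by (rule summable_on_cmult_right[OF assms])

lemma ell2_prod_summable:
  assumes "(\<lambda>i. (cmod (f i))\<^sup>2) summable_on UNIV" "(\<lambda>i. (cmod (g i))\<^sup>2) summable_on UNIV"
  shows "(\<lambda>i. f i * cnj (g i)) summable_on UNIV"
proof (rule abs_summable_summable, rule summable_on_comparison_test)
  show "(\<lambda>i. (cmod (f i))\<^sup>2 + (cmod (g i))\<^sup>2) summable_on UNIV"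
    by (rule summable_on_add[OF assms])
  fix i
  have "2 * (cmod (f i) * cmod (g i)) \<le> (cmod (f i))\<^sup>2 + (cmod (g i))\<^sup>2"
    using sum_squares_bound[of "cmod (f i)" "cmod (g i)"] by (simp add: mult.assoc)
  moreover have "0 \<le> cmod (f i) * cmod (g i)" by simp
  ultimately show "cmod (f i * cnj (g i)) \<le> (cmod (f i))\<^sup>2 + (cmod (g i))\<^sup>2"
    by (simp only: norm_mult complex_mod_cnj)
qed auto

instantiation ell2 :: (type) ab_group_add
begin
lift_definition zero_ell2 :: "'a ell2" is "\<lambda>_. 0" by simp
lift_definition plus_ell2 :: "'a ell2 \<Rightarrow> 'a ell2 \<Rightarrow> 'a ell2" is "\<lambda>f g i. f i + g i"
  by (rule ell2_add)
lift_definition uminus_ell2 :: "'a ell2 \<Rightarrow> 'a ell2" is "\<lambda>f i. - f i" by simp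
lift_definition minus_ell2 :: "'a ell2 \<Rightarrow> 'a ell2 \<Rightarrow> 'a ell2" is "\<lambda>f g i. f i - g i"
  using ell2_add[of _ "\<lambda>i. - _ i"] by simp
instance by standard (transfer; auto simp: fun_eq_iff)+
end

instantiation ell2 :: (type) real_vector
begin
lift_definition scaleR_ell2 :: "real \<Rightarrow> 'a ell2 \<Rightarrow> 'a ell2" is "\<lambda>r f i. complex_of_real r * f i"
  by (rule ell2_scale)
instance by standard (transfer; auto simp: algebra_simps)+
end

instantiation ell2 :: (type) real_normed_vector
begin
lift_definition norm_ell2 :: "'a ell2 \<Rightarrow> real" is "\<lambda>f. sqrt (\<Sum>\<^sub>\<infinity>i. (cmod (f i))\<^sup>2)" .
definition "sgn_ell2 (x :: 'a ell2) = x /\<^sub>R norm x"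
definition "dist_ell2 (x :: 'a ell2) y = norm (x - y)"
definition "uniformity_ell2 = (INF e\<in>{0 <..}. principal {(x :: 'a ell2, y). dist x y < e})"
definition "open_ell2 (U :: 'a ell2 set) \<longleftrightarrow>
  (\<forall>x\<in>U. eventually (\<lambda>(x', y). x' = x \<longrightarrow> y \<in> U) uniformity)"
instance
proof
  fix x y :: "'a ell2" and a :: real
  show "norm x = 0 \<longleftrightarrow> x = 0"
  proof transfer
    fix f :: "'a \<Rightarrow> complex" assume s: "(\<lambda>i. (cmod (f i))\<^sup>2) summable_on UNIV"
    show "sqrt (\<Sum>\<^sub>\<infinity>i. (cmod (f i))\<^sup>2) = 0 \<longleftrightarrow> f = (\<lambda>_. 0)"
    proof
      assume "sqrt (\<Sum>\<^sub>\<infinity>i. (cmod (f i))\<^sup>2) = 0"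
      hence 0: "(\<Sum>\<^sub>\<infinity>i. (cmod (f i))\<^sup>2) = 0" by simp
      have "(\<Sum>i\<in>{j}. (cmod (f i))\<^sup>2) \<le> (\<Sum>\<^sub>\<infinity>i. (cmod (f i))\<^sup>2)" for j
        by (rule finite_sum_le_infsum[OF s]) auto
      thus "f = (\<lambda>_. 0)" unfolding 0 by (auto simp: fun_eq_iff)
    qed simp
  qed
  show "norm (x + y) \<le> norm x + norm y"
  proof transfer
    fix f g :: "'a \<Rightarrow> complex"
    assume s: "(\<lambda>i. (cmod (f i))\<^sup>2) summable_on UNIV" "(\<lambda>i. (cmod (g i))\<^sup>2) summable_on UNIV"
    have le: "L2_set (\<lambda>i. cmod (h i)) F \<le> sqrt (\<Sum>\<^sub>\<infinity>i. (cmod (h i))\<^sup>2)"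
      if "(\<lambda>i. (cmod (h i))\<^sup>2) summable_on UNIV" "finite F" for h :: "'a \<Rightarrow> complex" and F
      unfolding L2_set_def by (rule real_sqrt_le_mono, rule finite_sum_le_infsum) (use that in auto)
    show "sqrt (\<Sum>\<^sub>\<infinity>i. (cmod (f i + g i))\<^sup>2)
        \<le> sqrt (\<Sum>\<^sub>\<infinity>i. (cmod (f i))\<^sup>2) + sqrt (\<Sum>\<^sub>\<infinity>i. (cmod (g i))\<^sup>2)"
      by (rule infsum_le_of_L2, rule order_trans[OF L2_add]) (intro add_mono le s)
  qed
  show "norm (a *\<^sub>R x) = \<bar>a\<bar> * norm x"
    by transfer (simp add: norm_mult power_mult_distrib infsum_cmult_right' real_sqrt_mult)
qed (simp_all add: sgn_ell2_def dist_ell2_def uniformity_ell2_def open_ell2_def)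
end

lemma ell2_L2_le_norm: "finite F \<Longrightarrow> L2_set (\<lambda>i. cmod (ell2_coeff x i)) F \<le> norm x"
  unfolding norm_ell2.rep_eq L2_set_def using ell2_coeff[of x]
  by (intro real_sqrt_le_mono finite_sum_le_infsum) auto

instance ell2 :: (type) banach
proof
  fix X :: "nat \<Rightarrow> 'a ell2"
  assume X: "Cauchy X"
  have coeff_le: "cmod (ell2_coeff x i) \<le> norm x" for x :: "'a ell2" and i
    using ell2_L2_le_norm[of "{i}" x] by simp
  have "Cauchy (\<lambda>n. ell2_coeff (X n) i)" for i
    unfolding Cauchy_def dist_norm
  proof (intro allI impI)
    fix e :: real assume "e > 0"
    then obtain N where N: "\<And>m n. m \<ge> N \<Longrightarrow> n \<ge> N \<Longrightarrow> norm (X m - X n) < e"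
      using X unfolding Cauchy_iff by blast
    have "cmod (ell2_coeff (X m) i - ell2_coeff (X n) i) < e" if "m \<ge> N" "n \<ge> N" for m n
      using order_le_less_trans[OF coeff_le[of "X m - X n" i] N[OF that]]
      by (simp add: minus_ell2.rep_eq)
    thus "\<exists>M. \<forall>m\<ge>M. \<forall>n\<ge>M. cmod (ell2_coeff (X m) i - ell2_coeff (X n) i) < e" by blast
  qed
  hence "\<forall>i. \<exists>l. (\<lambda>n. ell2_coeff (X n) i) \<longlonglongrightarrow> l" by (simp add: Cauchy_convergent_iff convergent_def)
  then obtain l where l: "\<And>i. (\<lambda>n. ell2_coeff (X n) i) \<longlonglongrightarrow> l i" by metis
  have key: "\<exists>N. \<forall>n\<ge>N. \<forall>F. finite F \<longrightarrow> L2_set (\<lambda>i. cmod (ell2_coeff (X n) i - l i)) F \<le> e"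
    if "e > 0" for e
  proof -
    obtain N where N: "\<And>m n. m \<ge> N \<Longrightarrow> n \<ge> N \<Longrightarrow> norm (X m - X n) < e"
      using X \<open>e > 0\<close> unfolding Cauchy_iff by blast
    have "L2_set (\<lambda>i. cmod (ell2_coeff (X n) i - l i)) F \<le> e" if "n \<ge> N" "finite F" for n F
    proof (rule tendsto_upperbound)
      show "(\<lambda>m. L2_set (\<lambda>i. cmod (ell2_coeff (X n) i - ell2_coeff (X m) i)) F)
          \<longlonglongrightarrow> L2_set (\<lambda>i. cmod (ell2_coeff (X n) i - l i)) F"
        unfolding L2_set_def by (intro tendsto_intros l)
      show "\<forall>\<^sub>F m in sequentially. L2_set (\<lambda>i. cmod (ell2_coeff (X n) i - ell2_coeff (X m) i)) F \<le> e"
        unfolding eventually_sequentially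
      proof (intro exI[of _ N] allI impI)
        fix m assume "m \<ge> N"
        from ell2_L2_le_norm[OF \<open>finite F\<close>, of "X n - X m"] N[OF \<open>n \<ge> N\<close> this]
        show "L2_set (\<lambda>i. cmod (ell2_coeff (X n) i - ell2_coeff (X m) i)) F \<le> e"
          by (simp add: minus_ell2.rep_eq)
      qed
    qed simp
    thus ?thesis by blast
  qed
  obtain N where N: "\<forall>F. finite F \<longrightarrow> L2_set (\<lambda>i. cmod (ell2_coeff (X N) i - l i)) F \<le> 1"
    using key[of 1] by auto
  hence "(\<lambda>i. (cmod (ell2_coeff (X N) i - l i))\<^sup>2) summable_on UNIV"
    unfolding ell2_iff_bounded by blast
  hence "(\<lambda>i. (cmod (- 1 * (ell2_coeff (X N) i - l i)))\<^sup>2) summable_on UNIV" by (rule ell2_scale)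
  from ell2_add[OF this, of "ell2_coeff (X N)"] ell2_coeff[of "X N"]
  have lsum: "(\<lambda>i. (cmod (l i))\<^sup>2) summable_on UNIV" by simp
  define L where "L = Abs_ell2 l"
  have L: "ell2_coeff L = l" unfolding L_def using lsum by (simp add: Abs_ell2_inverse)
  have "X \<longlonglongrightarrow> L"
  proof (rule LIMSEQ_I)
    fix e :: real assume "e > 0"
    then obtain N where N: "\<And>n F. n \<ge> N \<Longrightarrow> finite F \<Longrightarrow>
        L2_set (\<lambda>i. cmod (ell2_coeff (X n) i - l i)) F \<le> e / 2"
      using key[of "e/2"] by auto
    have "norm (X n - L) \<le> e / 2" if "n \<ge> N" for n
      unfolding norm_ell2.rep_eq minus_ell2.rep_eq L by (rule infsum_le_of_L2) (rule N[OF that])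
    thus "\<exists>N. \<forall>n\<ge>N. norm (X n - L) < e" using \<open>e > 0\<close> by (intro exI[of _ N]) force
  qed
  thus "convergent X" unfolding convergent_def by blast
qed

instantiation ell2 :: (type) chilbert
begin
lift_definition scaleC_ell2 :: "complex \<Rightarrow> 'a ell2 \<Rightarrow> 'a ell2" is "\<lambda>c f i. c * f i"
  by (rule ell2_scale)
lift_definition cinner_ell2 :: "'a ell2 \<Rightarrow> 'a ell2 \<Rightarrow> complex"
  is "\<lambda>f g. \<Sum>\<^sub>\<infinity>i. f i * cnj (g i)" .
instance
proof
  fix x y z :: "'a ell2" and a b :: complex and r :: real
  show "scaleC a (x + y) = scaleC a x + scaleC a y" by transfer (auto simp: algebra_simps)
  show "scaleC (a + b) x = scaleC a x + scaleC b x" by transfer (auto simp: algebra_simps)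
  show "scaleC a (scaleC b x) = scaleC (a * b) x" by transfer (auto simp: algebra_simps)
  show "scaleC 1 x = x" by transfer simp
  show "r *\<^sub>R x = scaleC (complex_of_real r) x" by transfer simp
  show "cinner x y = cnj (cinner y x)"
    by transfer (simp add: infsum_cnj[symmetric] mult.commute)
  show "cinner (x + y) z = cinner x z + cinner y z"
    by transfer (simp add: infsum_add[symmetric] ell2_prod_summable algebra_simps)
  show "cinner (scaleC a x) y = a * cinner x y"
    by transfer (simp add: infsum_cmult_right'[symmetric] mult.assoc)
  show "norm x = sqrt (Re (cinner x x))"
  proof transfer
    fix f :: "'a \<Rightarrow> complex" assume f: "(\<lambda>i. (cmod (f i))\<^sup>2) summable_on UNIV"
    have "(\<Sum>\<^sub>\<infinity>i. f i * cnj (f i)) = (\<Sum>\<^sub>\<infinity>i. complex_of_real ((cmod (f i))\<^sup>2))"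
      by (simp only: complex_norm_square)
    also have "\<dots> = complex_of_real (\<Sum>\<^sub>\<infinity>i. (cmod (f i))\<^sup>2)"
      by (rule infsumI, rule has_sum_of_real, rule has_sum_infsum) (rule f)
    finally show "sqrt (\<Sum>\<^sub>\<infinity>i. (cmod (f i))\<^sup>2) = sqrt (Re (\<Sum>\<^sub>\<infinity>i. f i * cnj (f i)))" by simp
  qed
qed
end

lift_definition ell2_ket :: "'a \<Rightarrow> 'a ell2" is "\<lambda>a i. if i = a then 1 else 0"
proof -
  fix a :: 'a
  have "(\<lambda>i. (cmod (if i = a then 1 else 0 :: complex))\<^sup>2) summable_on {a}" by simp
  thus "(\<lambda>i. (cmod (if i = a then 1 else 0 :: complex))\<^sup>2) summable_on UNIV"
    by (rule summable_on_cong_neutral[THEN iffD1, rotated -1]) auto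
qed


subsection \<open>Orthonormal bases\<close>

definition orthonormal :: "'a::chilbert set \<Rightarrow> bool" where
  "orthonormal B \<longleftrightarrow> (\<forall>b\<in>B. \<forall>c\<in>B. cinner b c = (if b = c then 1 else 0))"

definition is_onb :: "'a::chilbert set \<Rightarrow> bool" where
  "is_onb B \<longleftrightarrow> orthonormal B \<and> (\<forall>x. (\<forall>b\<in>B. cinner x b = 0) \<longrightarrow> x = 0)"

lemma ex_onb: "\<exists>B :: 'a::chilbert set. is_onb B"
proof -
  have "\<exists>M\<in>{B :: 'a set. orthonormal B}. \<forall>X\<in>{B. orthonormal B}. M \<subseteq> X \<longrightarrow> X = M"
  proof (rule subset_Zorn')
    fix C :: "'a set set"
    assume "subset.chain {B. orthonormal B} C"
    hence C: "\<And>X. X \<in> C \<Longrightarrow> orthonormal X" "\<And>X Y. X \<in> C \<Longrightarrow> Y \<in> C \<Longrightarrow> X \<subseteq> Y \<or> Y \<subseteq> X"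
      unfolding subset.chain_def by auto
    have "cinner b c = (if b = c then 1 else 0)" if bc: "b \<in> \<Union>C" "c \<in> \<Union>C" for b c
    proof -
      obtain X Y where XY: "X \<in> C" "b \<in> X" "Y \<in> C" "c \<in> Y" using bc by blast
      then consider "b \<in> Y" | "c \<in> X" using C(2) by blast
      thus ?thesis using C(1) XY unfolding orthonormal_def by cases blast+
    qed
    thus "\<Union>C \<in> {B. orthonormal B}" unfolding orthonormal_def by blast
  qed
  then obtain M :: "'a set" where M: "orthonormal M"
    and max: "\<And>X. orthonormal X \<Longrightarrow> M \<subseteq> X \<Longrightarrow> X = M" by blast
  have "x = 0" if x: "\<forall>b\<in>M. cinner x b = 0" for x
  proof (rule ccontr)
    assume "x \<noteq> 0"
    define e where "e = scaleC (complex_of_real (1 / norm x)) x"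
    have e1: "cinner e e = 1"
      using \<open>x \<noteq> 0\<close> unfolding e_def cinner_scaleC_left cinner_scaleC_right cinner_self[of x]
      by (simp add: power2_eq_square)
    have e0: "cinner e b = 0" "cinner b e = 0" if "b \<in> M" for b
      using x that cinner_commute[of b x]
      by (auto simp: e_def cinner_scaleC_left cinner_scaleC_right)
    have "orthonormal (insert e M)"
      using M e1 e0 unfolding orthonormal_def by auto
    hence "e \<in> M" using max[of "insert e M"] by blast
    thus False using e0(1)[of e] e1 by simp
  qed
  thus ?thesis using M unfolding is_onb_def by blast
qed

definition onb :: "'a::chilbert set" where
  "onb = (SOME B. is_onb B)"

lemma is_onb_onb: "is_onb onb"
  unfolding onb_def by (rule someI_ex[OF ex_onb])

lemma bessel:
  assumes B: "orthonormal B" and F: "finite F" "F \<subseteq> B"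
  shows "(\<Sum>b\<in>F. (cmod (cinner x b))\<^sup>2) \<le> (norm x)\<^sup>2"
proof -
  define p where "p = (\<Sum>b\<in>F. scaleC (cinner x b) b)"
  define S where "S = (\<Sum>b\<in>F. (cmod (cinner x b))\<^sup>2)"
  have S: "complex_of_real S = (\<Sum>b\<in>F. cinner x b * cnj (cinner x b))"
    unfolding S_def by (simp only: of_real_sum complex_norm_square)
  have xp: "cinner x p = of_real S"
    unfolding p_def S by (simp add: cinner_sum_right cinner_scaleC_right mult.commute)
  have bp: "cinner b p = cnj (cinner x b)" if "b \<in> F" for b
  proof -
    have "cinner b p = (\<Sum>c\<in>F. cnj (cinner x c) * cinner b c)"
      unfolding p_def by (simp add: cinner_sum_right cinner_scaleC_right)
    also have "\<dots> = (\<Sum>c\<in>F. if c = b then cnj (cinner x c) else 0)"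
      using B F(2) that unfolding orthonormal_def by (intro sum.cong) (auto simp: subset_iff)
    finally show ?thesis using that F(1) by simp
  qed
  have "cinner p p = (\<Sum>b\<in>F. cinner x b * cinner b p)"
    by (subst (1) p_def) (simp add: cinner_sum_left cinner_scaleC_left)
  also have "\<dots> = of_real S" unfolding S by (rule sum.cong) (simp_all add: bp)
  finally have pp: "cinner p p = of_real S" .
  have px: "cinner p x = of_real S" using cinner_commute[of p x] xp by simp
  have "cinner (x - p) (x - p) = of_real ((norm x)\<^sup>2 - S)"
    by (simp add: cinner_diff_left cinner_diff_right xp pp px cinner_self[of x])
  hence "complex_of_real ((norm (x - p))\<^sup>2) = of_real ((norm x)\<^sup>2 - S)"
    by (simp only: cinner_self)
  hence "(norm (x - p))\<^sup>2 = (norm x)\<^sup>2 - S" using of_real_eq_iff by blast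
  thus ?thesis unfolding S_def by (metis diff_ge_0_iff_ge zero_le_power2)
qed


section \<open>Bounded operators\<close>

typedef (overloaded) ('a::chilbert, 'b::chilbert) cblop =
  "{T :: 'a \<Rightarrow> 'b. bounded_linear T \<and> (\<forall>c x. T (scaleC c x) = scaleC c (T x))}"
  morphisms cblop_apply Abs_cblop
  by (rule exI[of _ "\<lambda>_. 0"]) (simp add: scaleC_zero_right)

setup_lifting type_definition_cblop

lemma bounded_linear_scaleC: "bounded_linear (\<lambda>x :: 'a::chilbert. scaleC c x)"
proof
  show "\<exists>K. \<forall>x. norm (scaleC c x) \<le> norm x * K"
    by (rule exI[of _ "cmod c"]) (simp add: norm_scaleC mult.commute)
qed (simp_all add: scaleC_add_right scaleR_scaleC scaleC_scaleC mult.commute)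

instantiation cblop :: (chilbert, chilbert) ab_group_add
begin
lift_definition zero_cblop :: "('a, 'b) cblop" is "\<lambda>_. 0" by (simp add: scaleC_zero_right)
lift_definition plus_cblop :: "('a, 'b) cblop \<Rightarrow> ('a, 'b) cblop \<Rightarrow> ('a, 'b) cblop"
  is "\<lambda>S T x. S x + T x" by (simp add: bounded_linear_add scaleC_add_right)
lift_definition uminus_cblop :: "('a, 'b) cblop \<Rightarrow> ('a, 'b) cblop"
  is "\<lambda>T x. - T x" by (simp add: bounded_linear_minus scaleC_minus_right)
lift_definition minus_cblop :: "('a, 'b) cblop \<Rightarrow> ('a, 'b) cblop \<Rightarrow> ('a, 'b) cblop"
  is "\<lambda>S T x. S x - T x"
  using scaleC_add_right[where 'a = 'b, of _ _ "- _"]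
  by (simp add: bounded_linear_sub scaleC_minus_right)
instance by standard (transfer; simp add: fun_eq_iff)+
end

lift_definition op_scale :: "complex \<Rightarrow> ('a::chilbert, 'b::chilbert) cblop \<Rightarrow> ('a, 'b) cblop"
  is "\<lambda>c T x. scaleC c (T x)"
  by (auto intro: bounded_linear_compose[OF bounded_linear_scaleC] simp: scaleC_scaleC mult.commute)

lemma vector_space_op_scale: "vector_space (op_scale :: _ \<Rightarrow> ('a::chilbert, 'b::chilbert) cblop \<Rightarrow> _)"
  by standard (transfer; simp add: fun_eq_iff scaleC_add_right scaleC_add_left scaleC_scaleC scaleC_one)+

lift_definition op_id :: "('a::chilbert, 'a) cblop" is "\<lambda>x. x" by (simp add: bounded_linear_ident)

lift_definition op_comp ::
    "('b::chilbert, 'c::chilbert) cblop \<Rightarrow> ('a::chilbert, 'b) cblop \<Rightarrow> ('a, 'c) cblop"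
  is "\<lambda>S T x. S (T x)" by (simp add: bounded_linear_compose)

text \<open>The operator \<open>c \<mapsto> c h\<close>; this is the identification of a Hilbert space \<open>H\<close>
  with \<open>L(\<complex>, H)\<close>.\<close>

lift_definition op_of_vec :: "'b::chilbert \<Rightarrow> (complex, 'b) cblop" is "\<lambda>h c. scaleC c h"
proof -
  fix h :: 'b
  have "bounded_linear (\<lambda>c. scaleC c h)"
  proof
    show "\<exists>K. \<forall>c. norm (scaleC c h) \<le> norm c * K"
      by (rule exI[of _ "norm h"]) (simp add: norm_scaleC)
  qed (simp_all add: scaleC_add_left scaleR_scaleC scaleC_scaleC scaleC_complex_def)
  thus "bounded_linear (\<lambda>c. scaleC c h) \<and> (\<forall>c x. scaleC (scaleC c x) h = scaleC c (scaleC x h))"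
    by (simp add: scaleC_complex_def scaleC_scaleC)
qed

text \<open>By the Riesz representation theorem every bounded operator has exactly one adjoint.\<close>

definition op_adj :: "('a::chilbert, 'b::chilbert) cblop \<Rightarrow> ('b, 'a) cblop" where
  "op_adj T = (THE S. \<forall>x y. cinner (cblop_apply T x) y = cinner x (cblop_apply S y))"


section \<open>Operator matrices\<close>

text \<open>An element of \<open>L(H, K)\<^sup>n\<^sup>\<times>\<^sup>m\<close> is a matrix of operators. It acts from \<open>H\<^sup>m\<close> to \<open>K\<^sup>n\<close>, whose
  elements are vectors over \<open>H\<close> and \<open>K\<close>.\<close>

definition vec_cinner :: "'a::chilbert vec \<Rightarrow> 'a vec \<Rightarrow> complex" where
  "vec_cinner x y = (\<Sum>i<dim_vec x. cinner (x $ i) (y $ i))"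

definition vec_norm :: "'a::chilbert vec \<Rightarrow> real" where
  "vec_norm x = sqrt (Re (vec_cinner x x))"

definition opmat_apply :: "('a::chilbert, 'b::chilbert) cblop mat \<Rightarrow> 'a vec \<Rightarrow> 'b vec" where
  "opmat_apply A x = vec (dim_row A) (\<lambda>i. \<Sum>j<dim_col A. cblop_apply (A $$ (i, j)) (x $ j))"

definition opmat_mult ::
    "('b::chilbert, 'c::chilbert) cblop mat \<Rightarrow> ('a::chilbert, 'b) cblop mat \<Rightarrow> ('a, 'c) cblop mat" where
  "opmat_mult A B =
    mat (dim_row A) (dim_col B) (\<lambda>(i, j). \<Sum>k<dim_col A. op_comp (A $$ (i, k)) (B $$ (k, j)))"

definition opmat_adj :: "('a::chilbert, 'b::chilbert) cblop mat \<Rightarrow> ('b, 'a) cblop mat" where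
  "opmat_adj A = mat (dim_col A) (dim_row A) (\<lambda>(i, j). op_adj (A $$ (j, i)))"

definition opmat_norm :: "('a::chilbert, 'b::chilbert) cblop mat \<Rightarrow> real" where
  "opmat_norm A = (SUP x\<in>{x \<in> carrier_vec (dim_col A). vec_norm x \<le> 1}. vec_norm (opmat_apply A x))"

definition opmat_positive :: "('a::chilbert, 'a) cblop mat \<Rightarrow> bool" where
  "opmat_positive A \<longleftrightarrow>
    dim_row A = dim_col A \<and>
    (\<forall>x\<in>carrier_vec (dim_col A). vec_cinner (opmat_apply A x) x \<in> \<real>\<^sub>\<ge>\<^sub>0)"

text \<open>\<open>P \<otimes> I\<^sub>H\<close> for a complex matrix \<open>P\<close>.\<close>

definition ampl :: "complex mat \<Rightarrow> ('a::chilbert, 'a) cblop mat" where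
  "ampl P = map_mat (\<lambda>c. op_scale c op_id) P"


section \<open>Noncommutative functions\<close>

text \<open>Products of a complex matrix with a matrix over a complex vector space with scalar
  multiplication \<open>s\<close>.\<close>

definition lmult :: "(complex \<Rightarrow> 'v::ab_group_add \<Rightarrow> 'v) \<Rightarrow> complex mat \<Rightarrow> 'v mat \<Rightarrow> 'v mat" where
  "lmult s A Z = mat (dim_row A) (dim_col Z) (\<lambda>(i, j). \<Sum>k<dim_row Z. s (A $$ (i, k)) (Z $$ (k, j)))"

definition rmult :: "(complex \<Rightarrow> 'v::ab_group_add \<Rightarrow> 'v) \<Rightarrow> 'v mat \<Rightarrow> complex mat \<Rightarrow> 'v mat" where
  "rmult s Z A = mat (dim_row Z) (dim_col A) (\<lambda>(i, j). \<Sum>k<dim_col Z. s (A $$ (k, j)) (Z $$ (i, k)))"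

definition nc_space :: "'v mat set" where
  "nc_space = (\<Union>n\<in>{1..}. carrier_mat n n)"

definition closed_dsum :: "'v::zero mat set \<Rightarrow> bool" where
  "closed_dsum \<Omega> \<longleftrightarrow>
    (\<forall>Z\<in>\<Omega>. \<forall>W\<in>\<Omega>. four_block_mat Z (0\<^sub>m (dim_row Z) (dim_col W)) (0\<^sub>m (dim_row W) (dim_col Z)) W \<in> \<Omega>)"

definition full_nc_subset :: "(complex \<Rightarrow> 'v::ab_group_add \<Rightarrow> 'v) \<Rightarrow> 'v mat set \<Rightarrow> bool" where
  "full_nc_subset s \<Xi> \<longleftrightarrow>
    \<Xi> \<subseteq> nc_space \<and> closed_dsum \<Xi> \<and>
    (\<forall>Z\<in>\<Xi>. \<forall>Z'\<in>nc_space. \<forall>J\<in>carrier_mat (dim_row Z) (dim_row Z').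
      inj_on (\<lambda>x. J *\<^sub>v x) (carrier_vec (dim_row Z')) \<and> lmult s J Z' = rmult s Z J \<longrightarrow> Z' \<in> \<Xi>)"

definition graded :: "'v mat set \<Rightarrow> ('v mat \<Rightarrow> 'w mat) \<Rightarrow> bool" where
  "graded \<Omega> f \<longleftrightarrow> (\<forall>n. \<forall>Z\<in>\<Omega> \<inter> carrier_mat n n. f Z \<in> carrier_mat n n)"

definition nc_function ::
    "(complex \<Rightarrow> 'v::ab_group_add \<Rightarrow> 'v) \<Rightarrow> (complex \<Rightarrow> 'w::ab_group_add \<Rightarrow> 'w) \<Rightarrow>
      'v mat set \<Rightarrow> ('v mat \<Rightarrow> 'w mat) \<Rightarrow> bool" where
  "nc_function s s0 \<Omega> f \<longleftrightarrow>
    graded \<Omega> f \<and>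
    (\<forall>Z\<in>\<Omega>. \<forall>Z'\<in>\<Omega>. \<forall>A\<in>carrier_mat (dim_row Z') (dim_row Z).
      lmult s A Z = rmult s Z' A \<longrightarrow> lmult s0 A (f Z) = rmult s0 (f Z') A)"


section \<open>Kernels\<close>

text \<open>The value \<open>K(Z, W) \<in> L(\<complex>\<^sup>n\<^sup>\<times>\<^sup>m, L(H)\<^sup>n\<^sup>\<times>\<^sup>m)\<close> of an nc kernel is meaningful only on
  complex matrices of size \<open>n \<times> m\<close>.\<close>

type_synonym ('v, 'h) nc_ker = "'v mat \<Rightarrow> 'v mat \<Rightarrow> complex mat \<Rightarrow> ('h, 'h) cblop mat"

definition nc_kernel ::
    "(complex \<Rightarrow> 'v::ab_group_add \<Rightarrow> 'v) \<Rightarrow> 'v mat set \<Rightarrow> ('v, 'h::chilbert) nc_ker \<Rightarrow> bool" where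
  "nc_kernel s \<Omega> K \<longleftrightarrow>
    (\<forall>Z\<in>\<Omega>. \<forall>W\<in>\<Omega>. \<forall>P\<in>carrier_mat (dim_row Z) (dim_row W).
      K Z W P \<in> carrier_mat (dim_row Z) (dim_row W) \<and>
      (\<forall>P'\<in>carrier_mat (dim_row Z) (dim_row W). K Z W (P + P') = K Z W P + K Z W P') \<and>
      (\<forall>c. K Z W (c \<cdot>\<^sub>m P) = map_mat (op_scale c) (K Z W P))) \<and>
    (\<forall>Z\<in>\<Omega>. \<forall>Z'\<in>\<Omega>. \<forall>W\<in>\<Omega>. \<forall>W'\<in>\<Omega>.
      \<forall>A\<in>carrier_mat (dim_row Z') (dim_row Z). \<forall>B\<in>carrier_mat (dim_row W') (dim_row W).
      \<forall>P\<in>carrier_mat (dim_row Z) (dim_row W).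
        lmult s A Z = rmult s Z' A \<and> lmult s B W = rmult s W' B \<longrightarrow>
        rmult op_scale (lmult op_scale A (K Z W P)) (mat_adjoint B) = K Z' W' (A * P * mat_adjoint B))"

text \<open>For points \<open>Z\<^sub>0, \<dots>, Z\<^sub>l\<close> of sizes \<open>m\<^sub>0, \<dots>, m\<^sub>l\<close> and \<open>N = \<Sum>m\<^sub>i\<close>, row (or column) \<open>r < N\<close> of an
  \<open>N \<times> N\<close> block matrix belongs to the block \<open>blk_index\<close>, at position \<open>r - blk_offset\<close> of that
  block.\<close>

definition blk_offset :: "'v mat list \<Rightarrow> nat \<Rightarrow> nat" where
  "blk_offset Zs i = (\<Sum>j<i. dim_row (Zs ! j))"

definition blk_index :: "'v mat list \<Rightarrow> nat \<Rightarrow> nat" where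
  "blk_index Zs r = (LEAST i. r < blk_offset Zs (Suc i))"

definition blk :: "'v mat list \<Rightarrow> complex mat \<Rightarrow> nat \<Rightarrow> nat \<Rightarrow> complex mat" where
  "blk Zs P i j = mat (dim_row (Zs ! i)) (dim_row (Zs ! j))
    (\<lambda>(p, q). P $$ (blk_offset Zs i + p, blk_offset Zs j + q))"

definition kernel_block :: "('v, 'h::chilbert) nc_ker \<Rightarrow> 'v mat list \<Rightarrow> complex mat \<Rightarrow> ('h, 'h) cblop mat" where
  "kernel_block K Zs P =
    mat (blk_offset Zs (length Zs)) (blk_offset Zs (length Zs))
      (\<lambda>(r, t). let i = blk_index Zs r; j = blk_index Zs t in
        K (Zs ! i) (Zs ! j) (blk Zs P i j) $$ (r - blk_offset Zs i, t - blk_offset Zs j))"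

definition cp_nc_kernel ::
    "(complex \<Rightarrow> 'v::ab_group_add \<Rightarrow> 'v) \<Rightarrow> 'v mat set \<Rightarrow> ('v, 'h::chilbert) nc_ker \<Rightarrow> bool" where
  "cp_nc_kernel s \<Omega> K \<longleftrightarrow>
    nc_kernel s \<Omega> K \<and>
    (\<forall>Zs. set Zs \<subseteq> \<Omega> \<longrightarrow>
      (\<forall>P\<in>carrier_mat (blk_offset Zs (length Zs)) (blk_offset Zs (length Zs)).
        opmat_positive (ampl P :: (complex, complex) cblop mat) \<longrightarrow>
        opmat_positive (kernel_block K Zs P)))"


section \<open>Reproducing kernel Hilbert spaces and multipliers\<close>

text \<open>Functions on \<open>D\<close> are made extensional, so that equality of functions is equality on \<open>D\<close>.\<close>

type_synonym ('v, 'h) nc_fun = "'v mat \<Rightarrow> (complex, 'h) cblop mat"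

definition fun_zero :: "'v mat set \<Rightarrow> ('v, 'h::chilbert) nc_fun" where
  "fun_zero D = (\<lambda>Z\<in>D. 0\<^sub>m (dim_row Z) (dim_row Z))"

definition fun_add :: "'v mat set \<Rightarrow> ('v, 'h::chilbert) nc_fun \<Rightarrow> ('v, 'h) nc_fun \<Rightarrow> ('v, 'h) nc_fun" where
  "fun_add D f g = (\<lambda>Z\<in>D. f Z + g Z)"

definition fun_scale :: "'v mat set \<Rightarrow> complex \<Rightarrow> ('v, 'h::chilbert) nc_fun \<Rightarrow> ('v, 'h) nc_fun" where
  "fun_scale D c f = (\<lambda>Z\<in>D. map_mat (op_scale c) (f Z))"

text \<open>\<open>F\<close> is a linear space of functions on \<open>D\<close> which is a Hilbert space for the inner product \<open>ip\<close>.\<close>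

definition hilbert_function_space ::
    "'v mat set \<Rightarrow> ('v, 'h::chilbert) nc_fun set \<Rightarrow>
      (('v, 'h) nc_fun \<Rightarrow> ('v, 'h) nc_fun \<Rightarrow> complex) \<Rightarrow> bool" where
  "hilbert_function_space D F ip \<longleftrightarrow>
    F \<subseteq> extensional D \<and>
    fun_zero D \<in> F \<and>
    (\<forall>f\<in>F. \<forall>g\<in>F. fun_add D f g \<in> F) \<and>
    (\<forall>c. \<forall>f\<in>F. fun_scale D c f \<in> F) \<and>
    (\<forall>f\<in>F. \<forall>g\<in>F. \<forall>h\<in>F. ip (fun_add D f g) h = ip f h + ip g h) \<and>
    (\<forall>c. \<forall>f\<in>F. \<forall>g\<in>F. ip (fun_scale D c f) g = c * ip f g) \<and>
    (\<forall>f\<in>F. \<forall>g\<in>F. ip f g = cnj (ip g f)) \<and>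
    (\<forall>f\<in>F. ip f f \<in> \<real>\<^sub>\<ge>\<^sub>0) \<and>
    (\<forall>f\<in>F. ip f f = 0 \<longrightarrow> f = fun_zero D) \<and>
    (let d = (\<lambda>f g. let h = fun_add D f (fun_scale D (- 1) g) in sqrt (Re (ip h h))) in
      \<forall>X :: nat \<Rightarrow> ('v, 'h) nc_fun. range X \<subseteq> F \<and> (\<forall>e>0. \<exists>M. \<forall>m\<ge>M. \<forall>n\<ge>M. d (X m) (X n) < e) \<longrightarrow>
        (\<exists>f\<in>F. (\<lambda>n. d (X n) f) \<longlonglongrightarrow> 0))"

text \<open>\<open>K\<^sub>W\<^sub>,\<^sub>v\<^sub>,\<^sub>y\<close> is determined by \<open>K\<^sub>W\<^sub>,\<^sub>v\<^sub>,\<^sub>y(Z) u = K(Z, W)(u v) y\<close> for column vectors \<open>u\<close>; its value at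
  \<open>Z\<close> is the matrix over \<open>L(\<complex>, H)\<close> whose \<open>j\<close>-th column is obtained from \<open>u = e\<^sub>j\<close>. The row
  vector \<open>v\<close> is represented by the vector of its entries.\<close>

definition outer_mat :: "complex vec \<Rightarrow> complex vec \<Rightarrow> complex mat" where
  "outer_mat u v = mat (dim_vec u) (dim_vec v) (\<lambda>(i, j). u $ i * v $ j)"

definition kernel_elt ::
    "'v mat set \<Rightarrow> ('v, 'h::chilbert) nc_ker \<Rightarrow> 'v mat \<Rightarrow> complex vec \<Rightarrow> 'h vec \<Rightarrow> ('v, 'h) nc_fun" where
  "kernel_elt D K W v y = (\<lambda>Z\<in>D. mat (dim_row Z) (dim_row Z)
    (\<lambda>(i, j). op_of_vec (opmat_apply (K Z W (outer_mat (unit_vec (dim_row Z) j) v)) y $ i)))"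

text \<open>\<open>F\<close> with inner product \<open>ip\<close> is the space \<open>H(K)\<close>.\<close>

definition nc_rkhs ::
    "(complex \<Rightarrow> 'v::ab_group_add \<Rightarrow> 'v) \<Rightarrow> 'v mat set \<Rightarrow> ('v, 'h::chilbert) nc_ker \<Rightarrow>
      ('v, 'h) nc_fun set \<Rightarrow> (('v, 'h) nc_fun \<Rightarrow> ('v, 'h) nc_fun \<Rightarrow> complex) \<Rightarrow> bool" where
  "nc_rkhs s D K F ip \<longleftrightarrow>
    hilbert_function_space D F ip \<and>
    (\<forall>f\<in>F. nc_function s op_scale D f) \<and>
    (\<forall>W\<in>D. \<forall>v\<in>carrier_vec (dim_row W). \<forall>y\<in>carrier_vec (dim_row W).
      kernel_elt D K W v y \<in> F \<and>
      (\<forall>f\<in>F. vec_cinner (opmat_apply (f W) (conjugate v)) y = ip f (kernel_elt D K W v y)))"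

text \<open>\<open>S\<close> is in the closed unit ball of the multipliers from \<open>H(K')\<close> to \<open>H(K)\<close>. The existential
  quantifiers only name these two spaces, which are unique (up to the irrelevant values of the
  inner products outside of them).\<close>

definition contractive_multiplier ::
    "(complex \<Rightarrow> 'v::ab_group_add \<Rightarrow> 'v) \<Rightarrow> 'v mat set \<Rightarrow> ('v, 'u::chilbert) nc_ker \<Rightarrow>
      ('v, 'y::chilbert) nc_ker \<Rightarrow> ('v mat \<Rightarrow> ('u, 'y) cblop mat) \<Rightarrow> bool" where
  "contractive_multiplier s D K' K S \<longleftrightarrow>
    (\<exists>F' ip' F ip. nc_rkhs s D K' F' ip' \<and> nc_rkhs s D K F ip \<and>
      (\<forall>f\<in>F'. let g = (\<lambda>W\<in>D. opmat_mult (S W) (f W)) in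
        g \<in> F \<and> sqrt (Re (ip g g)) \<le> sqrt (Re (ip' f f))))"


section \<open>Complete Pick kernels\<close>

text \<open>A scalar kernel takes values in complex matrices, via \<open>L(\<complex>) = \<complex>\<close>.\<close>

type_synonym 'v scalar_ker = "'v mat \<Rightarrow> 'v mat \<Rightarrow> complex mat \<Rightarrow> complex mat"

definition ker_ampl :: "'v scalar_ker \<Rightarrow> ('v, 'h::chilbert) nc_ker" where
  "ker_ampl k = (\<lambda>Z W P. ampl (k Z W P))"

definition de_branges_kernel ::
    "'v scalar_ker \<Rightarrow> ('v mat \<Rightarrow> ('u::chilbert, 'y::chilbert) cblop mat) \<Rightarrow> ('v, 'y) nc_ker" where
  "de_branges_kernel k S = (\<lambda>Z W P.
    ampl (k Z W P) - opmat_mult (opmat_mult (S Z) (ampl (k Z W P))) (opmat_adj (S W)))"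

text \<open>The Hilbert spaces \<open>U\<close> and \<open>Y\<close> of the definition are the type parameters \<open>'u\<close> and \<open>'y\<close>; a
  complete Pick kernel satisfies this for all types \<open>'u\<close> and \<open>'y\<close>. That \<open>D\<close> is closed under
  direct sums is presupposed by the construction of \<open>H(K)\<close>.\<close>

definition complete_pick_nc_kernel ::
    "'u::chilbert itself \<Rightarrow> 'y::chilbert itself \<Rightarrow>
      (complex \<Rightarrow> 'v::ab_group_add \<Rightarrow> 'v) \<Rightarrow> 'v mat set \<Rightarrow> 'v scalar_ker \<Rightarrow> bool" where
  "complete_pick_nc_kernel _ _ s D k \<longleftrightarrow>
    D \<subseteq> nc_space \<and> closed_dsum D \<and>
    cp_nc_kernel s D (ker_ampl k :: ('v, complex) nc_ker) \<and>
    (\<forall>\<Omega> (S0 :: 'v mat \<Rightarrow> ('u, 'y) cblop mat). \<Omega> \<subseteq> D \<and> graded \<Omega> S0 \<longrightarrow>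
      (\<exists>S. nc_function s op_scale D S \<and> contractive_multiplier s D (ker_ampl k) (ker_ampl k) S \<and>
        (\<forall>Z\<in>\<Omega>. S Z = S0 Z))
      \<longleftrightarrow> cp_nc_kernel s \<Omega> (de_branges_kernel k S0))"


section \<open>The kernel of an nc ball\<close>

text \<open>With a fixed orthonormal basis \<open>onb\<close> of \<open>R\<close>, the Hilbert space tensor power \<open>R\<^sup>\<otimes>\<^sup>k\<close> is the
  space of square-summable families indexed by the words of length \<open>k\<close> over \<open>onb\<close>. All
  tensor powers are subspaces of one type. For a vector \<open>x\<close> in \<open>R\<close> and \<open>y\<close> in the \<open>k\<close>-th
  tensor power, \<open>tensor_left x y\<close> is \<open>x \<otimes> y\<close> in the next one.\<close>

type_synonym 'r tensors = "'r list ell2"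

lemma tensor_left_bound:
  fixes f :: "'r::chilbert list \<Rightarrow> complex"
  assumes f: "\<And>F. finite F \<Longrightarrow> L2_set (\<lambda>i. cmod (f i)) F \<le> C" and G: "finite G"
  shows "L2_set (\<lambda>w. cmod (case w of [] \<Rightarrow> 0 | b # w' \<Rightarrow> if b \<in> onb then cinner x b * f w' else 0)) G
    \<le> norm x * C"
    (is "L2_set (\<lambda>w. cmod (?h w)) G \<le> _")
proof -
  define A where "A = hd ` (G - {[]}) \<inter> onb"
  define H where "H = tl ` G"
  have fin: "finite A" "finite H" unfolding A_def H_def using G by auto
  have "(\<Sum>w\<in>G. (cmod (?h w))\<^sup>2) = (\<Sum>w\<in>{w\<in>G. w \<noteq> [] \<and> hd w \<in> onb}. (cmod (?h w))\<^sup>2)"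
    using G by (intro sum.mono_neutral_right) (auto split: list.splits)
  also have "\<dots> \<le> (\<Sum>w\<in>(\<lambda>(b, w'). b # w') ` (A \<times> H). (cmod (?h w))\<^sup>2)"
  proof (rule sum_mono2)
    show "{w \<in> G. w \<noteq> [] \<and> hd w \<in> onb} \<subseteq> (\<lambda>(b, w'). b # w') ` (A \<times> H)"
    proof
      fix w assume "w \<in> {w \<in> G. w \<noteq> [] \<and> hd w \<in> onb}"
      hence "(hd w, tl w) \<in> A \<times> H" "w = hd w # tl w" unfolding A_def H_def by auto
      thus "w \<in> (\<lambda>(b, w'). b # w') ` (A \<times> H)" by (metis (no_types, lifting) case_prod_conv image_eqI)
    qed
  qed (use fin in auto)
  also have "\<dots> = (\<Sum>(b, w')\<in>A \<times> H. (cmod (cinner x b))\<^sup>2 * (cmod (f w'))\<^sup>2)"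
    by (subst sum.reindex)
      (auto simp: inj_on_def A_def norm_mult power_mult_distrib intro!: sum.cong)
  also have "\<dots> = (\<Sum>b\<in>A. (cmod (cinner x b))\<^sup>2) * (\<Sum>w'\<in>H. (cmod (f w'))\<^sup>2)"
    by (simp add: sum_product sum.cartesian_product)
  also have "\<dots> \<le> (norm x)\<^sup>2 * C\<^sup>2"
  proof (rule mult_mono)
    show "(\<Sum>b\<in>A. (cmod (cinner x b))\<^sup>2) \<le> (norm x)\<^sup>2"
      using is_onb_onb fin(1) unfolding is_onb_def by (intro bessel[of onb]) (auto simp: A_def)
    show "(\<Sum>w'\<in>H. (cmod (f w'))\<^sup>2) \<le> C\<^sup>2"
      using f[OF fin(2)] unfolding L2_set_def
      by (metis real_sqrt_le_iff real_sqrt_abs abs_ge_self order_trans)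
  qed (auto intro: sum_nonneg)
  finally have "L2_set (\<lambda>w. cmod (?h w)) G \<le> sqrt ((norm x * C)\<^sup>2)"
    unfolding L2_set_def by (intro real_sqrt_le_mono) (simp add: power_mult_distrib)
  moreover have "0 \<le> C" using f[of "{}"] by simp
  ultimately show ?thesis by simp
qed

lift_definition tensor_left :: "'r::chilbert \<Rightarrow> 'r tensors \<Rightarrow> 'r tensors"
  is "\<lambda>x f w. case w of [] \<Rightarrow> 0 | b # w' \<Rightarrow> if b \<in> onb then cinner x b * f w' else 0"
proof -
  fix x :: 'r and f :: "'r list \<Rightarrow> complex"
  assume "(\<lambda>i. (cmod (f i))\<^sup>2) summable_on UNIV"
  then obtain C where "\<And>F. finite F \<Longrightarrow> L2_set (\<lambda>i. cmod (f i)) F \<le> C"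
    unfolding ell2_iff_bounded by blast
  note tensor_left_bound[OF this, of _ x]
  thus "(\<lambda>w. (cmod (case w of [] \<Rightarrow> 0 | b # w' \<Rightarrow> if b \<in> onb then cinner x b * f w' else 0))\<^sup>2)
      summable_on UNIV"
    unfolding ell2_iff_bounded by blast
qed

lemma norm_tensor_left: "norm (tensor_left x y) \<le> norm x * norm y"
  unfolding norm_ell2.rep_eq[of "tensor_left x y"] tensor_left.rep_eq
  by (intro infsum_le_of_L2 tensor_left_bound ell2_L2_le_norm)

text \<open>For an operator \<open>T\<close> from \<open>\<complex>\<close> to \<open>R\<close>, the operators \<open>T \<otimes> I\<close> from \<open>R\<^sup>\<otimes>\<^sup>k\<close> to
  \<open>R \<otimes> R\<^sup>\<otimes>\<^sup>k\<close>, for all \<open>k\<close> at once.\<close>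

lift_definition op_tensor_id :: "(complex, 'r::chilbert) cblop \<Rightarrow> ('r tensors, 'r tensors) cblop"
  is "\<lambda>T. tensor_left (T 1)"
proof -
  fix x :: 'r
  have "bounded_linear (tensor_left x)"
  proof
    show "tensor_left x (y + z) = tensor_left x y + tensor_left x z" for y z
      by transfer (auto simp: fun_eq_iff algebra_simps split: list.splits)
    show "tensor_left x (a *\<^sub>R y) = a *\<^sub>R tensor_left x y" for a y
      by transfer (auto simp: fun_eq_iff split: list.splits)
    show "\<exists>K. \<forall>y. norm (tensor_left x y) \<le> norm y * K"
      by (rule exI[of _ "norm x"]) (metis norm_tensor_left mult.commute)
  qed
  moreover have "tensor_left x (scaleC c y) = scaleC c (tensor_left x y)" for c y
    by transfer (auto simp: fun_eq_iff split: list.splits)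
  ultimately show "bounded_linear (tensor_left x)
      \<and> (\<forall>c y. tensor_left x (scaleC c y) = scaleC c (tensor_left x y))"
    by blast
qed

text \<open>\<open>(L\<^sub>T)\<^sup>(\<^sup>k\<^sup>)\<close> for a square operator matrix \<open>T\<close> from \<open>\<complex>\<^sup>m\<close> to \<open>\<complex>\<^sup>m \<otimes> R\<close>. The unit word
  \<open>ell2_ket []\<close> spans \<open>R\<^sup>\<otimes>\<^sup>0 = \<complex>\<close>.\<close>

primrec L_power :: "(complex, 'r::chilbert) cblop mat \<Rightarrow> nat \<Rightarrow> (complex, 'r tensors) cblop mat" where
  "L_power T 0 = mat (dim_row T) (dim_row T) (\<lambda>(i, j). if i = j then op_of_vec (ell2_ket []) else 0)"
| "L_power T (Suc k) = opmat_mult (map_mat op_tensor_id T) (L_power T k)"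

definition nc_ball :: "'v mat set \<Rightarrow> ('v mat \<Rightarrow> ('a::chilbert, 'b::chilbert) cblop mat) \<Rightarrow> 'v mat set" where
  "nc_ball \<Xi> Q = {Z\<in>\<Xi>. opmat_norm (Q Z) < 1}"

text \<open>The value at 1 identifies an operator on \<open>\<complex>\<close> with a complex number. The series of
  matrices is summed entrywise.\<close>

definition ball_kernel :: "('v mat \<Rightarrow> ('r::chilbert, complex) cblop mat) \<Rightarrow> 'v scalar_ker" where
  "ball_kernel Q = (\<lambda>Z W P. mat (dim_row Z) (dim_row W) (\<lambda>(i, j). \<Sum>k.
    cblop_apply
      (opmat_mult (opmat_mult (opmat_adj (L_power (opmat_adj (Q Z)) k)) (ampl P))
        (L_power (opmat_adj (Q W)) k) $$ (i, j)) 1))"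

end

theory Submission
  imports Defs
begin

text \<open>Over words \<open>w\<close> in an orthonormal basis of \<open>R\<close>, the values of \<open>Q\<^sub>0(W)\<close> on basis vectors give
  matrices \<open>L\<^sub>w(W)\<close> with \<open>k(Z, W)(P) = \<Sum>\<^sub>w L\<^sub>w(Z)\<^sup>* P L\<^sub>w(W)\<close>. Hence \<open>k \<otimes> I\<close> has the feature vectors
  \<open>\<phi>(W, v, y) = (v L\<^sub>w(W) y)\<^sub>w\<close> in a vector-valued \<open>\<ell>\<^sup>2\<close>, and both complete positivity of the de Branges
  kernel and contractivity of the multiplier say that \<open>\<phi>(W, v, y) \<mapsto> \<phi>(W, v, S(W)\<^sup>* y)\<close> extends to a
  linear contraction. To extend \<open>S\<^sub>0\<close>, represent the defect kernel as a Gram matrix of vectors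
  \<open>h\<close> in a Hilbert space \<open>X\<close>. Since \<open>w\<close> is either empty or \<open>b # w'\<close>, the map
  \<open>(v y, (h(W, v Q\<^sub>b(W)\<^sup>*, y))\<^sub>b) \<mapsto> (v S\<^sub>0(W)\<^sup>* y, h(W, v, y))\<close> is isometric. Its extension
  \<open>V\<close> is the colligation of a transfer function \<open>S\<close> on the whole ball, defined by solving the fixed
  point equation for the state, which is uniquely solvable because \<open>\<parallel>Q\<^sub>0(W)\<parallel> < 1\<close>. Peeling off the last
  letter of \<open>w\<close> shows that \<open>S\<close> is a contractive multiplier.\<close>

section \<open>Hilbert space preliminaries\<close>

text \<open>Complete positivity becomes a norm inequality because a positive matrix \<open>P\<close>
  is a finite sum of rank-one matrices, and for rank-one \<open>P\<close> the form of the kernel is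
  a Gram matrix of feature vectors. Hilbert spaces are types here, while the classical argument uses
  closed spans, completions and sums over all letters. Each of these is replaced by Gram vectors in
  \<open>ell2\<close> over the index set of a positive kernel, and an isometry between closed spans
  by a contraction of the whole spaces that vanishes on the orthogonal complement. So the
  colligation \<open>V\<close> is only contractive, and energy inequalities stand in for unitarity.
  The two ends of a word have different uses. A first letter acts on the row \<open>v\<close> and
  keeps the point and \<open>y\<close>, so the defect vectors can be shifted without leaving the
  data set. A last letter acts on \<open>y\<close>, so it turns a state into an input of
  \<open>V\<close>.\<close>

lemma cinner_zero_right [simp]: "cinner x (0::'a::chilbert) = 0"
  by (subst cinner_commute) (simp add: cinner_zero_left)

lemma cinner_ext: "(\<And>t. cinner t x = cinner t y) \<Longrightarrow> x = (y::'a::chilbert)"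
proof -
  assume "\<And>t. cinner t x = cinner t y"
  hence "cinner (x - y) (x - y) = 0" by (simp add: cinner_diff_right)
  thus ?thesis by (simp add: cinner_self)
qed

lemma cinner_ext_left: "(\<And>t. cinner x t = cinner y t) \<Longrightarrow> x = (y::'a::chilbert)"
  by (rule cinner_ext) (metis cinner_commute)

lemma norm_sq_eq_cinner: "(norm (x::'a::chilbert))\<^sup>2 = Re (cinner x x)"
  by (simp add: cinner_self)

lemma norm_sq_add: "(norm (x + y :: 'a::chilbert))\<^sup>2 = (norm x)\<^sup>2 + 2 * Re (cinner x y) + (norm y)\<^sup>2"
  using cinner_commute[of y x]
  by (simp add: norm_sq_eq_cinner cinner_add_left cinner_add_right)

lemma norm_sq_diff: "(norm (x - y :: 'a::chilbert))\<^sup>2 = (norm x)\<^sup>2 - 2 * Re (cinner x y) + (norm y)\<^sup>2"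
  using cinner_commute[of y x]
  by (simp add: norm_sq_eq_cinner cinner_diff_left cinner_diff_right)

lemma linear_coeff_zero_if_quadratic_nonneg:
  assumes "\<And>t::real. 0 \<le> 2 * t * a + t\<^sup>2 * b"
  shows "a = 0"
proof (rule ccontr)
  assume a: "a \<noteq> 0"
  \<comment> \<open>The denominator is positive for every sign of \<open>b\<close>; with
    \<open>1 + \<bar>b\<bar>\<close> in place of \<open>b\<close> the quadratic is still negative at
    this \<open>t\<close>.\<close>
  define t where "t = - a / (1 + \<bar>b\<bar>)"
  have pos: "1 + \<bar>b\<bar> > 0" by simp
  have "2 * t * a + t\<^sup>2 * b \<le> 2 * t * a + t\<^sup>2 * (1 + \<bar>b\<bar>)"
    by (simp add: mult_left_mono)
  also have "\<dots> = t * (2 * a + t * (1 + \<bar>b\<bar>))" by (simp add: power2_eq_square algebra_simps)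
  also have "t * (1 + \<bar>b\<bar>) = - a" using pos unfolding t_def by simp
  also have "t * (2 * a + - a) = - (a\<^sup>2 / (1 + \<bar>b\<bar>))"
    unfolding t_def by (simp add: power2_eq_square)
  also have "\<dots> < 0" using a pos by simp
  finally show False using assms[of t] by simp
qed

lemma cauchy_schwarz: "cmod (cinner x y) \<le> norm x * norm (y::'a::chilbert)"
proof (cases "y = 0")
  case False
  define c where "c = cinner x y / complex_of_real ((norm y)\<^sup>2)"
  have "0 \<le> (norm (x - scaleC c y))\<^sup>2" by simp
  also have "\<dots> = (norm x)\<^sup>2 - 2 * Re (cnj c * cinner x y) + (cmod c)\<^sup>2 * (norm y)\<^sup>2"
    by (simp add: norm_sq_diff cinner_scaleC_right norm_scaleC power_mult_distrib)
  also have "cnj c * cinner x y = complex_of_real ((cmod (cinner x y))\<^sup>2 / (norm y)\<^sup>2)"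
    unfolding c_def of_real_divide complex_norm_square by (simp add: mult.commute)
  also have "(cmod c)\<^sup>2 * (norm y)\<^sup>2 = (cmod (cinner x y))\<^sup>2 / (norm y)\<^sup>2"
    using False unfolding c_def by (simp add: norm_divide power2_eq_square norm_mult)
  finally have "(cmod (cinner x y))\<^sup>2 \<le> (norm x * norm y)\<^sup>2"
    using False by (simp add: field_simps)
  thus ?thesis by (simp add: power2_le_iff_abs_le)
qed simp

lemma bounded_bilinear_cinner: "bounded_bilinear (cinner :: 'a::chilbert \<Rightarrow> 'a \<Rightarrow> complex)"
proof
  show "\<exists>K. \<forall>(a::'a) b. norm (cinner a b) \<le> norm a * norm b * K"
    by (rule exI[of _ 1]) (simp add: cauchy_schwarz)
qed (simp_all add: cinner_add_left cinner_add_right scaleR_scaleC cinner_scaleC_left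
      cinner_scaleC_right scaleC_complex_def)

lemmas tendsto_cinner = bounded_bilinear.tendsto[OF bounded_bilinear_cinner]

lemma scaleC_diff_right: "scaleC a (x - y :: 'a::chilbert) = scaleC a x - scaleC a y"
  using scaleC_add_right[of a x "- y"] by (simp add: scaleC_minus_right)

lemma scaleC_diff_left: "scaleC (a - b) (x :: 'a::chilbert) = scaleC a x - scaleC b x"
  by (metis add_diff_cancel_right' diff_add_cancel scaleC_add_left)

lemma scaleC_sum_left: "scaleC (sum f A) (x :: 'a::chilbert) = (\<Sum>i\<in>A. scaleC (f i) x)"
  by (induction A rule: infinite_finite_induct) (auto simp: scaleC_zero_left scaleC_add_left)

section \<open>Riesz representation from a graph or from a generating family\<close>

text \<open>The graph \<open>G\<close> of a bounded functional on a subspace: a minimising sequence of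
  \<open>\<parallel>x\<parallel>\<^sup>2 - 2 Re a\<close> over \<open>G\<close> converges to the representing vector.\<close>

lemma riesz_graph:
  fixes G :: "('a::chilbert \<times> complex) set"
  assumes ne: "(0, 0) \<in> G"
    and add: "\<And>x a y b. (x, a) \<in> G \<Longrightarrow> (y, b) \<in> G \<Longrightarrow> (x + y, a + b) \<in> G"
    and scale: "\<And>c x a. (x, a) \<in> G \<Longrightarrow> (scaleC c x, c * a) \<in> G"
    and bound: "\<And>x a. (x, a) \<in> G \<Longrightarrow> cmod a \<le> C * norm x"
    and C: "0 \<le> C"
  shows "\<exists>p. norm p \<le> C \<and> (\<forall>(x, a)\<in>G. cinner x p = a) \<and>
    (\<forall>z. (\<forall>(x, a)\<in>G. cinner x z = 0) \<longrightarrow> cinner p z = 0)"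
proof -
  define J where "J = (\<lambda>(x::'a, a). (norm x)\<^sup>2 - 2 * Re a)"
  define m where "m = Inf (J ` G)"
  \<comment> \<open>Completing the square in \<open>norm x\<close> bounds \<open>J\<close> from
    below.\<close>
  have lower: "- C\<^sup>2 \<le> J (x, a)" if "(x, a) \<in> G" for x a
  proof -
    have "Re a \<le> C * norm x" using bound[OF that] complex_Re_le_cmod order_trans by blast
    moreover have "0 \<le> (norm x - C)\<^sup>2" by simp
    ultimately show ?thesis unfolding J_def by (simp add: power2_diff mult_ac)
  qed
  have bdd: "bdd_below (J ` G)" by (rule bdd_belowI[of _ "- C\<^sup>2"]) (use lower in auto)
  have m_le: "m \<le> J (x, a)" if "(x, a) \<in> G" for x a
    unfolding m_def using that bdd by (intro cInf_lower) auto
  have "\<exists>p\<in>G. J p < m + inverse (real (Suc n))" for n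
  proof -
    have "\<exists>y\<in>J ` G. y < m + inverse (real (Suc n))"
      unfolding m_def by (rule cInf_lessD) (use ne in auto)
    thus ?thesis by blast
  qed
  then obtain s where s: "\<And>n. s n \<in> G" "\<And>n. J (s n) < m + inverse (real (Suc n))" by metis
  define X where "X n = fst (s n)" for n
  define A where "A n = snd (s n)" for n
  have G: "(X n, A n) \<in> G" and J: "J (X n, A n) < m + inverse (real (Suc n))" for n
    using s[of n] by (simp_all add: X_def A_def)
  \<comment> \<open>Parallelogram law: the midpoint of two elements of \<open>G\<close> is again in
    \<open>G\<close>, so its value of \<open>J\<close> is at least \<open>m\<close>. This makes a
    minimising sequence Cauchy.\<close>
  have par: "(norm (x - y))\<^sup>2 \<le> 2 * (J (x, a) - m) + 2 * (J (y, b) - m)"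
    if "(x, a) \<in> G" "(y, b) \<in> G" for x a y b
  proof -
    have "(scaleC (1/2) (x + y), (1/2) * (a + b)) \<in> G" using that by (intro scale add)
    from m_le[OF this] have "4 * m \<le> (norm (x + y))\<^sup>2 - 4 * Re (a + b)"
      by (simp add: J_def norm_scaleC power_mult_distrib power_divide field_simps)
    thus ?thesis unfolding J_def by (simp add: norm_sq_add norm_sq_diff)
  qed
  have inv0: "(\<lambda>n. inverse (real (Suc n))) \<longlonglongrightarrow> 0" by (rule LIMSEQ_inverse_real_of_nat)
  have Xc: "Cauchy X"
  proof (rule metric_CauchyI)
    fix e :: real assume e: "e > 0"
    hence "\<forall>\<^sub>F n in sequentially. inverse (real (Suc n)) < e\<^sup>2 / 4"
      using order_tendstoD(2)[OF inv0, of "e\<^sup>2/4"] by simp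
    then obtain N where N: "\<And>n. n \<ge> N \<Longrightarrow> inverse (real (Suc n)) < e\<^sup>2 / 4"
      unfolding eventually_sequentially by blast
    have "dist (X i) (X j) < e" if "i \<ge> N" "j \<ge> N" for i j
    proof -
      have "(norm (X i - X j))\<^sup>2 < e\<^sup>2"
        using par[OF G[of i] G[of j]] less_trans[OF J add_strict_left_mono[OF N[OF that(1)]]]
          less_trans[OF J add_strict_left_mono[OF N[OF that(2)]]] by argo
      thus ?thesis using e by (simp add: dist_norm power2_less_imp_less)
    qed
    thus "\<exists>M. \<forall>m\<ge>M. \<forall>n\<ge>M. dist (X m) (X n) < e" by blast
  qed
  then obtain p where p: "X \<longlonglongrightarrow> p" using Cauchy_convergent convergent_def by blast
  have Jlim: "(\<lambda>n. J (X n, A n)) \<longlonglongrightarrow> m"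
  proof (rule tendsto_sandwich[where f="\<lambda>_. m" and h="\<lambda>n. m + inverse (real (Suc n))"])
    show "(\<lambda>n. m + inverse (real (Suc n))) \<longlonglongrightarrow> m"
      using tendsto_add[OF tendsto_const inv0, of m] by simp
    show "\<forall>\<^sub>F n in sequentially. J (X n, A n) \<le> m + inverse (real (Suc n))"
      by (intro always_eventually allI less_imp_le J)
  qed (use m_le[OF G] in auto)
  \<comment> \<open>First variation: moving the minimising sequence by \<open>t\<close> times
    \<open>(x, a)\<close> cannot bring the limit of \<open>J\<close> below \<open>m\<close>, so the
    linear coefficient in \<open>t\<close> vanishes.\<close>
  have ReX: "Re (cinner x p) = Re a" if xa: "(x, a) \<in> G" for x a
  proof -
    have "0 \<le> 2 * t * (Re (cinner x p) - Re a) + t\<^sup>2 * (norm x)\<^sup>2" for t :: real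
    proof -
      let ?g = "\<lambda>n. J (X n, A n) + (2 * t * (Re (cinner x (X n)) - Re a) + t\<^sup>2 * (norm x)\<^sup>2)"
      have "?g \<longlonglongrightarrow> m + (2 * t * (Re (cinner x p) - Re a) + t\<^sup>2 * (norm x)\<^sup>2)"
        by (intro tendsto_intros Jlim tendsto_cinner p)
      moreover have "m \<le> ?g n" for n
      proof -
        have "(X n + scaleC (of_real t) x, A n + of_real t * a) \<in> G" by (intro add scale G xa)
        from m_le[OF this] have "m \<le> J (X n + scaleC (of_real t) x, A n + of_real t * a)" .
        also have "\<dots> = ?g n"
          using cinner_commute[of x "X n"]
          by (simp add: J_def norm_sq_add cinner_scaleC_right norm_scaleC power_mult_distrib algebra_simps)
        finally show ?thesis .
      qed
      ultimately have "m \<le> m + (2 * t * (Re (cinner x p) - Re a) + t\<^sup>2 * (norm x)\<^sup>2)"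
        by (intro LIMSEQ_le_const) auto
      thus ?thesis by simp
    qed
    from linear_coeff_zero_if_quadratic_nonneg[OF this] show ?thesis by simp
  qed
  have eq: "cinner x p = a" if xa: "(x, a) \<in> G" for x a
  proof (rule complex_eqI)
    show "Re (cinner x p) = Re a" by (rule ReX[OF xa])
    \<comment> \<open>Multiplication by \<open>- \<i>\<close> turns the imaginary part into the real
      part.\<close>
    show "Im (cinner x p) = Im a"
      using ReX[OF scale[OF xa, of "- \<i>"]] by (simp add: cinner_scaleC_left)
  qed
  have "norm p \<le> C"
  proof -
    have "(\<lambda>n. cmod (cinner (X n) p)) \<longlonglongrightarrow> cmod (cinner p p)"
      by (intro tendsto_intros tendsto_cinner p)
    moreover have "(\<lambda>n. C * norm (X n)) \<longlonglongrightarrow> C * norm p" by (intro tendsto_intros p)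
    moreover have "cmod (cinner (X n) p) \<le> C * norm (X n)" for n using eq[OF G] bound[OF G] by simp
    ultimately have "cmod (cinner p p) \<le> C * norm p" by (intro LIMSEQ_le) auto
    hence "norm p * norm p \<le> C * norm p" by (simp add: cinner_self power2_eq_square norm_mult)
    thus ?thesis using C by (cases "p = 0") auto
  qed
  \<comment> \<open>As a limit of first components of \<open>G\<close>, \<open>p\<close> is
    orthogonal to whatever is orthogonal to all of them.\<close>
  moreover have "cinner p z = 0" if z: "\<forall>(x, a)\<in>G. cinner x z = 0" for z
  proof -
    have "(\<lambda>n. cinner (X n) z) \<longlonglongrightarrow> cinner p z" by (intro tendsto_cinner p) auto
    moreover have "cinner (X n) z = 0" for n using z G[of n] by auto
    ultimately show ?thesis by (simp add: LIMSEQ_const_iff)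
  qed
  ultimately show ?thesis using eq by blast
qed

text \<open>The finite combinations of the pairs \<open>(h i, f i)\<close> form a graph, and the
  bound forces it to be single valued, so linear relations among the \<open>h i\<close> do no harm.
  The last clause places \<open>p\<close> in the closed span of the \<open>h i\<close>.\<close>

lemma riesz_family:
  fixes h :: "'i \<Rightarrow> 'a::chilbert" and f :: "'i \<Rightarrow> complex"
  assumes bound: "\<And>F c. finite F \<Longrightarrow> F \<subseteq> I \<Longrightarrow>
      cmod (\<Sum>i\<in>F. c i * f i) \<le> C * norm (\<Sum>i\<in>F. scaleC (c i) (h i))"
    and C: "0 \<le> C"
  shows "\<exists>p. norm p \<le> C \<and> (\<forall>i\<in>I. cinner (h i) p = f i) \<and>
    (\<forall>z. (\<forall>i\<in>I. cinner (h i) z = 0) \<longrightarrow> cinner p z = 0)"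
proof -
  define G where "G = {(\<Sum>i\<in>F. scaleC (c i) (h i), \<Sum>i\<in>F. c i * f i) | F c. finite F \<and> F \<subseteq> I}"
  have G_I: "(x, a) \<in> G" if "finite F" "F \<subseteq> I" "x = (\<Sum>i\<in>F. scaleC (c i) (h i))" "a = (\<Sum>i\<in>F. c i * f i)"
    for x a F c using that unfolding G_def by blast
  have "\<exists>p. norm p \<le> C \<and> (\<forall>(x, a)\<in>G. cinner x p = a) \<and>
    (\<forall>z. (\<forall>(x, a)\<in>G. cinner x z = 0) \<longrightarrow> cinner p z = 0)"
  proof (rule riesz_graph[OF _ _ _ _ C])
    show "(0, 0) \<in> G" by (rule G_I[of "{}"]) auto
    show "cmod a \<le> C * norm x" if "(x, a) \<in> G" for x a
      using that bound unfolding G_def by auto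
    show "(scaleC c x, c * a) \<in> G" if "(x, a) \<in> G" for c x a
    proof -
      obtain F d where "finite F" "F \<subseteq> I" "x = (\<Sum>i\<in>F. scaleC (d i) (h i))" "a = (\<Sum>i\<in>F. d i * f i)"
        using \<open>(x, a) \<in> G\<close> unfolding G_def by auto
      thus ?thesis
        by (intro G_I[of F _ "\<lambda>i. c * d i"])
          (auto simp: scaleC_sum_right scaleC_scaleC sum_distrib_left mult.assoc)
    qed
    show "(x + y, a + b) \<in> G" if xy: "(x, a) \<in> G" "(y, b) \<in> G" for x a y b
    proof -
      obtain F c where F: "finite F" "F \<subseteq> I" "x = (\<Sum>i\<in>F. scaleC (c i) (h i))" "a = (\<Sum>i\<in>F. c i * f i)"
        using xy(1) unfolding G_def by auto
      obtain H d where H: "finite H" "H \<subseteq> I" "y = (\<Sum>i\<in>H. scaleC (d i) (h i))" "b = (\<Sum>i\<in>H. d i * f i)"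
        using xy(2) unfolding G_def by auto
      \<comment> \<open>Padding by zeros brings both combinations to the common index set
        \<open>F \<union> H\<close>.\<close>
      let ?c = "\<lambda>i. if i \<in> F then c i else 0" and ?d = "\<lambda>i. if i \<in> H then d i else 0"
      have "x = (\<Sum>i\<in>F \<union> H. scaleC (?c i) (h i))" "a = (\<Sum>i\<in>F \<union> H. ?c i * f i)"
          "y = (\<Sum>i\<in>F \<union> H. scaleC (?d i) (h i))" "b = (\<Sum>i\<in>F \<union> H. ?d i * f i)"
        unfolding F(3,4) H(3,4) using F(1) H(1)
        by (auto intro!: sum.mono_neutral_cong_left simp: scaleC_zero_left)
      thus ?thesis using F(1,2) H(1,2)
        by (intro G_I[of "F \<union> H" _ "\<lambda>i. ?c i + ?d i"])
          (simp_all only: finite_Un Un_subset_iff simp_thms scaleC_add_left distrib_right sum.distrib)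
    qed
  qed
  then obtain p where p: "norm p \<le> C" "\<And>x a. (x, a) \<in> G \<Longrightarrow> cinner x p = a"
    "\<And>z. (\<forall>(x, a)\<in>G. cinner x z = 0) \<Longrightarrow> cinner p z = 0" by fast
  moreover have "(h i, f i) \<in> G" if "i \<in> I" for i
    by (rule G_I[of "{i}" _ "\<lambda>_. 1"]) (use that in \<open>auto simp: scaleC_one\<close>)
  moreover have "(\<forall>(x, a)\<in>G. cinner x z = 0)" if "\<forall>i\<in>I. cinner (h i) z = 0" for z
    using that unfolding G_def by (auto simp: cinner_sum_left cinner_scaleC_left subset_iff)
  ultimately show ?thesis by (intro exI[of _ p]) blast
qed

section \<open>Bounded operators\<close>

lemma cblop_bl: "bounded_linear (cblop_apply T)" and cblop_scale: "cblop_apply T (scaleC c x) = scaleC c (cblop_apply T x)"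
  using cblop_apply[of T] by auto

lemma cblop_add: "cblop_apply T (x + y) = cblop_apply T x + cblop_apply T y"
  by (rule linear_add[OF bounded_linear.linear[OF cblop_bl]])

lemma cblop_diff: "cblop_apply T (x - y) = cblop_apply T x - cblop_apply T y"
  by (rule linear_diff[OF bounded_linear.linear[OF cblop_bl]])

lemma cblop_zero: "cblop_apply T 0 = 0"
  by (rule linear_0[OF bounded_linear.linear[OF cblop_bl]])

lemma cblop_sum: "cblop_apply T (sum f A) = (\<Sum>i\<in>A. cblop_apply T (f i))"
  by (rule linear_sum[OF bounded_linear.linear[OF cblop_bl]])

lemma cblop_ex_bound: "\<exists>C\<ge>0. \<forall>x. norm (cblop_apply T x) \<le> C * norm x"
  using bounded_linear.nonneg_bounded[OF cblop_bl[of T]] by (auto simp: mult.commute)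

lemma cblop_eqI: "(\<And>x. cblop_apply S x = cblop_apply T x) \<Longrightarrow> S = T"
  by (metis cblop_apply_inject ext)

lemma sum_cblop_apply: "cblop_apply (sum f A) x = (\<Sum>i\<in>A. cblop_apply (f i) x)"
  by (induction A rule: infinite_finite_induct) (auto simp: zero_cblop.rep_eq plus_cblop.rep_eq)

lemma cblop_apply_Abs:
  assumes "\<And>x y. f (x + y) = f x + f y" "\<And>c x. f (scaleC c x) = scaleC c (f x)"
    and "\<And>x. norm (f x) \<le> C * norm x"
  shows "cblop_apply (Abs_cblop f) = f"
proof -
  have "bounded_linear f"
    by (rule bounded_linear_intro[where K=C])
      (use assms in \<open>auto simp: scaleR_scaleC mult.commute\<close>)
  thus ?thesis using assms(2) by (intro Abs_cblop_inverse) auto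
qed

text \<open>Riesz representation of \<open>x \<mapsto> cinner (cblop_apply T x) y\<close>, with all
  vectors as the generating family. Existence and uniqueness give meaning to the definite
  description in \<open>op_adj\<close>.\<close>

lemma op_adj_exists:
  fixes T :: "('a::chilbert, 'b::chilbert) cblop"
  shows "\<exists>S. \<forall>x y. cinner (cblop_apply T x) y = cinner x (cblop_apply S y)"
proof -
  obtain C where C: "0 \<le> C" "\<And>x. norm (cblop_apply T x) \<le> C * norm x"
    using cblop_ex_bound[of T] by blast
  have "\<exists>p. norm p \<le> C * norm y \<and> (\<forall>x. cinner x p = cinner (cblop_apply T x) y)" for y
  proof -
    have "cmod (\<Sum>i\<in>F. c i * cinner (cblop_apply T i) y) \<le> C * norm y * norm (\<Sum>i\<in>F. scaleC (c i) i)" for F c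
    proof -
      have "(\<Sum>i\<in>F. c i * cinner (cblop_apply T i) y) = cinner (cblop_apply T (\<Sum>i\<in>F. scaleC (c i) i)) y"
        by (simp add: cblop_sum cblop_scale cinner_sum_left cinner_scaleC_left)
      also have "cmod \<dots> \<le> norm (cblop_apply T (\<Sum>i\<in>F. scaleC (c i) i)) * norm y"
        by (rule cauchy_schwarz)
      also have "\<dots> \<le> (C * norm (\<Sum>i\<in>F. scaleC (c i) i)) * norm y"
        by (intro mult_right_mono C) auto
      finally show ?thesis by (simp add: mult_ac)
    qed
    from riesz_family[where h="\<lambda>x. x" and I=UNIV, OF this] C(1) show ?thesis by auto
  qed
  then obtain S where S: "\<And>y. norm (S y) \<le> C * norm y"
    "\<And>x y. cinner x (S y) = cinner (cblop_apply T x) y" by metis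
  have "cblop_apply (Abs_cblop S) = S"
    by (rule cblop_apply_Abs[OF _ _ S(1)]; rule cinner_ext)
      (simp_all add: S(2) cinner_add_right cinner_scaleC_right)
  thus ?thesis using S(2) by metis
qed

lemma op_adj_right: "cinner (cblop_apply T x) y = cinner x (cblop_apply (op_adj T) y)"
proof -
  have "\<exists>!S. \<forall>x y. cinner (cblop_apply T x) y = cinner x (cblop_apply S y)"
    using op_adj_exists[of T] by (metis cblop_eqI cinner_ext)
  from theI'[OF this] show ?thesis unfolding op_adj_def by blast
qed

lemma op_adj_left: "cinner (cblop_apply (op_adj T) x) y = cinner x (cblop_apply T y)"
  by (metis cinner_commute op_adj_right)

lemma op_adj_op_adj [simp]: "op_adj (op_adj T) = T"
  by (rule cblop_eqI, rule cinner_ext) (metis op_adj_left op_adj_right)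

text \<open>The adjoint is constructed first: Riesz gives for each \<open>y\<close> a vector
  \<open>W y\<close> in the closed span of the \<open>g i\<close> that represents
  \<open>g i \<mapsto> cinner (h i) y\<close>. Its adjoint \<open>V\<close> then extends
  \<open>g i \<mapsto> h i\<close> and vanishes on the orthogonal complement of the
  \<open>g i\<close>, without any passage to limits.\<close>

lemma contraction_extension:
  fixes g :: "'i \<Rightarrow> 'a::chilbert" and h :: "'i \<Rightarrow> 'b::chilbert"
  assumes le: "\<And>F c. finite F \<Longrightarrow>
      norm (\<Sum>i\<in>F. scaleC (c i) (h i)) \<le> norm (\<Sum>i\<in>F. scaleC (c i) (g i))"
  shows "\<exists>V. (\<forall>i. cblop_apply V (g i) = h i) \<and> (\<forall>x. norm (cblop_apply V x) \<le> norm x)"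
proof -
  have "\<exists>p. norm p \<le> norm y \<and> (\<forall>i. cinner (g i) p = cinner (h i) y) \<and>
      (\<forall>z. (\<forall>i. cinner (g i) z = 0) \<longrightarrow> cinner p z = 0)" for y
  proof -
    have "cmod (\<Sum>i\<in>F. c i * cinner (h i) y) \<le> norm y * norm (\<Sum>i\<in>F. scaleC (c i) (g i))"
      if "finite F" for F c
    proof -
      have "(\<Sum>i\<in>F. c i * cinner (h i) y) = cinner (\<Sum>i\<in>F. scaleC (c i) (h i)) y"
        by (simp add: cinner_sum_left cinner_scaleC_left)
      also have "cmod \<dots> \<le> norm (\<Sum>i\<in>F. scaleC (c i) (h i)) * norm y"
        by (rule cauchy_schwarz)
      also have "\<dots> \<le> norm (\<Sum>i\<in>F. scaleC (c i) (g i)) * norm y"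
        by (intro mult_right_mono le that) auto
      finally show ?thesis by (simp add: mult_ac)
    qed
    from riesz_family[where h=g and I=UNIV, OF this] show ?thesis by auto
  qed
  then obtain W where W: "\<And>y. norm (W y) \<le> norm y" "\<And>i y. cinner (g i) (W y) = cinner (h i) y"
    "\<And>y z. (\<forall>i. cinner (g i) z = 0) \<Longrightarrow> cinner (W y) z = 0" by metis
  \<comment> \<open>A vector of the closed span is determined by its inner products with the
    \<open>g i\<close>; this yields linearity of \<open>W\<close>.\<close>
  have uniq: "p = q"
    if "\<And>i. cinner (g i) p = cinner (g i) q" "\<And>z. (\<forall>i. cinner (g i) z = 0) \<Longrightarrow> cinner p z = cinner q z" for p q
  proof -
    have "cinner (p - q) (p - q) = 0"
      using that(1) that(2)[of "p - q"] by (simp add: cinner_diff_right[of "g _"] cinner_diff_left)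
    thus ?thesis by (simp add: cinner_self)
  qed
  have W': "cblop_apply (Abs_cblop W) = W"
  proof (rule cblop_apply_Abs[where C=1])
    show "W (x + y) = W x + W y" for x y
      by (rule uniq) (simp add: W(2) cinner_add_right, simp add: W(3) cinner_add_left)
    show "W (scaleC c x) = scaleC c (W x)" for c x
      by (rule uniq) (simp add: W(2) cinner_scaleC_right, simp add: W(3) cinner_scaleC_left)
  qed (simp add: W(1))
  define V where "V = op_adj (Abs_cblop W)"
  have V: "cinner (cblop_apply V x) y = cinner x (W y)" for x y
    unfolding V_def by (simp add: op_adj_left W')
  have "norm (cblop_apply V x) \<le> norm x" for x
  proof -
    have "cmod (cinner x (W (cblop_apply V x))) \<le> norm x * norm (cblop_apply V x)"
      by (rule order_trans[OF cauchy_schwarz]) (simp add: W(1) mult_left_mono)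
    hence "norm (cblop_apply V x) * norm (cblop_apply V x) \<le> norm x * norm (cblop_apply V x)"
      by (simp add: V[symmetric] cinner_self power2_eq_square norm_mult)
    thus ?thesis by (cases "cblop_apply V x = 0") auto
  qed
  moreover have "cblop_apply V (g i) = h i" for i
    by (rule cinner_ext_left) (simp add: V W(2))
  ultimately show ?thesis by blast
qed

section \<open>Orthogonal sums of two Hilbert spaces, the domain and codomain of
  colligations\<close>

instantiation prod :: (chilbert, chilbert) chilbert
begin
definition "scaleC (a::complex) (x :: 'a \<times> 'b) = (scaleC a (fst x), scaleC a (snd x))"
definition "cinner (x :: 'a \<times> 'b) y = cinner (fst x) (fst y) + cinner (snd x) (snd y)"
instance
proof
  fix x y z :: "'a \<times> 'b" and a b :: complex
  show "cinner x y = cnj (cinner y x)"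
    using cinner_commute[of "fst x" "fst y"] cinner_commute[of "snd x" "snd y"]
    by (simp add: cinner_prod_def)
  show "norm x = sqrt (Re (cinner x x))"
    by (simp add: cinner_prod_def norm_prod_def cinner_self)
qed (simp_all add: scaleC_prod_def cinner_prod_def prod_eq_iff scaleC_add_right scaleC_add_left
      scaleC_scaleC scaleC_one scaleR_scaleC cinner_add_left cinner_scaleC_left algebra_simps)
end

lemma scaleC_Pair: "scaleC c (x, y) = (scaleC c x, scaleC c y)"
  by (simp add: scaleC_prod_def)

lemma norm_sq_Pair: "(norm (x, y))\<^sup>2 = (norm x)\<^sup>2 + (norm y)\<^sup>2"
  by (simp add: norm_prod_def)

lemma sum_Pair: "(\<Sum>i\<in>F. (f i, g i)) = (sum f F, sum g F)"
  by (induction F rule: infinite_finite_induct) (auto simp: zero_prod_def)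

section \<open>Positive semidefinite kernels\<close>

lemma cinner_ket: "cinner x (ell2_ket t) = ell2_coeff x t"
proof -
  have "cinner x (ell2_ket t) = (\<Sum>\<^sub>\<infinity>i. ell2_coeff x i * cnj (if i = t then 1 else 0))"
    by (simp add: cinner_ell2.rep_eq ell2_ket.rep_eq)
  also have "\<dots> = (\<Sum>\<^sub>\<infinity>i\<in>{t}. ell2_coeff x i)"
    by (rule infsum_cong_neutral) auto
  finally show ?thesis by simp
qed

lemma norm_ket [simp]: "norm (ell2_ket t) = 1"
  by (simp add: norm_eq_sqrt_cinner cinner_ket ell2_ket.rep_eq)

lemma mult_cnj_eq_cmod: "z * cnj z = of_real ((cmod z)\<^sup>2)"
  by (rule complex_norm_square[symmetric])

definition psd :: "'i set \<Rightarrow> ('i \<Rightarrow> 'i \<Rightarrow> complex) \<Rightarrow> bool" where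
  "psd I \<kappa> \<longleftrightarrow> (\<forall>F c. finite F \<longrightarrow> F \<subseteq> I \<longrightarrow>
    (\<Sum>i\<in>F. \<Sum>j\<in>F. c i * cnj (c j) * \<kappa> i j) \<in> \<real>\<^sub>\<ge>\<^sub>0)"

lemma nonneg_Reals_iff: "z \<in> \<real>\<^sub>\<ge>\<^sub>0 \<longleftrightarrow> 0 \<le> Re z \<and> Im z = 0"
  using complex_nonneg_Reals_iff by auto

text \<open>Polarisation: the form is real for the coefficients \<open>(1, 1)\<close> and
  \<open>(1, \<i>)\<close>, which settles the imaginary and the real part.\<close>

lemma psd_hermitian:
  assumes "psd I \<kappa>" "i \<in> I" "j \<in> I"
  shows "\<kappa> i j = cnj (\<kappa> j i)"
proof -
  have one: "\<kappa> a a \<in> \<real>\<^sub>\<ge>\<^sub>0" if "a \<in> I" for a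
    using assms(1)[unfolded psd_def, rule_format, of "{a}" "\<lambda>_. 1"] that by simp
  show ?thesis
  proof (cases "i = j")
    case True thus ?thesis using one[OF assms(2)] by (auto simp: nonneg_Reals_iff complex_eq_iff)
  next
    case False
    have two: "Im (\<kappa> i i + cnj c * \<kappa> i j + (c * \<kappa> j i + c * cnj c * \<kappa> j j)) = 0" for c
      using assms(1)[unfolded psd_def, rule_format, of "{i, j}" "\<lambda>a. if a = i then 1 else c"] assms(2,3) False
      by (auto simp: nonneg_Reals_iff)
    show ?thesis
      using two[of 1] two[of \<i>] one[OF assms(2)] one[OF assms(3)]
      by (auto simp: nonneg_Reals_iff complex_eq_iff)
  qed
qed

text \<open>Here \<open>u\<close> is the norm of the combination of the vectors indexed by
  \<open>F\<close>, and \<open>j\<close> is an index whose vector has not been constructed yet. This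
  is the bound that lets Riesz produce the projection of that future vector.\<close>

lemma psd_cauchy_schwarz:
  assumes psd: "psd I \<kappa>" and F: "finite F" "F \<subseteq> I" and j: "j \<in> I" "j \<notin> F"
    and u: "complex_of_real (u\<^sup>2) = (\<Sum>i\<in>F. \<Sum>k\<in>F. c i * cnj (c k) * \<kappa> i k)" and u0: "0 \<le> u"
  shows "cmod (\<Sum>i\<in>F. c i * \<kappa> i j) \<le> sqrt (Re (\<kappa> j j)) * u"
proof -
  define \<alpha> where "\<alpha> = (\<Sum>i\<in>F. c i * \<kappa> i j)"
  define k where "k = Re (\<kappa> j j)"
  have kjj: "\<kappa> j j = of_real k" "0 \<le> k"
    using psd[unfolded psd_def, rule_format, of "{j}" "\<lambda>_. 1"] j unfolding k_def
    by (auto simp: nonneg_Reals_iff complex_eq_iff)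
  have \<alpha>': "(\<Sum>i\<in>F. cnj (c i) * \<kappa> j i) = cnj \<alpha>"
    unfolding \<alpha>_def cnj_sum complex_cnj_mult using F j by (intro sum.cong refl) (metis psd_hermitian[OF psd] subsetD)
  have quad: "0 \<le> u\<^sup>2 + 2 * Re (cnj t * \<alpha>) + (cmod t)\<^sup>2 * k" for t
  proof -
    define d where "d i = (if i = j then t else c i)" for i
    have d: "d i = c i" if "i \<in> F" for i using j that by (auto simp: d_def)
    have "(\<Sum>i\<in>insert j F. \<Sum>k\<in>insert j F. d i * cnj (d k) * \<kappa> i k)
        = t * cnj t * \<kappa> j j + t * (\<Sum>i\<in>F. cnj (c i) * \<kappa> j i)
          + (cnj t * \<alpha> + (\<Sum>i\<in>F. \<Sum>k\<in>F. c i * cnj (c k) * \<kappa> i k))"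
      using F(1) j(2)
      by (simp add: d sum.distrib sum_distrib_left \<alpha>_def mult_ac cong: sum.cong)
        (simp add: d_def mult_ac)
    hence "Re (t * cnj t * \<kappa> j j + t * cnj \<alpha> + (cnj t * \<alpha> + of_real (u\<^sup>2))) \<ge> 0"
      using psd[unfolded psd_def, rule_format, of "insert j F" d] F j
      unfolding \<alpha>' u[symmetric] by (auto simp: nonneg_Reals_iff)
    also have "Re (t * cnj t * \<kappa> j j + t * cnj \<alpha> + (cnj t * \<alpha> + of_real (u\<^sup>2)))
        = u\<^sup>2 + 2 * Re (cnj t * \<alpha>) + (cmod t)\<^sup>2 * k"
      unfolding kjj(1) mult_cnj_eq_cmod by (simp add: algebra_simps)
    finally show ?thesis .
  qed
  have "(cmod \<alpha>)\<^sup>2 \<le> k * u\<^sup>2"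
  proof (cases "k = 0")
    case True
    have "0 \<le> 2 * s * ((cmod \<alpha>)\<^sup>2) + u\<^sup>2" for s
      using quad[of "of_real s * \<alpha>"] True
      by (simp add: mult_cnj_eq_cmod mult.assoc mult.commute[of "cnj \<alpha>"])
    \<comment> \<open>For \<open>k = 0\<close> the expression is affine in \<open>s\<close>; at this
      \<open>s\<close> it would be -1 if \<open>\<alpha>\<close> were nonzero.\<close>
    from this[of "- (u\<^sup>2 + 1) / (2 * (cmod \<alpha>)\<^sup>2)"]
    have le: "0 \<le> 2 * (- (u\<^sup>2 + 1) / (2 * (cmod \<alpha>)\<^sup>2)) * ((cmod \<alpha>)\<^sup>2) + u\<^sup>2" .
    have "2 * (- (u\<^sup>2 + 1) / (2 * (cmod \<alpha>)\<^sup>2)) * ((cmod \<alpha>)\<^sup>2) = - (u\<^sup>2 + 1)" if "\<alpha> \<noteq> 0"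
      using that by simp
    with le have "\<alpha> = 0" by fastforce
    thus ?thesis using True by simp
  next
    case False
    hence k: "k > 0" using kjj by simp
    have "0 \<le> u\<^sup>2 - 2 * ((cmod \<alpha>)\<^sup>2 / k) + ((cmod \<alpha>)\<^sup>2 / k\<^sup>2) * k"
      \<comment> \<open>The minimiser of the quadratic in \<open>t\<close>.\<close>
      using quad[of "- \<alpha> / of_real k"] k
      by (simp add: mult_cnj_eq_cmod mult.assoc mult.commute[of "cnj \<alpha>"] norm_divide power_divide
          flip: of_real_power)
    hence "(cmod \<alpha>)\<^sup>2 / k \<le> u\<^sup>2" using k by (simp add: power2_eq_square)
    thus ?thesis using k by (simp add: field_simps)
  qed
  hence "cmod \<alpha> \<le> sqrt (k * u\<^sup>2)" by (rule real_le_rsqrt)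
  thus ?thesis using u0 unfolding \<alpha>_def k_def by (simp add: real_sqrt_mult)
qed

text \<open>Zorn's lemma on partial solutions; a missing index \<open>j\<close> is added by Gram-Schmidt, with
  \<open>ell2_ket j\<close> as the new direction.\<close>

theorem psd_gram:
  fixes \<kappa> :: "'i \<Rightarrow> 'i \<Rightarrow> complex"
  assumes psd: "psd I \<kappa>"
  shows "\<exists>h :: 'i \<Rightarrow> 'i ell2. (\<forall>i\<in>I. \<forall>j\<in>I. cinner (h i) (h j) = \<kappa> i j) \<and>
    (\<forall>i\<in>I. \<forall>t. t \<notin> I \<longrightarrow> ell2_coeff (h i) t = 0)"
proof -
  \<comment> \<open>Relations are used because unions of chains are then immediate. The support
    clause keeps \<open>ell2_ket j\<close> orthogonal to everything chosen before \<open>j\<close>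
    enters the domain.\<close>
  define A where "A = {G :: ('i \<times> 'i ell2) set. Domain G \<subseteq> I \<and>
    (\<forall>(i, x)\<in>G. \<forall>(j, y)\<in>G. cinner x y = \<kappa> i j) \<and>
    (\<forall>(i, x)\<in>G. \<forall>t. t \<notin> Domain G \<longrightarrow> ell2_coeff x t = 0)}"
  have "\<exists>M\<in>A. \<forall>X\<in>A. M \<subseteq> X \<longrightarrow> X = M"
  proof (rule subset_Zorn')
    fix C assume "subset.chain A C"
    hence C: "\<And>X. X \<in> C \<Longrightarrow> X \<in> A" and ch: "\<And>X Y. X \<in> C \<Longrightarrow> Y \<in> C \<Longrightarrow> X \<subseteq> Y \<or> Y \<subseteq> X"
      unfolding subset.chain_def by auto
    show "\<Union>C \<in> A" unfolding A_def mem_Collect_eq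
    proof (intro conjI)
      show "Domain (\<Union>C) \<subseteq> I" using C unfolding A_def by blast
      show "\<forall>(i, x)\<in>\<Union>C. \<forall>(j, y)\<in>\<Union>C. cinner x y = \<kappa> i j"
      proof clarsimp
        fix i x j y X Y assume a: "X \<in> C" "(i, x) \<in> X" "Y \<in> C" "(j, y) \<in> Y"
        then obtain Z where "Z \<in> C" "(i, x) \<in> Z" "(j, y) \<in> Z" using ch by blast
        thus "cinner x y = \<kappa> i j" using C unfolding A_def by fast
      qed
      show "\<forall>(i, x)\<in>\<Union>C. \<forall>t. t \<notin> Domain (\<Union>C) \<longrightarrow> ell2_coeff x t = 0"
      proof clarsimp
        fix i x t X assume a: "X \<in> C" "(i, x) \<in> X" "t \<notin> Domain (\<Union>C)"
        hence "t \<notin> Domain X" by blast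
        thus "ell2_coeff x t = 0" using C[OF a(1)] a(2) unfolding A_def by fast
      qed
    qed
  qed
  then obtain G where G: "G \<in> A" and max: "\<And>X. X \<in> A \<Longrightarrow> G \<subseteq> X \<Longrightarrow> X = G" by blast
  define J where "J = Domain G"
  have JI: "J \<subseteq> I" using G unfolding A_def J_def by blast
  define h where "h i = (SOME x. (i, x) \<in> G)" for i
  have hG: "(i, h i) \<in> G" if "i \<in> J" for i
    using that unfolding J_def h_def by (metis DomainE someI)
  have hh: "cinner (h i) (h j) = \<kappa> i j" if "i \<in> J" "j \<in> J" for i j
    using hG[OF that(1)] hG[OF that(2)] G unfolding A_def by fast
  have supp: "ell2_coeff x t = 0" if "(i, x) \<in> G" "t \<notin> J" for i x t
    using G that unfolding A_def J_def by fast
  \<comment> \<open>Two values at the same index have a difference of norm 0, so the maximal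
    relation is a function.\<close>
  have Gh: "x = h i" if "(i, x) \<in> G" for i x
  proof -
    have i: "i \<in> J" using that unfolding J_def by blast
    have c: "cinner y z = \<kappa> i i" if "(i, y) \<in> G" "(i, z) \<in> G" for y z
      using G that unfolding A_def by fast
    have "cinner (x - h i) (x - h i) = 0"
      using that hG[OF i] by (simp add: cinner_diff_left cinner_diff_right c)
    thus ?thesis by (simp add: cinner_self)
  qed
  have "I \<subseteq> J"
  proof (rule ccontr)
    assume "\<not> I \<subseteq> J"
    then obtain j where j: "j \<in> I" "j \<notin> J" by blast
    have kjj: "\<kappa> j j = of_real (Re (\<kappa> j j))" "0 \<le> Re (\<kappa> j j)"
      using psd[unfolded psd_def, rule_format, of "{j}" "\<lambda>_. 1"] j
      by (auto simp: nonneg_Reals_iff complex_eq_iff)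
    have "cmod (\<Sum>i\<in>F. c i * \<kappa> i j) \<le> sqrt (Re (\<kappa> j j)) * norm (\<Sum>i\<in>F. scaleC (c i) (h i))"
      if F: "finite F" "F \<subseteq> J" for F c
    proof (rule psd_cauchy_schwarz[OF psd F(1)])
      show "complex_of_real ((norm (\<Sum>i\<in>F. scaleC (c i) (h i)))\<^sup>2) = (\<Sum>i\<in>F. \<Sum>k\<in>F. c i * cnj (c k) * \<kappa> i k)"
        unfolding cinner_self[symmetric] cinner_sum_left unfolding cinner_sum_right
        using F(2) by (intro sum.cong refl) (auto simp: cinner_scaleC_left cinner_scaleC_right hh subset_iff)
    qed (use F j JI in auto)
    from riesz_family[where h=h and I=J, OF this] obtain p where p: "norm p \<le> sqrt (Re (\<kappa> j j))"
      "\<And>i. i \<in> J \<Longrightarrow> cinner (h i) p = \<kappa> i j" "\<And>z. (\<forall>i\<in>J. cinner (h i) z = 0) \<Longrightarrow> cinner p z = 0"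
      using kjj(2) by auto
    \<comment> \<open>\<open>p\<close> lies in the closed span of the \<open>h i\<close>, all of
      which are orthogonal to \<open>ell2_ket t\<close>.\<close>
    have p_supp: "ell2_coeff p t = 0" if "t \<notin> J" for t
      using p(3)[of "ell2_ket t"] supp[OF hG that] by (simp add: cinner_ket)
    have p2: "(norm p)\<^sup>2 \<le> Re (\<kappa> j j)"
      using power_mono[OF p(1) norm_ge_zero, of 2] kjj(2) by simp
    \<comment> \<open>\<open>p\<close> gives the inner products with the old vectors; the new
      direction supplies the part of \<open>\<kappa> j j\<close> missing from the squared norm of
      \<open>p\<close>, which is nonnegative by \<open>p2\<close>.\<close>
    define y where "y = p + scaleC (of_real (sqrt (Re (\<kappa> j j) - (norm p)\<^sup>2))) (ell2_ket j)"
    have xy: "cinner x y = \<kappa> i j" if "(i, x) \<in> G" for i x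
      using that supp[OF that j(2)] p(2)[of i] Gh[OF that] unfolding y_def J_def
      by (auto simp: cinner_add_right cinner_scaleC_right cinner_ket)
    have yx: "cinner y x = \<kappa> j i" if "(i, x) \<in> G" for i x
      using xy[OF that] cinner_commute[of y x] psd_hermitian[OF psd, of j i] j JI that unfolding J_def by auto
    have "Re (cinner y y) = Re (\<kappa> j j)"
      using p2 unfolding norm_sq_eq_cinner[symmetric] y_def norm_sq_add
      by (simp add: cinner_scaleC_right cinner_ket p_supp[OF j(2)] norm_scaleC)
    hence yy: "cinner y y = \<kappa> j j" using kjj(1) cinner_self[of y] by (simp add: complex_eq_iff)
    have "insert (j, y) G \<in> A" unfolding A_def mem_Collect_eq
    proof (intro conjI)
      show "Domain (insert (j, y) G) \<subseteq> I" using JI j unfolding J_def by auto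
      have "\<forall>(i, x)\<in>G. \<forall>(j, y)\<in>G. cinner x y = \<kappa> i j" using G unfolding A_def by blast
      thus "\<forall>(i, x)\<in>insert (j, y) G. \<forall>(k, z)\<in>insert (j, y) G. cinner x z = \<kappa> i k"
        using xy yx yy by auto
      have "ell2_coeff y t = 0" if "t \<notin> J" "t \<noteq> j" for t
        using p_supp that unfolding y_def by (simp add: plus_ell2.rep_eq scaleC_ell2.rep_eq ell2_ket.rep_eq)
      thus "\<forall>(i, x)\<in>insert (j, y) G. \<forall>t. t \<notin> Domain (insert (j, y) G) \<longrightarrow> ell2_coeff x t = 0"
        using supp unfolding J_def by auto
    qed
    hence "(j, y) \<in> G" using max[of "insert (j, y) G"] by blast
    thus False using j unfolding J_def by blast
  qed
  moreover have "ell2_coeff (h i) t = 0" if "i \<in> I" "t \<notin> I" for i t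
    using supp[OF hG] that JI calculation by blast
  ultimately show ?thesis using hh by (intro exI[of _ h]) blast
qed

text \<open>The support clause of \<open>psd_gram\<close> cuts the coordinate sum down to
  \<open>N\<close> terms, so a positive matrix is a sum of \<open>N\<close> rank-one
  matrices.\<close>

lemma psd_decomposition:
  assumes "psd {..<N::nat} \<kappa>"
  shows "\<exists>\<gamma> :: nat \<Rightarrow> nat \<Rightarrow> complex. \<forall>i<N. \<forall>j<N. \<kappa> i j = (\<Sum>k<N. \<gamma> k i * cnj (\<gamma> k j))"
proof -
  obtain h :: "nat \<Rightarrow> nat ell2" where h: "\<And>i j. i < N \<Longrightarrow> j < N \<Longrightarrow> cinner (h i) (h j) = \<kappa> i j"
    "\<And>i t. i < N \<Longrightarrow> \<not> t < N \<Longrightarrow> ell2_coeff (h i) t = 0"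
    using psd_gram[OF assms] by (metis lessThan_iff)
  have "\<kappa> i j = (\<Sum>k<N. ell2_coeff (h i) k * cnj (ell2_coeff (h j) k))" if "i < N" "j < N" for i j
  proof -
    have "\<kappa> i j = (\<Sum>\<^sub>\<infinity>k. ell2_coeff (h i) k * cnj (ell2_coeff (h j) k))"
      using h(1)[OF that] by (simp add: cinner_ell2.rep_eq)
    also have "\<dots> = (\<Sum>\<^sub>\<infinity>k\<in>{..<N}. ell2_coeff (h i) k * cnj (ell2_coeff (h j) k))"
      by (rule infsum_cong_neutral) (use h(2) that in auto)
    finally show ?thesis by simp
  qed
  thus ?thesis by (intro exI[of _ "\<lambda>k i. ell2_coeff (h i) k"]) auto
qed

lemma scaleC_minus_one: "scaleC (- 1) x = - (x::'a::chilbert)"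
  using scaleC_diff_left[of 0 1 x] by (simp add: scaleC_zero_left scaleC_one)

lemma cinner_lincomb:
  "cinner (\<Sum>i\<in>F. scaleC (c i) (x i)) (\<Sum>j\<in>G. scaleC (e j) (y j :: 'a::chilbert))
    = (\<Sum>i\<in>F. \<Sum>j\<in>G. c i * cnj (e j) * cinner (x i) (y j))"
  unfolding cinner_sum_left unfolding cinner_sum_right
  by (simp add: cinner_scaleC_left cinner_scaleC_right mult_ac)

lemma psdI_real:
  assumes "\<And>F c. finite F \<Longrightarrow> F \<subseteq> I \<Longrightarrow>
    \<exists>r\<ge>0. (\<Sum>i\<in>F. \<Sum>j\<in>F. c i * cnj (c j) * \<kappa> i j) = complex_of_real r"
  shows "psd I \<kappa>"
  unfolding psd_def
proof (intro allI impI)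
  fix F :: "'a set" and c assume "finite F" "F \<subseteq> I"
  from assms[OF this, of c] obtain r where "r \<ge> 0"
    "(\<Sum>i\<in>F. \<Sum>j\<in>F. c i * cnj (c j) * \<kappa> i j) = complex_of_real r" by blast
  thus "(\<Sum>i\<in>F. \<Sum>j\<in>F. c i * cnj (c j) * \<kappa> i j) \<in> \<real>\<^sub>\<ge>\<^sub>0" by simp
qed

text \<open>On \<open>\<complex>\<^sup>m\<close> the difference of the two sides is a positive form, hence a sum of squares.\<close>

lemma quadratic_bound_lift:
  fixes M :: "'a \<Rightarrow> nat \<Rightarrow> complex" and d :: "nat \<Rightarrow> 'x::chilbert"
  assumes A: "finite A"
    and bound: "\<And>d. (\<Sum>a\<in>A. (cmod (\<Sum>l<m. M a l * d l))\<^sup>2) \<le> C * (\<Sum>l<m. (cmod (d l))\<^sup>2)"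
  shows "(\<Sum>a\<in>A. (norm (\<Sum>l<m. scaleC (M a l) (d l)))\<^sup>2) \<le> C * (\<Sum>l<m. (norm (d l))\<^sup>2)"
proof -
  define \<kappa> where "\<kappa> l l' = (if l = l' then complex_of_real C else 0) - (\<Sum>a\<in>A. M a l * cnj (M a l'))" for l l'
  \<comment> \<open>Stated for every Hilbert space: with scalars it turns \<open>bound\<close> into
    positivity of \<open>\<kappa>\<close>, with vectors it carries the decomposition of
    \<open>\<kappa>\<close> to the claim.\<close>
  have form: "(\<Sum>l<m. \<Sum>l'<m. \<kappa> l l' * cinner (x l) (x l'))
      = of_real (C * (\<Sum>l<m. (norm (x l))\<^sup>2) - (\<Sum>a\<in>A. (norm (\<Sum>l<m. scaleC (M a l) (x l)))\<^sup>2))"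
    for x :: "nat \<Rightarrow> 'z::chilbert"
  proof -
    have 1: "complex_of_real (C * (\<Sum>l<m. (norm (x l))\<^sup>2)) =
        (\<Sum>l<m. \<Sum>l'<m. (if l = l' then complex_of_real C else 0) * cinner (x l) (x l'))"
      by (simp add: cinner_self sum_distrib_left if_distrib[of "\<lambda>z. z * _"] cong: if_cong)
    have 2: "complex_of_real (\<Sum>a\<in>A. (norm (\<Sum>l<m. scaleC (M a l) (x l)))\<^sup>2) =
        (\<Sum>l<m. \<Sum>l'<m. (\<Sum>a\<in>A. M a l * cnj (M a l')) * cinner (x l) (x l'))"
      unfolding of_real_sum cinner_self[symmetric] cinner_lincomb sum_distrib_right
      by (subst sum.swap[where A=A], intro sum.cong refl, rule sum.swap)
    show ?thesis unfolding of_real_diff 1 2 sum_subtractf[symmetric] left_diff_distrib[symmetric] \<kappa>_def ..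
  qed
  have "psd {..<m} \<kappa>"
  proof (rule psdI_real)
    fix F :: "nat set" and c :: "nat \<Rightarrow> complex" assume F: "finite F" "F \<subseteq> {..<m}"
    let ?c = "\<lambda>i. if i \<in> F then c i else 0"
    have inner: "(\<Sum>j\<in>F. c i * cnj (c j) * \<kappa> i j) = (\<Sum>j<m. \<kappa> i j * cinner (?c i) (?c j))" if "i \<in> F" for i
      using F that by (intro sum.mono_neutral_cong_left) (auto simp: cinner_complex_def)
    have "(\<Sum>i\<in>F. \<Sum>j\<in>F. c i * cnj (c j) * \<kappa> i j) = (\<Sum>i<m. \<Sum>j<m. \<kappa> i j * cinner (?c i) (?c j))"
      using F inner by (intro sum.mono_neutral_cong_left) (auto simp: cinner_complex_def)
    thus "\<exists>r\<ge>0. (\<Sum>i\<in>F. \<Sum>j\<in>F. c i * cnj (c j) * \<kappa> i j) = complex_of_real r"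
      unfolding form using bound[of ?c]
      by (intro exI[of _ "C * (\<Sum>l<m. (norm (?c l))\<^sup>2) - (\<Sum>a\<in>A. (norm (\<Sum>l<m. scaleC (M a l) (?c l)))\<^sup>2)"])
        (simp add: scaleC_complex_def)
  qed
  then obtain \<gamma> :: "nat \<Rightarrow> nat \<Rightarrow> complex" where \<gamma>: "\<And>i j. i < m \<Longrightarrow> j < m \<Longrightarrow> \<kappa> i j = (\<Sum>k<m. \<gamma> k i * cnj (\<gamma> k j))"
    using psd_decomposition by blast
  have "(\<Sum>l<m. \<Sum>l'<m. \<kappa> l l' * cinner (d l) (d l'))
      = (\<Sum>l<m. \<Sum>l'<m. \<Sum>k<m. \<gamma> k l * cnj (\<gamma> k l') * cinner (d l) (d l'))"
    by (intro sum.cong refl) (simp add: \<gamma> sum_distrib_right)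
  also have "\<dots> = (\<Sum>k<m. \<Sum>l<m. \<Sum>l'<m. \<gamma> k l * cnj (\<gamma> k l') * cinner (d l) (d l'))"
    by (rule trans[OF sum.cong[OF refl sum.swap] sum.swap])
  also have "\<dots> = of_real (\<Sum>k<m. (norm (\<Sum>l<m. scaleC (\<gamma> k l) (d l)))\<^sup>2)"
    unfolding of_real_sum cinner_self[symmetric] cinner_lincomb ..
  finally have "C * (\<Sum>l<m. (norm (d l))\<^sup>2) - (\<Sum>a\<in>A. (norm (\<Sum>l<m. scaleC (M a l) (d l)))\<^sup>2)
      = (\<Sum>k<m. (norm (\<Sum>l<m. scaleC (\<gamma> k l) (d l)))\<^sup>2)"
    unfolding form of_real_eq_iff .
  thus ?thesis by (smt (verit) sum_nonneg zero_le_power2)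
qed

section \<open>Square-summable families of vectors\<close>

definition sq_sum :: "('w \<Rightarrow> 'x::chilbert) \<Rightarrow> bool" where
  "sq_sum f \<longleftrightarrow> (\<lambda>w. (norm (f w))\<^sup>2) summable_on UNIV"

lemma norm_add_sq_le: "(norm (x + y :: 'a::real_normed_vector))\<^sup>2 \<le> 2 * (norm x)\<^sup>2 + 2 * (norm y)\<^sup>2"
proof -
  have "(norm (x + y))\<^sup>2 \<le> (norm x + norm y)\<^sup>2" by (intro power_mono norm_triangle_ineq) auto
  also have "\<dots> \<le> 2 * (norm x)\<^sup>2 + 2 * (norm y)\<^sup>2"
    using zero_le_power2[of "norm x - norm y"] by (simp add: power2_sum power2_diff)
  finally show ?thesis .
qed

lemma sq_sum_add: "sq_sum f \<Longrightarrow> sq_sum g \<Longrightarrow> sq_sum (\<lambda>w. f w + g w)"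
  unfolding sq_sum_def
  by (rule summable_on_comparison_test[of "\<lambda>w. 2 * (norm (f w))\<^sup>2 + 2 * (norm (g w))\<^sup>2"])
    (auto intro!: summable_on_add summable_on_cmult_right norm_add_sq_le)

lemma sq_sum_scale: "sq_sum f \<Longrightarrow> sq_sum (\<lambda>w. scaleC c (f w))"
  unfolding sq_sum_def norm_scaleC power_mult_distrib by (rule summable_on_cmult_right)

lemma sq_sum_sum: "(\<And>i. i \<in> F \<Longrightarrow> sq_sum (f i)) \<Longrightarrow> sq_sum (\<lambda>w. \<Sum>i\<in>F. f i w)"
  by (induction F rule: infinite_finite_induct) (auto intro: sq_sum_add simp: sq_sum_def[of "\<lambda>_. 0"])

lemma sq_sum_lincomb: "(\<And>i. i \<in> F \<Longrightarrow> sq_sum (f i)) \<Longrightarrow> sq_sum (\<lambda>w. \<Sum>i\<in>F. scaleC (c i) (f i w))"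
  by (intro sq_sum_sum sq_sum_scale)

lemma sq_sumI:
  assumes "\<And>F. finite F \<Longrightarrow> (\<Sum>w\<in>F. (norm (f w))\<^sup>2) \<le> C"
  shows "sq_sum f" "(\<Sum>\<^sub>\<infinity>w. (norm (f w))\<^sup>2) \<le> C"
proof -
  show "sq_sum f" unfolding sq_sum_def using assms
    by (intro nonneg_bdd_above_summable_on bdd_aboveI[where M=C]) auto
  thus "(\<Sum>\<^sub>\<infinity>w. (norm (f w))\<^sup>2) \<le> C" unfolding sq_sum_def
    by (intro infsum_le_finite_sums) (use assms in auto)
qed

lemma sq_sum_cinner:
  assumes "sq_sum f" "sq_sum g"
  shows "(\<lambda>w. cinner (f w) (g w)) summable_on UNIV"
proof (rule abs_summable_summable, rule summable_on_comparison_test)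
  show "(\<lambda>w. (norm (f w))\<^sup>2 + (norm (g w))\<^sup>2) summable_on UNIV"
    using assms unfolding sq_sum_def by (rule summable_on_add)
  fix w
  have "2 * (norm (f w) * norm (g w)) \<le> (norm (f w))\<^sup>2 + (norm (g w))\<^sup>2"
    using sum_squares_bound[of "norm (f w)" "norm (g w)"] by (simp add: mult.assoc)
  moreover have "0 \<le> norm (f w) * norm (g w)" by simp
  ultimately show "cmod (cinner (f w) (g w)) \<le> (norm (f w))\<^sup>2 + (norm (g w))\<^sup>2"
    using cauchy_schwarz[of "f w" "g w"] by linarith
qed auto

section \<open>The inner product of square-summable families and its realisation in a Hilbert
  space\<close>

definition vip :: "('w \<Rightarrow> 'x::chilbert) \<Rightarrow> ('w \<Rightarrow> 'x) \<Rightarrow> complex" where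
  "vip f g = (\<Sum>\<^sub>\<infinity>w. cinner (f w) (g w))"

lemma vip_commute: "vip f g = cnj (vip g f)"
  unfolding vip_def infsum_cnj[symmetric] by (subst cinner_commute) simp

lemma vip_lincomb_left:
  assumes "finite F" "\<And>i. i \<in> F \<Longrightarrow> sq_sum (f i)" "sq_sum g"
  shows "vip (\<lambda>w. \<Sum>i\<in>F. scaleC (c i) (f i w)) g = (\<Sum>i\<in>F. c i * vip (f i) g)"
  using assms(1,2)
proof (induction F rule: finite_induct)
  case (insert i F)
  have "vip (\<lambda>w. \<Sum>i\<in>insert i F. scaleC (c i) (f i w)) g =
      (\<Sum>\<^sub>\<infinity>w. c i * cinner (f i w) (g w) + cinner (\<Sum>i\<in>F. scaleC (c i) (f i w)) (g w))"
    unfolding vip_def using insert.hyps by (simp add: cinner_add_left cinner_scaleC_left)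
  also have "\<dots> = c i * vip (f i) g + vip (\<lambda>w. \<Sum>i\<in>F. scaleC (c i) (f i w)) g"
    unfolding vip_def
    by (subst infsum_add)
      (use insert.prems assms(3) in \<open>auto intro!: summable_on_cmult_right sq_sum_cinner sq_sum_lincomb
        simp: infsum_cmult_right'\<close>)
  finally show ?case using insert by simp
qed (simp add: vip_def cinner_zero_left)

lemma vip_lincomb_right:
  assumes "finite F" "\<And>i. i \<in> F \<Longrightarrow> sq_sum (f i)" "sq_sum g"
  shows "vip g (\<lambda>w. \<Sum>i\<in>F. scaleC (c i) (f i w)) = (\<Sum>i\<in>F. cnj (c i) * vip g (f i))"
  using arg_cong[OF vip_lincomb_left[OF assms, where c=c], where f=cnj]
  by (simp add: vip_commute[of g])

lemma vip_self: "sq_sum f \<Longrightarrow> vip f f = of_real (\<Sum>\<^sub>\<infinity>w. (norm (f w))\<^sup>2)"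
  unfolding vip_def cinner_self sq_sum_def by (intro infsumI has_sum_of_real has_sum_infsum)

lemma psd_vip: "psd {f :: 'w \<Rightarrow> 'x::chilbert. sq_sum f} vip"
proof (rule psdI_real)
  fix F :: "('w \<Rightarrow> 'x) set" and c assume F: "finite F" "F \<subseteq> {f. sq_sum f}"
  let ?s = "\<lambda>w. \<Sum>f\<in>F. scaleC (c f) (f w)"
  have sq: "sq_sum f" if "f \<in> F" for f using F that by auto
  have "(\<Sum>i\<in>F. \<Sum>j\<in>F. c i * cnj (c j) * vip i j) = vip ?s ?s"
    using F(1) by (simp add: vip_lincomb_left vip_lincomb_right sq sq_sum_lincomb sum_distrib_left mult_ac)
  also have "\<dots> = complex_of_real (\<Sum>\<^sub>\<infinity>w. (norm (?s w))\<^sup>2)"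
    by (intro vip_self sq_sum_lincomb sq)
  finally show "\<exists>r\<ge>0. (\<Sum>i\<in>F. \<Sum>j\<in>F. c i * cnj (c j) * vip i j) = complex_of_real r"
    by (intro exI[of _ "\<Sum>\<^sub>\<infinity>w. (norm (?s w))\<^sup>2"] conjI infsum_nonneg) auto
qed

text \<open>A copy of the vector-valued sequence space: Gram vectors of the positive kernel
  \<open>vip\<close>, indexed by the families themselves. The values are meaningful only on families
  with \<open>sq_sum\<close>.\<close>

definition vell2 :: "('w \<Rightarrow> 'x::chilbert) \<Rightarrow> ('w \<Rightarrow> 'x) ell2" where
  "vell2 = (SOME h. \<forall>f\<in>{f. sq_sum f}. \<forall>g\<in>{f. sq_sum f}. cinner (h f) (h g) = vip f g)"

lemma cinner_vell2: "sq_sum f \<Longrightarrow> sq_sum g \<Longrightarrow> cinner (vell2 f) (vell2 g) = vip f g"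
proof -
  have "\<exists>h :: ('a \<Rightarrow> 'b) \<Rightarrow> ('a \<Rightarrow> 'b) ell2. \<forall>f\<in>{f. sq_sum f}. \<forall>g\<in>{f. sq_sum f}. cinner (h f) (h g) = vip f g"
    using psd_gram[OF psd_vip] by blast
  from someI_ex[OF this] show "sq_sum f \<Longrightarrow> sq_sum g \<Longrightarrow> ?thesis" unfolding vell2_def by blast
qed

lemma norm_vell2: "sq_sum f \<Longrightarrow> (norm (vell2 f))\<^sup>2 = (\<Sum>\<^sub>\<infinity>w. (norm (f w))\<^sup>2)"
  using cinner_vell2[of f f] by (simp add: norm_sq_eq_cinner vip_self)

text \<open>\<open>vell2\<close> is merely chosen, but its inner products are prescribed, so the two
  sides differ by a vector of norm 0.\<close>

lemma vell2_lincomb: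
  assumes "finite F" "\<And>i. i \<in> F \<Longrightarrow> sq_sum (f i)"
  shows "vell2 (\<lambda>w. \<Sum>i\<in>F. scaleC (c i) (f i w)) = (\<Sum>i\<in>F. scaleC (c i) (vell2 (f i)))"
proof -
  let ?s = "\<lambda>w. \<Sum>i\<in>F. scaleC (c i) (f i w)" and ?t = "\<Sum>i\<in>F. scaleC (c i) (vell2 (f i))"
  have s: "sq_sum ?s" by (intro sq_sum_lincomb assms)
  have 1: "cinner x ?t = vip g ?s" if "x = vell2 g" "sq_sum g" for x g
    using assms that by (simp add: cinner_sum_right cinner_scaleC_right cinner_vell2 vip_lincomb_right)
  have 2: "cinner ?t ?t = vip ?s ?s"
    using assms by (subst cinner_sum_left) (simp add: cinner_scaleC_left 1 vip_lincomb_left s)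
  have "cinner (vell2 ?s - ?t) (vell2 ?s - ?t) = 0"
    using 1[OF refl s] 2 cinner_commute[of ?t "vell2 ?s"] cinner_vell2[OF s s] vip_commute[of ?s ?s]
    by (simp add: cinner_diff_left cinner_diff_right)
  thus ?thesis by (simp add: cinner_self)
qed

lemma vell2_diff: "sq_sum f \<Longrightarrow> sq_sum g \<Longrightarrow> vell2 (\<lambda>w. f w - g w) = vell2 f - vell2 g"
  using vell2_lincomb[of "UNIV :: bool set" "\<lambda>b. if b then f else g" "\<lambda>b. if b then 1 else - 1"]
  by (simp add: UNIV_bool scaleC_one scaleC_minus_one)

text \<open>Fubini along a parametrisation by pairs of everything except one point \<open>c\<close>.
  It is used with \<open>c\<close> the empty word, the other words being split at their first or at
  their last letter.\<close>

lemma infsum_split: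
  fixes f :: "'c \<Rightarrow> real" and j :: "'a \<times> 'b \<Rightarrow> 'c"
  assumes f: "f summable_on UNIV" and j: "inj j" "range j = - {c}"
  shows "(\<lambda>b. f (j (a, b))) summable_on UNIV"
    and "(\<lambda>a. \<Sum>\<^sub>\<infinity>b. f (j (a, b))) summable_on UNIV"
    and "(\<Sum>\<^sub>\<infinity>x. f x) = f c + (\<Sum>\<^sub>\<infinity>a. \<Sum>\<^sub>\<infinity>b. f (j (a, b)))"
proof -
  have "f summable_on range j" using f by (rule summable_on_subset_banach) auto
  hence s: "(\<lambda>x. f (j x)) summable_on UNIV \<times> UNIV"
    using summable_on_reindex[OF j(1), of f] by (simp add: o_def)
  show 1: "(\<lambda>b. f (j (a, b))) summable_on UNIV" for a
    using summable_on_SigmaD1[of "\<lambda>a b. f (j (a, b))" UNIV "\<lambda>_. UNIV" a] s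
    by (simp add: cond_case_prod_eta[of "\<lambda>a b. f (j (a, b))" "\<lambda>x. f (j x)"] del: UNIV_Times_UNIV)
  have "((\<lambda>x. f (j x)) has_sum (\<Sum>\<^sub>\<infinity>x. f (j x))) (UNIV \<times> UNIV)"
    using s has_sum_infsum by fastforce
  from has_sum_Sigma'[OF this has_sum_infsum[OF 1]]
  have h: "((\<lambda>a. \<Sum>\<^sub>\<infinity>b. f (j (a, b))) has_sum (\<Sum>\<^sub>\<infinity>x. f (j x))) UNIV" .
  thus "(\<lambda>a. \<Sum>\<^sub>\<infinity>b. f (j (a, b))) summable_on UNIV" unfolding summable_on_def by blast
  have "(\<Sum>\<^sub>\<infinity>x. f x) = (\<Sum>\<^sub>\<infinity>x\<in>insert c (range j). f x)" using j(2) by (intro arg_cong[of _ _ "infsum f"]) auto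
  also have "\<dots> = f c + (\<Sum>\<^sub>\<infinity>x\<in>range j. f x)"
    by (rule infsum_insert) (use j(2) \<open>f summable_on range j\<close> in auto)
  also have "(\<Sum>\<^sub>\<infinity>x\<in>range j. f x) = (\<Sum>\<^sub>\<infinity>x. f (j x))"
    using infsum_reindex[OF j(1), of f] by (simp add: o_def)
  finally show "(\<Sum>\<^sub>\<infinity>x. f x) = f c + (\<Sum>\<^sub>\<infinity>a. \<Sum>\<^sub>\<infinity>b. f (j (a, b)))" using infsumI[OF h] by simp
qed

lemma inj_cons_split: "inj (\<lambda>(b, w). b # w)" "range (\<lambda>(b, w). b # w) = - {[]}"
proof -
  show "range (\<lambda>(b, w). b # w) = - {[] :: 'b list}"
    by (auto simp: image_iff) (meson neq_Nil_conv)
qed (auto simp: inj_def)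

lemma inj_snoc_split: "inj (\<lambda>(w, b). w @ [b])" "range (\<lambda>(w, b). w @ [b]) = - {[]}"
proof -
  show "range (\<lambda>(w, b). w @ [b]) = - {[] :: 'b list}"
    by (auto simp: image_iff) (meson rev_exhaust)
qed (auto simp: inj_def)

section \<open>Operator matrices\<close>

lemma vec_norm_sq: "(vec_norm x)\<^sup>2 = (\<Sum>i<dim_vec x. (norm (x $ i))\<^sup>2)"
proof -
  have "vec_cinner x x = of_real (\<Sum>i<dim_vec x. (norm (x $ i))\<^sup>2)"
    by (simp add: vec_cinner_def cinner_self)
  thus ?thesis by (simp add: vec_norm_def sum_nonneg)
qed

lemma vec_norm_nonneg: "0 \<le> vec_norm x"
  by (simp add: vec_norm_def vec_cinner_def cinner_self sum_nonneg)

lemma vec_norm_eq_L2: "vec_norm x = L2_set (\<lambda>i. norm (x $ i)) {..<dim_vec x}"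
  unfolding L2_set_def vec_norm_sq[symmetric] using vec_norm_nonneg[of x] by simp

lemma dim_opmat_apply [simp]: "dim_vec (opmat_apply A x) = dim_row A"
  by (simp add: opmat_apply_def)

text \<open>A crude sum of entrywise bounds suffices: it makes the supremum in
  \<open>opmat_norm\<close> a supremum of a bounded set and settles vectors of norm 0.\<close>

lemma opmat_apply_bounded:
  shows "\<exists>C\<ge>0. \<forall>x\<in>carrier_vec (dim_col A). vec_norm (opmat_apply A x) \<le> C * vec_norm x"
proof -
  have "\<exists>C. \<forall>i j. 0 \<le> C i j \<and> (\<forall>x. norm (cblop_apply (A $$ (i, j)) x) \<le> C i j * norm x)"
    by (intro choice allI) (use cblop_ex_bound in blast)
  then obtain C where C: "\<And>i j. 0 \<le> C i j" "\<And>i j x. norm (cblop_apply (A $$ (i, j)) x) \<le> C i j * norm x"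
    by blast
  have "vec_norm (opmat_apply A x) \<le> (\<Sum>i<dim_row A. \<Sum>j<dim_col A. C i j) * vec_norm x"
    if x: "x \<in> carrier_vec (dim_col A)" for x
  proof -
    have xj: "norm (x $ j) \<le> vec_norm x" if "j < dim_col A" for j
      unfolding vec_norm_eq_L2 using x that by (intro member_le_L2_set) auto
    have "vec_norm (opmat_apply A x) \<le> (\<Sum>i<dim_row A. norm (opmat_apply A x $ i))"
      unfolding vec_norm_eq_L2 dim_opmat_apply by (rule L2_set_le_sum) auto
    also have "\<dots> \<le> (\<Sum>i<dim_row A. \<Sum>j<dim_col A. C i j * vec_norm x)"
      unfolding opmat_apply_def
      by (intro sum_mono) (auto intro!: sum_norm_le order_trans[OF C(2)] mult_left_mono C(1) xj)
    finally show ?thesis by (simp add: sum_distrib_right)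
  qed
  thus ?thesis by (intro exI[of _ "\<Sum>i<dim_row A. \<Sum>j<dim_col A. C i j"]) (auto intro!: sum_nonneg C)
qed

lemma opmat_apply_scale:
  assumes "x \<in> carrier_vec (dim_col A)"
  shows "opmat_apply A (map_vec (scaleC c) x) = map_vec (scaleC c) (opmat_apply A x)"
  using assms unfolding opmat_apply_def
  by (intro eq_vecI) (auto simp: cblop_scale scaleC_sum_right)

lemma vec_norm_scale: "vec_norm (map_vec (scaleC c) x) = cmod c * vec_norm x"
  unfolding vec_norm_eq_L2 L2_set_right_distrib[OF norm_ge_zero]
  by (intro L2_set_cong) (auto simp: norm_scaleC)

lemma opmat_norm_upper:
  assumes "x \<in> carrier_vec (dim_col A)" "vec_norm x \<le> 1"
  shows "vec_norm (opmat_apply A x) \<le> opmat_norm A"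
proof -
  obtain C where C: "0 \<le> C" "\<And>x. x \<in> carrier_vec (dim_col A) \<Longrightarrow> vec_norm (opmat_apply A x) \<le> C * vec_norm x"
    using opmat_apply_bounded[of A] by blast
  have "bdd_above ((\<lambda>x. vec_norm (opmat_apply A x)) ` {x \<in> carrier_vec (dim_col A). vec_norm x \<le> 1})"
    by (rule bdd_aboveI[where M=C]) (auto intro!: order_trans[OF C(2)] mult_left_le C(1))
  thus ?thesis unfolding opmat_norm_def using assms by (intro cSUP_upper) auto
qed

lemma opmat_norm_bound:
  assumes x: "x \<in> carrier_vec (dim_col A)"
  shows "vec_norm (opmat_apply A x) \<le> opmat_norm A * vec_norm x"
proof (cases "vec_norm x = 0")
  case True
  obtain C where "vec_norm (opmat_apply A x) \<le> C * vec_norm x"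
    using opmat_apply_bounded[of A] x by blast
  thus ?thesis using True by simp
next
  case False
  hence pos: "vec_norm x > 0" using vec_norm_nonneg[of x] by simp
  let ?c = "complex_of_real (1 / vec_norm x)"
  have "vec_norm (opmat_apply A (map_vec (scaleC ?c) x)) \<le> opmat_norm A"
    using x pos by (intro opmat_norm_upper) (auto simp: vec_norm_scale norm_divide)
  thus ?thesis using pos by (simp add: opmat_apply_scale[OF x] vec_norm_scale norm_divide field_simps)
qed

lemma opmat_norm_le:
  assumes "\<And>x. x \<in> carrier_vec (dim_col A) \<Longrightarrow> vec_norm (opmat_apply A x) \<le> c * vec_norm x" "0 \<le> c"
  shows "opmat_norm A \<le> c"
  unfolding opmat_norm_def
proof (rule cSUP_least)
  have "0\<^sub>v (dim_col A) \<in> {x \<in> carrier_vec (dim_col A). vec_norm x \<le> 1}"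
    by (simp add: vec_norm_eq_L2 L2_set_def)
  thus "{x \<in> carrier_vec (dim_col A). vec_norm x \<le> 1} \<noteq> {}" by blast
qed (auto intro!: order_trans[OF assms(1)] mult_left_le assms(2))

lemma opmat_norm_nonneg: "0 \<le> opmat_norm A"
  by (rule order_trans[OF vec_norm_nonneg opmat_norm_upper[of "0\<^sub>v (dim_col A)"]])
    (simp_all add: vec_norm_eq_L2 L2_set_def)

section \<open>Words of the coefficients of \<open>Q\<close>\<close>

text \<open>Elements of \<open>X\<^sup>m\<close> and rows in \<open>\<complex>\<^sup>1\<^sup>\<times>\<^sup>m\<close> are functions on \<open>nat\<close> of which only the first
  \<open>m = dim_row W\<close> values matter. \<open>Qc Q W b\<close> is the matrix \<open>Q\<^sub>b(W)\<close> of the values of \<open>Q(W)\<close> at \<open>b\<close>,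
  \<open>Qst Q W b y\<close> is \<open>Q\<^sub>b(W)\<^sup>* y\<close>, \<open>Lact Q W w y\<close> is \<open>L\<^sub>w(W) y\<close>, \<open>ev Q W v y w\<close> is \<open>v L\<^sub>w(W) y\<close>,
  \<open>shiftv Q W b v\<close> is \<open>v Q\<^sub>b(W)\<^sup>*\<close>, and \<open>astar A y\<close> is \<open>A\<^sup>* y\<close>. Letters outside the basis act as 0, so
  that sums over words need no side condition.\<close>

definition Qc :: "('v mat \<Rightarrow> ('r::chilbert, complex) cblop mat) \<Rightarrow> 'v mat \<Rightarrow> 'r \<Rightarrow> nat \<Rightarrow> nat \<Rightarrow> complex" where
  "Qc Q W b l j = cblop_apply (Q W $$ (l, j)) b"

definition Qst :: "('v mat \<Rightarrow> ('r::chilbert, complex) cblop mat) \<Rightarrow> 'v mat \<Rightarrow> 'r \<Rightarrow> (nat \<Rightarrow> 'x::chilbert) \<Rightarrow> nat \<Rightarrow> 'x" where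
  "Qst Q W b y j = (if b \<in> onb \<and> j < dim_row W then \<Sum>l<dim_row W. scaleC (cnj (Qc Q W b l j)) (y l) else 0)"

primrec Lact :: "('v mat \<Rightarrow> ('r::chilbert, complex) cblop mat) \<Rightarrow> 'v mat \<Rightarrow> 'r list \<Rightarrow> (nat \<Rightarrow> 'x::chilbert) \<Rightarrow> nat \<Rightarrow> 'x" where
  "Lact Q W [] y = y"
| "Lact Q W (b # w) y = Qst Q W b (Lact Q W w y)"

definition ev :: "('v mat \<Rightarrow> ('r::chilbert, complex) cblop mat) \<Rightarrow> 'v mat \<Rightarrow> (nat \<Rightarrow> complex) \<Rightarrow> (nat \<Rightarrow> 'x::chilbert) \<Rightarrow> 'r list \<Rightarrow> 'x" where
  "ev Q W v y w = (\<Sum>p<dim_row W. scaleC (v p) (Lact Q W w y p))"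

definition shiftv :: "('v mat \<Rightarrow> ('r::chilbert, complex) cblop mat) \<Rightarrow> 'v mat \<Rightarrow> 'r \<Rightarrow> (nat \<Rightarrow> complex) \<Rightarrow> nat \<Rightarrow> complex" where
  "shiftv Q W b v l = (if b \<in> onb then \<Sum>j<dim_row W. v j * cnj (Qc Q W b l j) else 0)"

definition astar :: "complex mat \<Rightarrow> (nat \<Rightarrow> 'x::chilbert) \<Rightarrow> nat \<Rightarrow> 'x" where
  "astar A y q = (\<Sum>i<dim_row A. scaleC (cnj (A $$ (i, q))) (y i))"

lemma ev_Nil: "ev Q W v y [] = (\<Sum>p<dim_row W. scaleC (v p) (y p))"
  by (simp add: ev_def)

text \<open>The first letter acts last on \<open>y\<close>, so it can be absorbed into the row.
  Shifting a feature vector thus keeps both \<open>W\<close> and \<open>y\<close>.\<close>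

lemma ev_Cons: "ev Q W v y (b # w) = ev Q W (shiftv Q W b v) y w"
proof (cases "b \<in> onb")
  case True
  have "ev Q W v y (b # w) = (\<Sum>p<dim_row W. \<Sum>l<dim_row W. scaleC (v p * cnj (Qc Q W b l p)) (Lact Q W w y l))"
    using True by (simp add: ev_def Qst_def scaleC_sum_right scaleC_scaleC)
  also have "\<dots> = (\<Sum>l<dim_row W. \<Sum>p<dim_row W. scaleC (v p * cnj (Qc Q W b l p)) (Lact Q W w y l))"
    by (rule sum.swap)
  finally show ?thesis using True by (simp add: ev_def shiftv_def scaleC_sum_left)
qed (simp add: ev_def shiftv_def Qst_def scaleC_zero_left scaleC_zero_right)

lemma Lact_snoc: "Lact Q W (w @ [b]) y = Lact Q W w (Qst Q W b y)"
  by (induction w) auto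

text \<open>The last letter acts first on \<open>y\<close>; dropping it replaces a state by its
  image under that letter.\<close>

lemma ev_snoc: "ev Q W v y (w @ [b]) = ev Q W v (Qst Q W b y) w"
  by (simp add: ev_def Lact_snoc)

lemma Qst_lincomb:
  "Qst Q W b (\<lambda>j. \<Sum>i\<in>F. scaleC (c i) (y i j)) = (\<lambda>j. \<Sum>i\<in>F. scaleC (c i) (Qst Q W b (y i) j))"
proof
  fix j
  have "(\<Sum>l<dim_row W. scaleC (cnj (Qc Q W b l j)) (\<Sum>i\<in>F. scaleC (c i) (y i l)))
      = (\<Sum>i\<in>F. scaleC (c i) (\<Sum>l<dim_row W. scaleC (cnj (Qc Q W b l j)) (y i l)))"
    by (simp add: scaleC_sum_right scaleC_scaleC mult.commute sum.swap[of _ F])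
  thus "Qst Q W b (\<lambda>j. \<Sum>i\<in>F. scaleC (c i) (y i j)) j = (\<Sum>i\<in>F. scaleC (c i) (Qst Q W b (y i) j))"
    by (auto simp: Qst_def scaleC_zero_right)
qed

lemma Lact_lincomb:
  "Lact Q W w (\<lambda>j. \<Sum>i\<in>F. scaleC (c i) (y i j)) = (\<lambda>j. \<Sum>i\<in>F. scaleC (c i) (Lact Q W w (y i) j))"
  by (induction w) (simp_all add: Qst_lincomb)

lemma Qst_op: "Qst Q W b (\<lambda>j. cblop_apply T (y j)) = (\<lambda>j. cblop_apply T (Qst Q W b y j))"
  by (auto simp: Qst_def fun_eq_iff cblop_sum cblop_scale cblop_zero)

lemma Lact_op: "Lact Q W w (\<lambda>j. cblop_apply T (y j)) = (\<lambda>j. cblop_apply T (Lact Q W w y j))"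
  by (induction w) (simp_all add: Qst_op)

lemma Qst_cong: "(\<And>l. l < dim_row W \<Longrightarrow> y l = z l) \<Longrightarrow> Qst Q W b y = Qst Q W b z"
  by (auto simp: Qst_def fun_eq_iff)

lemma Lact_cong: "(\<And>l. l < dim_row W \<Longrightarrow> y l = z l) \<Longrightarrow> p < dim_row W \<Longrightarrow> Lact Q W w y p = Lact Q W w z p"
proof (induction w arbitrary: p)
  case (Cons b w)
  show ?case using Qst_cong[of W "Lact Q W w y" "Lact Q W w z" Q b] Cons by simp
qed simp

lemma ev_cong:
  "(\<And>l. l < dim_row W \<Longrightarrow> y l = z l) \<Longrightarrow> (\<And>l. l < dim_row W \<Longrightarrow> u l = v l) \<Longrightarrow> ev Q W u y w = ev Q W v z w"
  unfolding ev_def by (intro sum.cong refl) (auto intro: Lact_cong[THEN arg_cong])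

lemma ev_lincomb_y:
  "ev Q W v (\<lambda>j. \<Sum>i\<in>F. scaleC (c i) (y i j)) w = (\<Sum>i\<in>F. scaleC (c i) (ev Q W v (y i) w))"
  unfolding ev_def Lact_lincomb
  by (simp add: scaleC_sum_right scaleC_scaleC mult.commute sum.swap[of _ F])

lemma ev_lincomb_v:
  "ev Q W (\<lambda>j. \<Sum>i\<in>F. c i * v i j) y w = (\<Sum>i\<in>F. scaleC (c i) (ev Q W (v i) y w))"
  unfolding ev_def
  by (simp add: scaleC_sum_right scaleC_sum_left scaleC_scaleC sum.swap[of _ F])

definition unit_fun :: "nat \<Rightarrow> nat \<Rightarrow> complex" where
  "unit_fun j q = (if q = j then 1 else 0)"

lemma unit_fun_expand: "q < m \<Longrightarrow> (\<Sum>j<m. scaleC (unit_fun j q) (y j)) = y q"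
  by (simp add: unit_fun_def if_distrib[of "\<lambda>c. scaleC c _"] scaleC_one scaleC_zero_left cong: if_cong)

lemma sum_ell2_coeff: "ell2_coeff (sum f A) w = (\<Sum>i\<in>A. ell2_coeff (f i) w)"
  by (induction A rule: infinite_finite_induct) (auto simp: zero_ell2.rep_eq plus_ell2.rep_eq)

lemma dim_opmat_adj [simp]: "dim_row (opmat_adj A) = dim_col A" "dim_col (opmat_adj A) = dim_row A"
  by (simp_all add: opmat_adj_def)

lemma opmat_adj_entry [simp]: "i < dim_col A \<Longrightarrow> j < dim_row A \<Longrightarrow> opmat_adj A $$ (i, j) = op_adj (A $$ (j, i))"
  by (simp add: opmat_adj_def)

lemma dim_opmat_mult [simp]: "dim_row (opmat_mult A B) = dim_row A" "dim_col (opmat_mult A B) = dim_col B"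
  by (simp_all add: opmat_mult_def)

lemma opmat_mult_entry [simp]:
  "i < dim_row A \<Longrightarrow> j < dim_col B \<Longrightarrow>
    opmat_mult A B $$ (i, j) = (\<Sum>k<dim_col A. op_comp (A $$ (i, k)) (B $$ (k, j)))"
  by (simp add: opmat_mult_def)

lemma dim_ampl [simp]: "dim_row (ampl P) = dim_row P" "dim_col (ampl P) = dim_col P"
  by (simp_all add: ampl_def)

lemma ampl_entry [simp]: "i < dim_row P \<Longrightarrow> j < dim_col P \<Longrightarrow> ampl P $$ (i, j) = op_scale (P $$ (i, j)) op_id"
  by (simp add: ampl_def)

text \<open>The points are ordered as in the kernel, but the family at \<open>W\<close> comes first
  in \<open>vip\<close> because inner products are linear in the first argument.\<close>

definition Lvip :: "('v mat \<Rightarrow> ('r::chilbert, complex) cblop mat) \<Rightarrow> 'v mat \<Rightarrow> 'v mat \<Rightarrow>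
    (nat \<Rightarrow> 'x::chilbert) \<Rightarrow> (nat \<Rightarrow> 'x) \<Rightarrow> nat \<Rightarrow> nat \<Rightarrow> complex" where
  "Lvip Q Z W y x p q = vip (\<lambda>w. Lact Q W w y q) (\<lambda>w. Lact Q Z w x p)"

section \<open>Intertwining relations and bounds for the word matrices\<close>

locale nc_row_ball =
  fixes s :: "complex \<Rightarrow> 'v::ab_group_add \<Rightarrow> 'v"
    and \<Xi> :: "'v mat set"
    and Q :: "'v mat \<Rightarrow> ('r::chilbert, complex) cblop mat"
  assumes vs: "vector_space s"
    and full: "full_nc_subset s \<Xi>"
    and ncQ: "nc_function s op_scale \<Xi> Q"
begin

abbreviation D :: "'v mat set" where "D \<equiv> nc_ball \<Xi> Q"

lemma Xi_square: "W \<in> \<Xi> \<Longrightarrow> W \<in> carrier_mat (dim_row W) (dim_row W)"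
  using full unfolding full_nc_subset_def nc_space_def by fastforce

lemma Q_carrier: "W \<in> \<Xi> \<Longrightarrow> Q W \<in> carrier_mat (dim_row W) (dim_row W)"
  using ncQ Xi_square unfolding nc_function_def graded_def by blast

lemma D_Xi: "W \<in> D \<Longrightarrow> W \<in> \<Xi>"
  by (simp add: nc_ball_def)

lemma D_square: "W \<in> D \<Longrightarrow> W \<in> carrier_mat (dim_row W) (dim_row W)"
  using D_Xi Xi_square by blast

lemma D_nc_space: "D \<subseteq> nc_space"
  using D_Xi full unfolding full_nc_subset_def by blast

text \<open>The relation \<open>A Q(Z) = Q(W) A\<close>, evaluated at the basis vector
  \<open>b\<close> and adjointed. In this form the nc property of \<open>Q\<close> passes to words
  and feature vectors.\<close>

lemma astar_Qst:
  assumes Z: "Z \<in> \<Xi>" and W: "W \<in> \<Xi>" and A: "A \<in> carrier_mat (dim_row W) (dim_row Z)"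
    and int: "lmult s A Z = rmult s W A" and j: "j < dim_row Z"
  shows "Qst Q Z b (astar A y) j = astar A (Qst Q W b y) j"
proof (cases "b \<in> onb")
  case True
  have eq: "lmult op_scale A (Q Z) = rmult op_scale (Q W) A"
    using ncQ Z W A int unfolding nc_function_def by blast
  have ent: "(\<Sum>l<dim_row Z. A $$ (i, l) * Qc Q Z b l j) = (\<Sum>k<dim_row W. A $$ (k, j) * Qc Q W b i k)"
    if i: "i < dim_row W" for i
  proof -
    have "cblop_apply (lmult op_scale A (Q Z) $$ (i, j)) b = cblop_apply (rmult op_scale (Q W) A $$ (i, j)) b"
      unfolding eq ..
    thus ?thesis using i j A Q_carrier[OF Z] Q_carrier[OF W]
      by (simp add: lmult_def rmult_def sum_cblop_apply op_scale.rep_eq scaleC_complex_def Qc_def)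
  qed
  have "Qst Q Z b (astar A y) j = (\<Sum>i<dim_row W. scaleC (cnj (\<Sum>l<dim_row Z. A $$ (i, l) * Qc Q Z b l j)) (y i))"
    using True j A by (simp add: Qst_def astar_def scaleC_sum_right scaleC_scaleC scaleC_sum_left
        cnj_sum sum.swap[of _ "{..<dim_row Z}"] mult.commute)
  also have "\<dots> = (\<Sum>i<dim_row W. scaleC (cnj (\<Sum>k<dim_row W. A $$ (k, j) * Qc Q W b i k)) (y i))"
    by (intro sum.cong refl) (simp add: ent)
  also have "\<dots> = (\<Sum>i<dim_row W. \<Sum>k<dim_row W. scaleC (cnj (A $$ (k, j)) * cnj (Qc Q W b i k)) (y i))"
    by (simp add: cnj_sum scaleC_sum_left)
  also have "\<dots> = (\<Sum>k<dim_row W. \<Sum>i<dim_row W. scaleC (cnj (A $$ (k, j)) * cnj (Qc Q W b i k)) (y i))"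
    by (rule sum.swap)
  also have "\<dots> = astar A (Qst Q W b y) j"
    using True A by (simp add: Qst_def astar_def scaleC_sum_right scaleC_scaleC)
  finally show ?thesis .
qed (simp add: Qst_def astar_def scaleC_zero_right)

lemma astar_Lact:
  assumes Z: "Z \<in> \<Xi>" and W: "W \<in> \<Xi>" and A: "A \<in> carrier_mat (dim_row W) (dim_row Z)"
    and int: "lmult s A Z = rmult s W A"
  shows "j < dim_row Z \<Longrightarrow> Lact Q Z w (astar A y) j = astar A (Lact Q W w y) j"
proof (induction w arbitrary: j)
  case (Cons b w)
  have "Lact Q Z (b # w) (astar A y) j = Qst Q Z b (astar A (Lact Q W w y)) j"
    using fun_cong[OF Qst_cong[of Z "Lact Q Z w (astar A y)" "astar A (Lact Q W w y)" Q b], of j] Cons.IH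
    by simp
  also have "\<dots> = astar A (Lact Q W (b # w) y) j" by (simp add: astar_Qst[OF assms Cons.prems])
  finally show ?case .
qed simp

text \<open>The column of all \<open>Qst Q W b\<close> is the adjoint of the row operator
  \<open>Q(W)\<close> and has the same norm. For scalars \<open>d\<close> this is
  \<open>S = norm(x)^2 = <Q(W) x, d> \<le> r norm(x) norm(d)\<close>, with \<open>x\<close> as
  defined in the proof; \<open>quadratic_bound_lift\<close> passes to vectors.\<close>

lemma Qst_bound:
  assumes W: "W \<in> D" and B: "finite B"
  shows "(\<Sum>b\<in>B. \<Sum>j<dim_row W. (norm (Qst Q W b y j))\<^sup>2)
    \<le> (opmat_norm (Q W))\<^sup>2 * (\<Sum>l<dim_row W. (norm (y l))\<^sup>2)"
proof -
  define m r where "m = dim_row W" and "r = opmat_norm (Q W)"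
  have dims: "dim_row (Q W) = m" "dim_col (Q W) = m" using Q_carrier[OF D_Xi[OF W]] unfolding m_def by auto
  \<comment> \<open>Letters outside the basis contribute 0.\<close>
  define B' where "B' = B \<inter> onb"
  have B': "finite B'" "B' \<subseteq> onb" using B unfolding B'_def by auto
  have on: "cinner b c = (if b = c then 1 else 0)" if "b \<in> B'" "c \<in> B'" for b c
    using is_onb_onb B'(2) that unfolding is_onb_def orthonormal_def by blast
  have scalar: "(\<Sum>a\<in>B' \<times> {..<m}. (cmod (\<Sum>l<m. (\<lambda>(b, j) l. cnj (Qc Q W b l j)) a l * d l))\<^sup>2)
      \<le> r\<^sup>2 * (\<Sum>l<m. (cmod (d l))\<^sup>2)" for d :: "nat \<Rightarrow> complex"
  proof -
    define \<gamma> where "\<gamma> j b = (\<Sum>l<m. cnj (Qc Q W b l j) * d l)" for j b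
    \<comment> \<open>The projection of the adjoint of \<open>Q(W)\<close> applied to
      \<open>d\<close> onto the span of the letters in \<open>B'\<close>.\<close>
    define x where "x = vec m (\<lambda>j. \<Sum>b\<in>B'. scaleC (\<gamma> j b) b)"
    define S where "S = (\<Sum>j<m. \<Sum>b\<in>B'. (cmod (\<gamma> j b))\<^sup>2)"
    have x: "x \<in> carrier_vec (dim_col (Q W))" by (simp add: x_def dims)
    have xj: "(norm (x $ j))\<^sup>2 = (\<Sum>b\<in>B'. (cmod (\<gamma> j b))\<^sup>2)" if "j < m" for j
    proof -
      have "complex_of_real ((norm (x $ j))\<^sup>2) = (\<Sum>b\<in>B'. \<Sum>c\<in>B'. \<gamma> j b * cnj (\<gamma> j c) * (if b = c then 1 else 0))"
        unfolding cinner_self[symmetric] using that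
        by (simp add: x_def cinner_lincomb on cong: sum.cong)
      also have "\<dots> = of_real (\<Sum>b\<in>B'. (cmod (\<gamma> j b))\<^sup>2)"
        using B'(1) by (simp add: mult_cnj_eq_cmod if_distrib cong: if_cong)
      finally show ?thesis unfolding of_real_eq_iff .
    qed
    have xS: "(vec_norm x)\<^sup>2 = S" unfolding vec_norm_sq S_def by (simp add: x_def[THEN arg_cong[of _ _ dim_vec]] xj)
    define D where "D = sqrt (\<Sum>l<m. (cmod (d l))\<^sup>2)"
    have dv: "vec_norm (vec m d) = D"
      unfolding vec_norm_eq_L2 L2_set_def D_def by (auto intro!: arg_cong[of _ _ sqrt] sum.cong)
    have "complex_of_real S = (\<Sum>j<m. \<Sum>b\<in>B'. \<gamma> j b * cnj (\<gamma> j b))"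
      unfolding S_def mult_cnj_eq_cmod by simp
    also have "\<dots> = (\<Sum>j<m. \<Sum>b\<in>B'. \<Sum>l<m. \<gamma> j b * Qc Q W b l j * cnj (d l))"
      by (subst (2) \<gamma>_def) (simp add: cnj_sum sum_distrib_left mult.assoc)
    also have "\<dots> = (\<Sum>j<m. \<Sum>l<m. \<Sum>b\<in>B'. \<gamma> j b * Qc Q W b l j * cnj (d l))"
      by (intro sum.cong refl sum.swap)
    also have "\<dots> = (\<Sum>l<m. \<Sum>j<m. \<Sum>b\<in>B'. \<gamma> j b * Qc Q W b l j * cnj (d l))"
      by (rule sum.swap)
    also have "\<dots> = (\<Sum>l<m. opmat_apply (Q W) x $ l * cnj (d l))"
      unfolding opmat_apply_def dims
      by (simp add: x_def cblop_sum cblop_scale scaleC_complex_def Qc_def sum_distrib_right)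
    finally have "complex_of_real S = (\<Sum>l<m. opmat_apply (Q W) x $ l * cnj (d l))" .
    hence "cmod (complex_of_real S) \<le> (\<Sum>l<m. cmod (opmat_apply (Q W) x $ l) * cmod (d l))"
      by (auto intro!: sum_norm_le simp: norm_mult)
    also have "\<dots> \<le> L2_set (\<lambda>l. cmod (opmat_apply (Q W) x $ l)) {..<m} * L2_set (\<lambda>l. cmod (d l)) {..<m}"
      using L2_set_mult_ineq[of "\<lambda>l. cmod (opmat_apply (Q W) x $ l)" "\<lambda>l. cmod (d l)" "{..<m}"] by simp
    also have "\<dots> = vec_norm (opmat_apply (Q W) x) * D"
      unfolding vec_norm_eq_L2 D_def L2_set_def[of "\<lambda>l. cmod (d l)"] by (simp add: dims)
    also have "\<dots> \<le> r * vec_norm x * D"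
      unfolding r_def by (intro mult_right_mono opmat_norm_bound x) (simp add: D_def sum_nonneg)
    finally have S_le: "S \<le> r * sqrt S * D"
      using xS[symmetric] vec_norm_nonneg[of x] by (simp add: norm_power)
    have "0 \<le> S" unfolding S_def by (intro sum_nonneg) auto
    have "S \<le> r\<^sup>2 * D\<^sup>2"
    proof (cases "S = 0")
      case False
      hence "sqrt S > 0" using \<open>0 \<le> S\<close> by simp
      moreover have "sqrt S * sqrt S \<le> (r * D) * sqrt S" using S_le \<open>0 \<le> S\<close> by (simp add: mult_ac)
      ultimately have "sqrt S \<le> r * D" by (metis mult_right_le_imp_le)
      from power_mono[OF this, of 2] show ?thesis using \<open>0 \<le> S\<close> by (simp add: power_mult_distrib)
    qed simp
    moreover have "S = (\<Sum>a\<in>B' \<times> {..<m}. (cmod (\<Sum>l<m. (\<lambda>(b, j) l. cnj (Qc Q W b l j)) a l * d l))\<^sup>2)"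
      unfolding S_def \<gamma>_def by (subst sum.swap) (simp add: sum.cartesian_product case_prod_beta)
    ultimately show ?thesis by (simp add: D_def sum_nonneg)
  qed
  have "(\<Sum>b\<in>B. \<Sum>j<m. (norm (Qst Q W b y j))\<^sup>2) = (\<Sum>b\<in>B'. \<Sum>j<m. (norm (Qst Q W b y j))\<^sup>2)"
    unfolding B'_def using B by (intro sum.mono_neutral_right) (auto simp: Qst_def)
  also have "\<dots> = (\<Sum>a\<in>B' \<times> {..<m}. (norm (\<Sum>l<m. scaleC ((\<lambda>(b, j) l. cnj (Qc Q W b l j)) a l) (y l)))\<^sup>2)"
    unfolding sum.cartesian_product using B'(2) by (intro sum.cong) (auto simp: Qst_def m_def)
  also have "\<dots> \<le> r\<^sup>2 * (\<Sum>l<m. (norm (y l))\<^sup>2)"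
    using B'(1) scalar by (intro quadratic_bound_lift) auto
  finally show ?thesis unfolding m_def r_def .
qed

lemma norm_Q_less: "W \<in> D \<Longrightarrow> (opmat_norm (Q W))\<^sup>2 < 1"
  using opmat_norm_nonneg[of "Q W"] by (simp add: nc_ball_def power2_less_1_iff)

text \<open>A geometric series: each further letter costs at most the factor \<open>r\<close>. The
  induction is on the maximal word length and removes the first letter.\<close>

lemma Lact_bound:
  assumes W: "W \<in> D" and H: "finite H"
  shows "(\<Sum>w\<in>H. \<Sum>p<dim_row W. (norm (Lact Q W w y p))\<^sup>2)
    \<le> (\<Sum>p<dim_row W. (norm (y p))\<^sup>2) / (1 - (opmat_norm (Q W))\<^sup>2)"
proof -
  define m r where "m = dim_row W" and "r = (opmat_norm (Q W))\<^sup>2"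
  define N where "N = (\<Sum>p<m. (norm (y p))\<^sup>2)"
  \<comment> \<open>The solution of \<open>N + r * K = K\<close>: the empty word gives
    \<open>N\<close>, and words with a first letter give at most \<open>r * K\<close>, so the same
    bound is reproduced at every length.\<close>
  define K where "K = N / (1 - r)"
  have r: "0 \<le> r" "r < 1" using norm_Q_less[OF W] by (auto simp: r_def)
  have N: "0 \<le> N" unfolding N_def by (intro sum_nonneg) auto
  have K: "N + r * K = K" using r unfolding K_def by (simp add: field_simps)
  have "0 \<le> K" using N r unfolding K_def by simp
  define S where "S w = (\<Sum>p<m. (norm (Lact Q W w y p))\<^sup>2)" for w
  have S0: "0 \<le> S w" for w unfolding S_def by (intro sum_nonneg) auto
  have "(\<Sum>w\<in>H. S w) \<le> K" if "finite H" "\<forall>w\<in>H. length w \<le> n" for n H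
    using that
  proof (induction n arbitrary: H)
    case 0
    hence "(\<Sum>w\<in>H. S w) \<le> (\<Sum>w\<in>{[]}. S w)" by (intro sum_mono2) (auto simp: S0)
    also have "\<dots> = N" by (simp add: S_def N_def)
    also have "N \<le> K" using K r \<open>0 \<le> K\<close> by (smt (verit) mult_nonneg_nonneg)
    finally show ?case .
  next
    case (Suc n)
    define B T where "B = hd ` (H - {[]})" and "T = tl ` (H - {[]})"
    have fin: "finite B" "finite T" using Suc.prems unfolding B_def T_def by auto
    have "(\<Sum>w\<in>T. S w) \<le> K"
      using Suc.prems fin by (intro Suc.IH) (auto simp: T_def)
    have "H \<subseteq> insert [] ((\<lambda>(b, w). b # w) ` (B \<times> T))"
    proof
      fix w assume "w \<in> H"
      show "w \<in> insert [] ((\<lambda>(b, w). b # w) ` (B \<times> T))"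
      proof (cases w)
        case (Cons b v)
        hence "b \<in> B" "v \<in> T" using \<open>w \<in> H\<close> unfolding B_def T_def by (force simp: image_iff)+
        thus ?thesis using Cons by auto
      qed simp
    qed
    \<comment> \<open>Enlarging to a full product of letters and tails lets the sum over letters be
      taken first, where \<open>Qst_bound\<close> applies.\<close>
    hence "(\<Sum>w\<in>H. S w) \<le> (\<Sum>w\<in>insert [] ((\<lambda>(b, w). b # w) ` (B \<times> T)). S w)"
      using fin by (intro sum_mono2) (auto simp: S0)
    also have "\<dots> = N + (\<Sum>w\<in>(\<lambda>(b, w). b # w) ` (B \<times> T). S w)"
      using fin by (subst sum.insert) (auto simp: S_def N_def)
    also have "(\<Sum>w\<in>(\<lambda>(b, w). b # w) ` (B \<times> T). S w) = (\<Sum>b\<in>B. \<Sum>w\<in>T. S (b # w))"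
      by (subst sum.reindex) (auto simp: inj_on_def sum.cartesian_product case_prod_beta)
    also have "\<dots> = (\<Sum>w\<in>T. \<Sum>b\<in>B. \<Sum>p<m. (norm (Qst Q W b (Lact Q W w y) p))\<^sup>2)"
      by (subst sum.swap) (simp add: S_def)
    also have "\<dots> \<le> (\<Sum>w\<in>T. r * S w)"
      unfolding S_def m_def r_def by (intro sum_mono Qst_bound W fin)
    also have "\<dots> \<le> r * K"
      unfolding sum_distrib_left[symmetric] using \<open>(\<Sum>w\<in>T. S w) \<le> K\<close> r by (intro mult_left_mono)
    finally show ?case using K by simp
  qed
  from this[of H "Max (length ` H)"] H show ?thesis
    unfolding S_def K_def N_def m_def r_def by auto
qed

lemma
  assumes "W \<in> D" "p < dim_row W"
  shows sq_sum_Lact: "sq_sum (\<lambda>w. Lact Q W w y p)"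
    and norm_Lact_le: "(\<Sum>\<^sub>\<infinity>w. (norm (Lact Q W w y p))\<^sup>2)
      \<le> (\<Sum>p<dim_row W. (norm (y p))\<^sup>2) / (1 - (opmat_norm (Q W))\<^sup>2)"
proof -
  have "(\<Sum>w\<in>H. (norm (Lact Q W w y p))\<^sup>2) \<le> (\<Sum>p<dim_row W. (norm (y p))\<^sup>2) / (1 - (opmat_norm (Q W))\<^sup>2)"
    if "finite H" for H
  proof -
    have "(\<Sum>w\<in>H. (norm (Lact Q W w y p))\<^sup>2) \<le> (\<Sum>w\<in>H. \<Sum>p<dim_row W. (norm (Lact Q W w y p))\<^sup>2)"
      using assms(2) by (intro sum_mono member_le_sum) auto
    thus ?thesis using Lact_bound[OF assms(1) that, of y] by linarith
  qed
  note this[THEN sq_sumI(1)] this[THEN sq_sumI(2)]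
  thus "sq_sum (\<lambda>w. Lact Q W w y p)" "(\<Sum>\<^sub>\<infinity>w. (norm (Lact Q W w y p))\<^sup>2)
      \<le> (\<Sum>p<dim_row W. (norm (y p))\<^sup>2) / (1 - (opmat_norm (Q W))\<^sup>2)" by blast+
qed

lemma sq_sum_ev: "W \<in> D \<Longrightarrow> sq_sum (ev Q W v y)"
  unfolding ev_def[abs_def] by (intro sq_sum_lincomb sq_sum_Lact) auto

lemma Qst_sq_sum:
  assumes "W \<in> D" "j < dim_row W"
  shows "sq_sum (\<lambda>b. Qst Q W b y j)"
proof (rule sq_sumI)
  fix B :: "'r set" assume "finite B"
  have "(\<Sum>b\<in>B. (norm (Qst Q W b y j))\<^sup>2) \<le> (\<Sum>b\<in>B. \<Sum>j<dim_row W. (norm (Qst Q W b y j))\<^sup>2)"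
    using assms(2) by (intro sum_mono member_le_sum) auto
  thus "(\<Sum>b\<in>B. (norm (Qst Q W b y j))\<^sup>2) \<le> (opmat_norm (Q W))\<^sup>2 * (\<Sum>l<dim_row W. (norm (y l))\<^sup>2)"
    using Qst_bound[OF assms(1) \<open>finite B\<close>, of y] by linarith
qed

section \<open>The kernel entries as sums over words\<close>

lemma L_power_carrier:
  "W \<in> \<Xi> \<Longrightarrow> L_power (opmat_adj (Q W)) k \<in> carrier_mat (dim_row W) (dim_row W)"
  using Q_carrier[of W] by (induction k) (auto intro!: carrier_matI)

text \<open>Translates tensor powers into words. Each factor prepends one letter to the empty unit
  word, so only words of length \<open>k\<close> occur, and the coordinate of the adjoint of
  \<open>Q(W)\<close> at \<open>b\<close> is the conjugate of \<open>Qc\<close>.\<close>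

lemma L_power_coeff:
  assumes W: "W \<in> \<Xi>" and j: "j < dim_row W"
  shows "q < dim_row W \<Longrightarrow> ell2_coeff (cblop_apply (L_power (opmat_adj (Q W)) k $$ (q, j)) 1) w
    = (if length w = k then Lact Q W w (unit_fun j) q else 0)"
proof (induction k arbitrary: q w)
  case 0
  thus ?case using Q_carrier[OF W] j
    by (auto simp: op_of_vec.rep_eq scaleC_one ell2_ket.rep_eq zero_cblop.rep_eq
        zero_ell2.rep_eq unit_fun_def)
next
  case (Suc k)
  let ?L = "L_power (opmat_adj (Q W)) k" and ?m = "dim_row W"
  have dims: "dim_row (Q W) = ?m" "dim_col (Q W) = ?m" "dim_col ?L = ?m" "dim_row ?L = ?m"
    using Q_carrier[OF W] L_power_carrier[OF W, of k] by auto
  have "cblop_apply (L_power (opmat_adj (Q W)) (Suc k) $$ (q, j)) 1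
      = (\<Sum>l<?m. tensor_left (cblop_apply (op_adj (Q W $$ (l, q))) 1) (cblop_apply (?L $$ (l, j)) 1))"
    using Suc.prems j
    by (simp add: dims sum_cblop_apply op_comp.rep_eq op_tensor_id.rep_eq)
  hence c: "ell2_coeff (cblop_apply (L_power (opmat_adj (Q W)) (Suc k) $$ (q, j)) 1) w
      = (\<Sum>l<?m. case w of [] \<Rightarrow> 0 | b # w' \<Rightarrow> if b \<in> onb then
          cinner (cblop_apply (op_adj (Q W $$ (l, q))) 1) b * ell2_coeff (cblop_apply (?L $$ (l, j)) 1) w' else 0)"
    by (simp add: sum_ell2_coeff tensor_left.rep_eq)
  show ?case
  proof (cases w)
    case Nil
    show ?thesis unfolding c using Nil by simp
  next
    case (Cons b v)
    show ?thesis unfolding c using Cons Suc.prems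
      by (auto simp: Suc.IH op_adj_left Qst_def Qc_def cinner_complex_def scaleC_complex_def)
  qed
qed

text \<open>The term of order \<open>k\<close> of the series collects exactly the words of length
  \<open>k\<close>; the family over all words is summable by the bound on the ball.\<close>

lemma ball_kernel_entry:
  assumes Z: "Z \<in> D" and W: "W \<in> D" and P: "P \<in> carrier_mat (dim_row Z) (dim_row W)"
    and i: "i < dim_row Z" and j: "j < dim_row W"
  shows "ball_kernel Q Z W P $$ (i, j) =
    (\<Sum>p<dim_row Z. \<Sum>q<dim_row W. P $$ (p, q) * Lvip Q Z W (unit_fun j) (unit_fun i) p q)"
proof -
  note ZX = D_Xi[OF Z] and WX = D_Xi[OF W]
  let ?LZ = "L_power (opmat_adj (Q Z))" and ?LW = "L_power (opmat_adj (Q W))"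
  let ?n = "dim_row Z" and ?m = "dim_row W"
  define g where "g p q w = cinner (Lact Q W w (unit_fun j) q) (Lact Q Z w (unit_fun i) p)" for p q w
  have gs: "g p q summable_on UNIV" if "p < ?n" "q < ?m" for p q
    unfolding g_def by (intro sq_sum_cinner sq_sum_Lact Z W that)
  have dims: "dim_row (?LZ k) = ?n" "dim_col (?LZ k) = ?n" "dim_row (?LW k) = ?m" "dim_col (?LW k) = ?m" for k
    using L_power_carrier[OF ZX] L_power_carrier[OF WX] by auto
  have ent: "cblop_apply (opmat_mult (opmat_mult (opmat_adj (?LZ k)) (ampl P)) (?LW k) $$ (i, j)) 1
      = (\<Sum>p<?n. \<Sum>q<?m. P $$ (p, q) * (\<Sum>\<^sub>\<infinity>w\<in>{w. length w = k}. g p q w))" for k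
  proof -
    have "cblop_apply (opmat_mult (opmat_mult (opmat_adj (?LZ k)) (ampl P)) (?LW k) $$ (i, j)) 1
        = (\<Sum>q<?m. \<Sum>p<?n. P $$ (p, q) * cblop_apply (op_adj (?LZ k $$ (p, i))) (cblop_apply (?LW k $$ (q, j)) 1))"
      using i j P by (simp add: dims sum_cblop_apply op_comp.rep_eq
          op_scale.rep_eq op_id.rep_eq cblop_scale scaleC_complex_def)
    also have "\<dots> = (\<Sum>p<?n. \<Sum>q<?m. P $$ (p, q) * (\<Sum>\<^sub>\<infinity>w\<in>{w. length w = k}. g p q w))"
    proof (subst sum.swap, intro sum.cong refl, goal_cases)
      case (1 p q)
      have "cblop_apply (op_adj (?LZ k $$ (p, i))) (cblop_apply (?LW k $$ (q, j)) 1)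
          = cinner (cblop_apply (op_adj (?LZ k $$ (p, i))) (cblop_apply (?LW k $$ (q, j)) 1)) 1"
        by (simp add: cinner_complex_def)
      also have "\<dots> = cinner (cblop_apply (?LW k $$ (q, j)) 1) (cblop_apply (?LZ k $$ (p, i)) 1)"
        by (rule op_adj_left)
      also have "\<dots> = (\<Sum>\<^sub>\<infinity>w. if length w = k then g p q w else 0)"
        unfolding cinner_ell2.rep_eq using 1 i j
        by (intro infsum_cong) (auto simp: L_power_coeff ZX WX g_def cinner_complex_def)
      also have "\<dots> = (\<Sum>\<^sub>\<infinity>w\<in>{w. length w = k}. g p q w)"
        by (rule infsum_cong_neutral) auto
      finally show ?case by simp
    qed
    finally show ?thesis .
  qed
  \<comment> \<open>Words correspond to pairs of a length and a word of that length, so summation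
    level by level is a case of Fubini.\<close>
  have lev: "(\<lambda>k. \<Sum>\<^sub>\<infinity>w\<in>{w. length w = k}. g p q w) sums (\<Sum>\<^sub>\<infinity>w. g p q w)" if pq: "p < ?n" "q < ?m" for p q
  proof (rule has_sum_imp_sums)
    let ?S = "Sigma UNIV (\<lambda>k. {w :: 'r list. length w = k})"
    have bij: "bij_betw snd ?S UNIV"
      by (rule bij_betw_byWitness[where f'="\<lambda>w. (length w, w)"]) auto
    have "(g p q has_sum (\<Sum>\<^sub>\<infinity>w. g p q w)) UNIV" by (rule has_sum_infsum[OF gs[OF pq]])
    hence hs: "((\<lambda>x. g p q (snd x)) has_sum (\<Sum>\<^sub>\<infinity>w. g p q w)) ?S"
      unfolding has_sum_reindex_bij_betw[OF bij] .
    show "((\<lambda>k. \<Sum>\<^sub>\<infinity>w\<in>{w. length w = k}. g p q w) has_sum (\<Sum>\<^sub>\<infinity>w. g p q w)) UNIV"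
      by (rule has_sum_Sigma'[OF hs])
        (simp, rule has_sum_infsum, rule summable_on_subset_banach[OF gs[OF pq]], simp)
  qed
  have "(\<lambda>k. \<Sum>p<?n. \<Sum>q<?m. P $$ (p, q) * (\<Sum>\<^sub>\<infinity>w\<in>{w. length w = k}. g p q w)) sums
      (\<Sum>p<?n. \<Sum>q<?m. P $$ (p, q) * (\<Sum>\<^sub>\<infinity>w. g p q w))"
    by (intro sums_sum sums_mult lev) auto
  from sums_unique[OF this, symmetric] show ?thesis
    using i j by (simp add: ball_kernel_def ent g_def Lvip_def vip_def)
qed

end

section \<open>Block matrices and direct sums\<close>

lemma sum_lessThan_add: "(\<Sum>j<n + m. f j) = (\<Sum>j<n. f j) + (\<Sum>j<m. f (n + j :: nat))"
  for f :: "nat \<Rightarrow> 'a::comm_monoid_add"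
  by (induction m) (auto simp: ac_simps)

lemma sum_swap_pairs:
  "(\<Sum>i\<in>A. \<Sum>j\<in>B. \<Sum>p\<in>C. \<Sum>q\<in>E. f i j p q) = (\<Sum>p\<in>C. \<Sum>q\<in>E. \<Sum>i\<in>A. \<Sum>j\<in>B. f i j p q)"
proof -
  have "(\<Sum>i\<in>A. \<Sum>j\<in>B. \<Sum>p\<in>C. \<Sum>q\<in>E. f i j p q) = (\<Sum>i\<in>A. \<Sum>p\<in>C. \<Sum>j\<in>B. \<Sum>q\<in>E. f i j p q)"
    by (intro sum.cong refl sum.swap)
  also have "\<dots> = (\<Sum>p\<in>C. \<Sum>i\<in>A. \<Sum>j\<in>B. \<Sum>q\<in>E. f i j p q)" by (rule sum.swap)
  also have "\<dots> = (\<Sum>p\<in>C. \<Sum>i\<in>A. \<Sum>q\<in>E. \<Sum>j\<in>B. f i j p q)" by (intro sum.cong refl sum.swap)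
  also have "\<dots> = (\<Sum>p\<in>C. \<Sum>q\<in>E. \<Sum>i\<in>A. \<Sum>j\<in>B. f i j p q)" by (intro sum.cong refl sum.swap)
  finally show ?thesis .
qed

lemma vector_space_one_zero:
  assumes "vector_space sc"
  shows "sc 0 x = 0" "sc 1 x = x"
proof -
  interpret vector_space sc by fact
  show "sc 0 x = 0" "sc 1 x = x" by simp_all
qed

lemma mat_adjoint_entry: "i < dim_col A \<Longrightarrow> j < dim_row A \<Longrightarrow> mat_adjoint A $$ (i, j) = cnj (A $$ (j, i))"
  for A :: "complex mat"
  by (simp add: mat_adjoint_def mat_of_rows_def)

lemma dim_mat_adjoint [simp]: "dim_row (mat_adjoint A) = dim_col A" "dim_col (mat_adjoint A) = dim_row A"
  by (simp_all add: mat_adjoint_def)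

lemma dim_lmult [simp]: "dim_row (lmult sc A Z) = dim_row A" "dim_col (lmult sc A Z) = dim_col Z"
  by (simp_all add: lmult_def)

lemma dim_rmult [simp]: "dim_row (rmult sc Z A) = dim_row Z" "dim_col (rmult sc Z A) = dim_col A"
  by (simp_all add: rmult_def)

text \<open>The sesquilinear form of \<open>M\<close>. The kernel axioms are checked on such forms,
  since the kernels are accessible through inner products of feature vectors.\<close>

definition pair :: "nat \<Rightarrow> nat \<Rightarrow> ('a::chilbert, 'b::chilbert) cblop mat \<Rightarrow> (nat \<Rightarrow> 'a) \<Rightarrow> (nat \<Rightarrow> 'b) \<Rightarrow> complex" where
  "pair n m M y x = (\<Sum>i<n. \<Sum>j<m. cinner (cblop_apply (M $$ (i, j)) (y j)) (x i))"

lemma pair_eqI: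
  assumes M: "M \<in> carrier_mat n m" and N: "N \<in> carrier_mat n m"
    and eq: "\<And>y x. pair n m M y x = pair n m N y x"
  shows "M = N"
proof (rule eq_matI)
  fix i j assume "i < dim_row N" "j < dim_col N"
  hence ij: "i < n" "j < m" using N by auto
  have single: "pair n m L (\<lambda>q. if q = j then a else 0) (\<lambda>p. if p = i then b else 0) = cinner (cblop_apply (L $$ (i, j)) a) b"
    for L a b
  proof -
    have col: "(\<Sum>q<m. cinner (cblop_apply (L $$ (p, q)) (if q = j then a else 0)) z) = cinner (cblop_apply (L $$ (p, j)) a) z" for p z
    proof -
      have "(\<Sum>q<m. cinner (cblop_apply (L $$ (p, q)) (if q = j then a else 0)) z)
          = (\<Sum>q<m. if q = j then cinner (cblop_apply (L $$ (p, j)) a) z else 0)"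
        by (intro sum.cong refl) (auto simp: cblop_zero cinner_zero_left)
      thus ?thesis using ij by simp
    qed
    have "pair n m L (\<lambda>q. if q = j then a else 0) (\<lambda>p. if p = i then b else 0)
        = (\<Sum>p<n. if p = i then cinner (cblop_apply (L $$ (i, j)) a) b else 0)"
      unfolding pair_def col by (intro sum.cong refl) auto
    thus ?thesis using ij by simp
  qed
  show "M $$ (i, j) = N $$ (i, j)"
    by (rule cblop_eqI, rule cinner_ext_left) (metis eq single)
qed (use M N in auto)

lemma pair_add:
  "M \<in> carrier_mat n m \<Longrightarrow> N \<in> carrier_mat n m \<Longrightarrow> pair n m (M + N) y x = pair n m M y x + pair n m N y x"
  by (simp add: pair_def plus_cblop.rep_eq cinner_add_left sum.distrib)

lemma pair_scale: "M \<in> carrier_mat n m \<Longrightarrow> pair n m (map_mat (op_scale c) M) y x = c * pair n m M y x"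
  by (simp add: pair_def op_scale.rep_eq cinner_scaleC_left sum_distrib_left)

lemma pair_conj:
  assumes M: "M \<in> carrier_mat n m" and A: "A \<in> carrier_mat n' n" and B: "B \<in> carrier_mat m' m"
  shows "pair n' m' (rmult op_scale (lmult op_scale A M) (mat_adjoint B)) y x = pair n m M (astar B y) (astar A x)"
proof -
  have "pair n' m' (rmult op_scale (lmult op_scale A M) (mat_adjoint B)) y x
      = (\<Sum>i<n'. \<Sum>j<m'. \<Sum>q<m. \<Sum>p<n. cnj (B $$ (j, q)) * (A $$ (i, p) * cinner (cblop_apply (M $$ (p, q)) (y j)) (x i)))"
    using M A B by (simp add: pair_def rmult_def lmult_def mat_adjoint_entry sum_cblop_apply op_scale.rep_eq
        cinner_sum_left cinner_scaleC_left scaleC_sum_right sum_distrib_left)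
  also have "\<dots> = (\<Sum>p<n. \<Sum>q<m. \<Sum>i<n'. \<Sum>j<m'. cnj (B $$ (j, q)) * (A $$ (i, p) * cinner (cblop_apply (M $$ (p, q)) (y j)) (x i)))"
    by (subst sum_swap_pairs) (rule sum.swap)
  also have "\<dots> = pair n m M (astar B y) (astar A x)"
    using A B by (simp add: pair_def astar_def cblop_sum cblop_scale cinner_sum_left cinner_sum_right
        cinner_scaleC_left cinner_scaleC_right sum_distrib_left mult_ac)
  finally show ?thesis .
qed

section \<open>Block indices and positive scalar matrices\<close>

lemma blk_offset_Suc: "blk_offset Zs (Suc i) = blk_offset Zs i + dim_row (Zs ! i)"
  by (simp add: blk_offset_def)

lemma blk_offset_mono: "i \<le> j \<Longrightarrow> blk_offset Zs i \<le> blk_offset Zs j"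
  unfolding blk_offset_def by (intro sum_mono2) auto

lemma blk_index: "p < dim_row (Zs ! i) \<Longrightarrow> blk_index Zs (blk_offset Zs i + p) = i"
  unfolding blk_index_def
proof (rule Least_equality)
  fix j assume "blk_offset Zs i + p < blk_offset Zs (Suc j)"
  thus "i \<le> j" using blk_offset_mono[of "Suc j" i Zs] by (metis add_lessD1 leD not_less_eq_eq)
qed (simp add: blk_offset_Suc)

lemma sum_blocks: "(\<Sum>r<blk_offset Zs l. g r) = (\<Sum>i<l. \<Sum>p<dim_row (Zs ! i). g (blk_offset Zs i + p))"
  for g :: "nat \<Rightarrow> 'a::comm_monoid_add"
proof (induction l)
  case 0
  show ?case by (simp add: blk_offset_def)
qed (simp add: blk_offset_Suc sum_lessThan_add)

lemma blk_offset_less: "i < l \<Longrightarrow> p < dim_row (Zs ! i) \<Longrightarrow> blk_offset Zs i + p < blk_offset Zs l"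
  using blk_offset_mono[of "Suc i" l Zs] by (simp add: blk_offset_Suc)

lemma kernel_block_form:
  assumes "x \<in> carrier_vec (blk_offset Zs (length Zs))"
  shows "vec_cinner (opmat_apply (kernel_block K Zs P) x) x =
    (\<Sum>i<length Zs. \<Sum>j<length Zs. pair (dim_row (Zs ! i)) (dim_row (Zs ! j)) (K (Zs ! i) (Zs ! j) (blk Zs P i j))
      (\<lambda>q. x $ (blk_offset Zs j + q)) (\<lambda>p. x $ (blk_offset Zs i + p)))"
proof -
  let ?o = "blk_offset Zs" and ?l = "length Zs" and ?N = "blk_offset Zs (length Zs)"
  have "vec_cinner (opmat_apply (kernel_block K Zs P) x) x
      = (\<Sum>r<?N. \<Sum>t<?N. cinner (cblop_apply (kernel_block K Zs P $$ (r, t)) (x $ t)) (x $ r))"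
    by (simp add: vec_cinner_def opmat_apply_def cinner_sum_left kernel_block_def)
  also have "\<dots> = (\<Sum>i<?l. \<Sum>p<dim_row (Zs ! i). \<Sum>j<?l. \<Sum>q<dim_row (Zs ! j).
      cinner (cblop_apply (kernel_block K Zs P $$ (?o i + p, ?o j + q)) (x $ (?o j + q))) (x $ (?o i + p)))"
    unfolding sum_blocks ..
  also have "\<dots> = (\<Sum>i<?l. \<Sum>p<dim_row (Zs ! i). \<Sum>j<?l. \<Sum>q<dim_row (Zs ! j).
      cinner (cblop_apply (K (Zs ! i) (Zs ! j) (blk Zs P i j) $$ (p, q)) (x $ (?o j + q))) (x $ (?o i + p)))"
    by (intro sum.cong refl) (simp add: kernel_block_def blk_offset_less blk_index)
  also have "\<dots> = (\<Sum>i<?l. \<Sum>j<?l. \<Sum>p<dim_row (Zs ! i). \<Sum>q<dim_row (Zs ! j).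
      cinner (cblop_apply (K (Zs ! i) (Zs ! j) (blk Zs P i j) $$ (p, q)) (x $ (?o j + q))) (x $ (?o i + p)))"
    by (intro sum.cong refl sum.swap)
  finally show ?thesis unfolding pair_def .
qed

lemma ampl_form:
  assumes "P \<in> carrier_mat N N" "x \<in> carrier_vec N"
  shows "vec_cinner (opmat_apply (ampl P :: (complex, complex) cblop mat) x) x
    = (\<Sum>r<N. \<Sum>t<N. P $$ (r, t) * x $ t * cnj (x $ r))"
  using assms by (simp add: vec_cinner_def opmat_apply_def op_scale.rep_eq op_id.rep_eq scaleC_complex_def
      cinner_complex_def sum_distrib_right)

text \<open>The reduction of complete positivity to rank-one matrices.\<close>

lemma ampl_positive_decomp:
  assumes P: "P \<in> carrier_mat N N" and pos: "opmat_positive (ampl P :: (complex, complex) cblop mat)"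
  shows "\<exists>\<gamma>. \<forall>r<N. \<forall>t<N. P $$ (r, t) = (\<Sum>k<N. \<gamma> k r * cnj (\<gamma> k t :: complex))"
proof -
  have "psd {..<N} (\<lambda>r t. P $$ (r, t))"
    unfolding psd_def
  proof (intro allI impI)
    fix F and c :: "nat \<Rightarrow> complex" assume F: "finite F" "F \<subseteq> {..<N}"
    \<comment> \<open>The conjugate appears because \<open>psd\<close> pairs \<open>c i\<close> with
      the row index, whereas the form of \<open>P\<close> conjugates the entry at the row.\<close>
    define x where "x = vec N (\<lambda>r. if r \<in> F then cnj (c r) else 0)"
    have "(\<Sum>i\<in>F. \<Sum>j\<in>F. c i * cnj (c j) * P $$ (i, j)) = (\<Sum>r<N. \<Sum>t<N. P $$ (r, t) * x $ t * cnj (x $ r))"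
    proof (rule sum.mono_neutral_cong_left)
      fix i assume "i \<in> F"
      thus "(\<Sum>j\<in>F. c i * cnj (c j) * P $$ (i, j)) = (\<Sum>t<N. P $$ (i, t) * x $ t * cnj (x $ i))"
        using F by (intro sum.mono_neutral_cong_left) (auto simp: x_def subset_iff mult_ac)
    qed (use F in \<open>auto simp: x_def\<close>)
    also have "\<dots> \<in> \<real>\<^sub>\<ge>\<^sub>0"
      using pos P unfolding opmat_positive_def by (subst ampl_form[symmetric]) (auto simp: x_def)
    finally show "(\<Sum>i\<in>F. \<Sum>j\<in>F. c i * cnj (c j) * P $$ (i, j)) \<in> \<real>\<^sub>\<ge>\<^sub>0" .
  qed
  from psd_decomposition[OF this] show ?thesis .
qed

lemma ampl_rank_one_positive:
  "opmat_positive (ampl (mat N N (\<lambda>(r, t). cnj (v r) * v t)) :: (complex, complex) cblop mat)"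
  unfolding opmat_positive_def
proof (intro conjI ballI)
  fix x :: "complex vec" assume "x \<in> carrier_vec (dim_col (ampl (mat N N (\<lambda>(r, t). cnj (v r) * v t)) :: (complex, complex) cblop mat))"
  hence x: "x \<in> carrier_vec N" by simp
  let ?z = "\<Sum>t<N. v t * x $ t"
  have "vec_cinner (opmat_apply (ampl (mat N N (\<lambda>(r, t). cnj (v r) * v t)) :: (complex, complex) cblop mat) x) x
      = (\<Sum>r<N. \<Sum>t<N. (v t * x $ t) * cnj (v r * x $ r))"
    by (subst ampl_form[OF _ x]) (auto intro!: sum.cong)
  also have "\<dots> = ?z * cnj ?z" by (subst sum.swap) (simp add: sum_product cnj_sum)
  finally show "vec_cinner (opmat_apply (ampl (mat N N (\<lambda>(r, t). cnj (v r) * v t)) :: (complex, complex) cblop mat) x) x \<in> \<real>\<^sub>\<ge>\<^sub>0"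
    unfolding mult_cnj_eq_cmod by simp
qed simp

section \<open>The ball is closed under direct sums\<close>

context nc_row_ball
begin

text \<open>The hypothesis on \<open>X\<close> says that the inclusion \<open>A\<close> of the
  coordinates from \<open>k0\<close> on intertwines \<open>Z\<close> with \<open>X\<close>. Hence it
  intertwines \<open>Q Z\<close> with \<open>Q X\<close>, which determines a block column of
  \<open>Q X\<close>.\<close>

lemma Q_block:
  assumes Z: "Z \<in> \<Xi>" and X: "X \<in> \<Xi>" and le: "k0 + dim_row Z \<le> dim_row X"
    and blk: "\<And>i j. i < dim_row X \<Longrightarrow> j < dim_row Z \<Longrightarrow>
      X $$ (i, k0 + j) = (if k0 \<le> i \<and> i < k0 + dim_row Z then Z $$ (i - k0, j) else 0)"
    and ij: "i < dim_row X" "j < dim_row Z"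
  shows "Q X $$ (i, k0 + j) = (if k0 \<le> i \<and> i < k0 + dim_row Z then Q Z $$ (i - k0, j) else 0)"
proof -
  define A :: "complex mat" where "A = mat (dim_row X) (dim_row Z) (\<lambda>(i, k). if i = k0 + k then 1 else 0)"
  have A: "A \<in> carrier_mat (dim_row X) (dim_row Z)" by (simp add: A_def)
  have L: "lmult sc A Y $$ (i, j) = (if k0 \<le> i \<and> i < k0 + dim_row Z then Y $$ (i - k0, j) else 0)"
    if sc: "vector_space sc" and Y: "Y \<in> carrier_mat (dim_row Z) (dim_row Z)" and "i < dim_row X" "j < dim_row Z" for sc Y i j
  proof -
    have "lmult sc A Y $$ (i, j) = (\<Sum>k<dim_row Z. sc (if i = k0 + k then 1 else 0) (Y $$ (k, j)))"
      using that by (simp add: lmult_def A_def)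
    also have "\<dots> = (\<Sum>k<dim_row Z. if k = i - k0 then if k0 \<le> i then Y $$ (i - k0, j) else 0 else 0)"
      by (intro sum.cong refl) (auto simp: vector_space_one_zero[OF sc])
    finally have "lmult sc A Y $$ (i, j) = (\<Sum>k<dim_row Z. if k = i - k0 then if k0 \<le> i then Y $$ (i - k0, j) else 0 else 0)" .
    thus ?thesis by auto
  qed
  have R: "rmult sc Y A $$ (i, j) = Y $$ (i, k0 + j)"
    if sc: "vector_space sc" and Y: "Y \<in> carrier_mat (dim_row X) (dim_row X)" and "i < dim_row X" "j < dim_row Z" for sc Y i j
  proof -
    have "rmult sc Y A $$ (i, j) = (\<Sum>k<dim_row X. sc (if k = k0 + j then 1 else 0) (Y $$ (i, k)))"
      using that by (simp add: rmult_def A_def)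
    also have "\<dots> = (\<Sum>k<dim_row X. if k = k0 + j then Y $$ (i, k0 + j) else 0)"
      by (intro sum.cong refl) (auto simp: vector_space_one_zero[OF sc])
    finally have "rmult sc Y A $$ (i, j) = (\<Sum>k<dim_row X. if k = k0 + j then Y $$ (i, k0 + j) else 0)" .
    thus ?thesis using that le by auto
  qed
  have "lmult s A Z = rmult s X A"
  proof (rule eq_matI)
    fix i j assume "i < dim_row (rmult s X A)" "j < dim_col (rmult s X A)"
    hence "i < dim_row X" "j < dim_row Z" using A by auto
    thus "lmult s A Z $$ (i, j) = rmult s X A $$ (i, j)"
      by (simp add: L[OF vs Xi_square[OF Z]] R[OF vs Xi_square[OF X]] blk)
  qed (simp_all add: carrier_matD[OF A] carrier_matD(2)[OF Xi_square[OF Z]])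
  hence "lmult op_scale A (Q Z) = rmult op_scale (Q X) A"
    using ncQ Z X A unfolding nc_function_def by blast
  thus ?thesis
    using L[OF vector_space_op_scale Q_carrier[OF Z] ij] R[OF vector_space_op_scale Q_carrier[OF X] ij] by simp
qed

text \<open>\<open>Q\<close> of a direct sum is the direct sum of the values of \<open>Q\<close>,
  and its norm is at most the larger of the two norms.\<close>

lemma closed_dsum_ball: "closed_dsum D"
  unfolding closed_dsum_def
proof (intro ballI)
  fix Z W assume Z: "Z \<in> D" and W: "W \<in> D"
  note ZX = D_Xi[OF Z] and WX = D_Xi[OF W]
  let ?n = "dim_row Z" and ?m = "dim_row W"
  define X where "X = four_block_mat Z (0\<^sub>m (dim_row Z) (dim_col W)) (0\<^sub>m (dim_row W) (dim_col Z)) W"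
  have X: "X \<in> \<Xi>" using full ZX WX unfolding full_nc_subset_def closed_dsum_def X_def by blast
  have sq: "dim_col Z = ?n" "dim_col W = ?m" using Xi_square ZX WX by auto
  have dX: "dim_row X = ?n + ?m" by (simp add: X_def)
  have dims: "dim_row (Q X) = ?n + ?m" "dim_col (Q X) = ?n + ?m" "dim_row (Q Z) = ?n" "dim_col (Q Z) = ?n"
    "dim_row (Q W) = ?m" "dim_col (Q W) = ?m" using Q_carrier[OF X] Q_carrier[OF ZX] Q_carrier[OF WX] dX by auto
  have left: "Q X $$ (i, j) = (if i < ?n then Q Z $$ (i, j) else 0)" if "i < ?n + ?m" "j < ?n" for i j
    using Q_block[OF ZX X, of 0 i j] that by (simp add: dX) (simp add: X_def sq)
  have right: "Q X $$ (i, ?n + j) = (if ?n \<le> i then Q W $$ (i - ?n, j) else 0)" if "i < ?n + ?m" "j < ?m" for i j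
    using Q_block[OF WX X, of ?n i j] that by (simp add: dX) (simp add: X_def sq)
  define c where "c = max (opmat_norm (Q Z)) (opmat_norm (Q W))"
  have c: "0 \<le> c" "c < 1" using Z W opmat_norm_nonneg[of "Q Z"] by (auto simp: c_def nc_ball_def le_max_iff_disj)
  have "opmat_norm (Q X) \<le> c"
  proof (rule opmat_norm_le[OF _ c(1)])
    fix x :: "'r vec" assume "x \<in> carrier_vec (dim_col (Q X))"
    hence x: "dim_vec x = ?n + ?m" by (simp add: dims)
    define x1 x2 where "x1 = vec ?n (\<lambda>j. x $ j)" and "x2 = vec ?m (\<lambda>j. x $ (?n + j))"
    have top: "opmat_apply (Q X) x $ i = opmat_apply (Q Z) x1 $ i" if "i < ?n" for i
      using that by (simp add: opmat_apply_def dims sum_lessThan_add left right x1_def zero_cblop.rep_eq)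
    have bot: "opmat_apply (Q X) x $ (?n + i) = opmat_apply (Q W) x2 $ i" if "i < ?m" for i
      using that by (simp add: opmat_apply_def dims sum_lessThan_add left right x2_def zero_cblop.rep_eq)
    have le: "(vec_norm (opmat_apply (Q V) z))\<^sup>2 \<le> c\<^sup>2 * (vec_norm z)\<^sup>2"
      if "opmat_norm (Q V) \<le> c" "z \<in> carrier_vec (dim_col (Q V))" for V z
    proof -
      have "vec_norm (opmat_apply (Q V) z) \<le> c * vec_norm z"
        using opmat_norm_bound[OF that(2)] mult_right_mono[OF that(1) vec_norm_nonneg[of z]] by linarith
      from power_mono[OF this vec_norm_nonneg, of 2] show ?thesis by (simp add: power_mult_distrib)
    qed
    have "(vec_norm (opmat_apply (Q X) x))\<^sup>2 = (vec_norm (opmat_apply (Q Z) x1))\<^sup>2 + (vec_norm (opmat_apply (Q W) x2))\<^sup>2"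
      unfolding vec_norm_sq by (simp add: dims sum_lessThan_add top bot)
    also have "\<dots> \<le> c\<^sup>2 * (vec_norm x1)\<^sup>2 + c\<^sup>2 * (vec_norm x2)\<^sup>2"
      by (intro add_mono le) (auto simp: c_def dims x1_def x2_def)
    also have "\<dots> = (c * vec_norm x)\<^sup>2"
      unfolding power_mult_distrib vec_norm_sq by (simp add: x sum_lessThan_add x1_def x2_def distrib_left)
    finally show "vec_norm (opmat_apply (Q X) x) \<le> c * vec_norm x"
      by (rule power2_le_imp_le) (intro mult_nonneg_nonneg c(1) vec_norm_nonneg)
  qed
  thus "four_block_mat Z (0\<^sub>m (dim_row Z) (dim_col W)) (0\<^sub>m (dim_row W) (dim_col Z)) W \<in> D"
    using X c unfolding X_def[symmetric] nc_ball_def by auto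
qed

end

section \<open>The kernel in terms of feature vectors\<close>

lemma vip_fixed_vectors: "vip (\<lambda>w. scaleC (a w) y) (\<lambda>w. scaleC (b w) x) = vip a b * cinner y x"
proof -
  have "cinner (scaleC (a w) y) (scaleC (b w) x) = cinner (a w) (b w) * cinner y x" for w
    by (simp add: cinner_scaleC_left cinner_scaleC_right cinner_complex_def)
  thus ?thesis unfolding vip_def by (simp add: infsum_cmult_left')
qed

lemma vip_sum_sum:
  assumes "finite F" "finite G" "\<And>i. i \<in> F \<Longrightarrow> sq_sum (f i)" "\<And>j. j \<in> G \<Longrightarrow> sq_sum (g j)"
  shows "vip (\<lambda>w. \<Sum>i\<in>F. scaleC (c i) (f i w)) (\<lambda>w. \<Sum>j\<in>G. scaleC (d j) (g j w))
    = (\<Sum>i\<in>F. \<Sum>j\<in>G. c i * cnj (d j) * vip (f i) (g j))"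
  using assms by (simp add: vip_lincomb_left vip_lincomb_right sq_sum_lincomb sum_distrib_left mult_ac)

context nc_row_ball
begin

definition kform :: "'v mat \<Rightarrow> 'v mat \<Rightarrow> complex mat \<Rightarrow> (nat \<Rightarrow> 'x::chilbert) \<Rightarrow> (nat \<Rightarrow> 'x) \<Rightarrow> complex" where
  "kform Z W P y x = (\<Sum>p<dim_row Z. \<Sum>q<dim_row W. P $$ (p, q) * Lvip Q Z W y x p q)"

definition phi :: "'v mat \<Rightarrow> (nat \<Rightarrow> complex) \<Rightarrow> (nat \<Rightarrow> 'x::chilbert) \<Rightarrow> ('r list \<Rightarrow> 'x) ell2" where
  "phi W v y = vell2 (ev Q W v y)"

text \<open>A word acts by a complex matrix, so it commutes with \<open>op_of_vec\<close>, and its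
  entries can be read off from scalar unit vectors.\<close>

lemma Lact_expand:
  assumes "q < dim_row W"
  shows "Lact Q W w y q = (\<Sum>j<dim_row W. scaleC (Lact Q W w (unit_fun j) q) (y j))"
proof -
  have "Lact Q W w y q = Lact Q W w (\<lambda>l. \<Sum>j<dim_row W. scaleC 1 (cblop_apply (op_of_vec (y j)) (unit_fun j l))) q"
    using assms by (intro Lact_cong) (simp_all add: op_of_vec.rep_eq scaleC_one unit_fun_expand)
  thus ?thesis unfolding Lact_lincomb Lact_op by (simp add: op_of_vec.rep_eq scaleC_one)
qed

lemma Lvip_expand:
  assumes "Z \<in> D" "W \<in> D" "p < dim_row Z" "q < dim_row W"
  shows "Lvip Q Z W y x p q
    = (\<Sum>i<dim_row Z. \<Sum>j<dim_row W. Lvip Q Z W (unit_fun j) (unit_fun i) p q * cinner (y j) (x i))"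
proof -
  have sq: "sq_sum (\<lambda>w. scaleC (Lact Q V w (unit_fun j) r) z)" if "V \<in> D" "r < dim_row V" for V j r z
    using sq_sum_Lact[OF that, of "\<lambda>l. scaleC (unit_fun j l) z"]
    Lact_op[of Q V _ "op_of_vec z" "unit_fun j"] by (simp add: op_of_vec.rep_eq)
  have "Lvip Q Z W y x p q
      = vip (\<lambda>w. \<Sum>j<dim_row W. scaleC 1 (scaleC (Lact Q W w (unit_fun j) q) (y j)))
          (\<lambda>w. \<Sum>i<dim_row Z. scaleC 1 (scaleC (Lact Q Z w (unit_fun i) p) (x i)))"
    unfolding Lvip_def scaleC_one using assms by (simp add: Lact_expand[symmetric])
  also have "\<dots> = (\<Sum>j<dim_row W. \<Sum>i<dim_row Z. Lvip Q Z W (unit_fun j) (unit_fun i) p q * cinner (y j) (x i))"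
    using assms by (subst vip_sum_sum) (auto simp: sq vip_fixed_vectors Lvip_def)
  finally show ?thesis by (subst sum.swap)
qed

lemma ball_kernel_form:
  assumes Z: "Z \<in> D" and W: "W \<in> D" and P: "P \<in> carrier_mat (dim_row Z) (dim_row W)"
  shows "(\<Sum>i<dim_row Z. \<Sum>j<dim_row W. ball_kernel Q Z W P $$ (i, j) * cinner (y j) (x i)) = kform Z W P y x"
proof -
  let ?n = "dim_row Z" and ?m = "dim_row W"
  let ?t = "\<lambda>i j p q. P $$ (p, q) * Lvip Q Z W (unit_fun j) (unit_fun i) p q * cinner (y j) (x i)"
  have "(\<Sum>i<?n. \<Sum>j<?m. ball_kernel Q Z W P $$ (i, j) * cinner (y j) (x i)) = (\<Sum>i<?n. \<Sum>j<?m. \<Sum>p<?n. \<Sum>q<?m. ?t i j p q)"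
    by (intro sum.cong refl) (simp add: ball_kernel_entry[OF assms] sum_distrib_right)
  also have "\<dots> = (\<Sum>p<?n. \<Sum>q<?m. \<Sum>i<?n. \<Sum>j<?m. ?t i j p q)" by (rule sum_swap_pairs)
  also have "\<dots> = kform Z W P y x"
    unfolding kform_def by (intro sum.cong refl) (simp add: Lvip_expand[OF Z W, of _ _ y x] sum_distrib_left mult.assoc)
  finally show ?thesis .
qed

lemma Lvip_cong:
  assumes "\<And>l. l < dim_row W \<Longrightarrow> y l = y' l" "\<And>l. l < dim_row Z \<Longrightarrow> x l = x' l" "p < dim_row Z" "q < dim_row W"
  shows "Lvip Q Z W y x p q = Lvip Q Z W y' x' p q"
proof -
  have "Lact Q W w y q = Lact Q W w y' q" "Lact Q Z w x p = Lact Q Z w x' p" for w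
    using assms by (auto intro: Lact_cong)
  thus ?thesis unfolding Lvip_def by simp
qed

lemma kform_cong:
  assumes "\<And>l. l < dim_row W \<Longrightarrow> y l = y' l" "\<And>l. l < dim_row Z \<Longrightarrow> x l = x' l"
  shows "kform Z W P y x = kform Z W P y' x'"
  unfolding kform_def using Lvip_cong[OF assms] by (intro sum.cong refl) auto

lemma kform_add:
  "P \<in> carrier_mat (dim_row Z) (dim_row W) \<Longrightarrow> P' \<in> carrier_mat (dim_row Z) (dim_row W) \<Longrightarrow>
    kform Z W (P + P') y x = kform Z W P y x + kform Z W P' y x"
  by (simp add: kform_def distrib_right sum.distrib)

lemma kform_scale:
  "P \<in> carrier_mat (dim_row Z) (dim_row W) \<Longrightarrow> kform Z W (c \<cdot>\<^sub>m P) y x = c * kform Z W P y x"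
  by (simp add: kform_def sum_distrib_left mult.assoc)

text \<open>This makes \<open>phi\<close> a feature map: at a rank-one matrix the sums over rows and
  columns combine into one inner product.\<close>

lemma kform_rank_one:
  assumes "Z \<in> D" "W \<in> D"
  shows "(\<Sum>p<dim_row Z. \<Sum>q<dim_row W. cnj (u p) * v q * Lvip Q Z W y x p q) = cinner (phi W v y) (phi Z u x)"
proof -
  have "cinner (phi W v y) (phi Z u x) = vip (ev Q W v y) (ev Q Z u x)"
    unfolding phi_def by (intro cinner_vell2 sq_sum_ev assms)
  also have "\<dots> = (\<Sum>q<dim_row W. \<Sum>p<dim_row Z. v q * cnj (u p) * Lvip Q Z W y x p q)"
    unfolding ev_def[abs_def] Lvip_def by (rule vip_sum_sum) (auto intro: sq_sum_Lact assms)
  finally show ?thesis by (subst sum.swap) (simp add: mult_ac)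
qed

lemma kform_intertwine:
  assumes Z: "Z \<in> D" "Z' \<in> D" and W: "W \<in> D" "W' \<in> D"
    and A: "A \<in> carrier_mat (dim_row Z') (dim_row Z)" "lmult s A Z = rmult s Z' A"
    and B: "B \<in> carrier_mat (dim_row W') (dim_row W)" "lmult s B W = rmult s W' B"
    and P: "P \<in> carrier_mat (dim_row Z) (dim_row W)"
  shows "kform Z W P (astar B y) (astar A x) = kform Z' W' (A * P * mat_adjoint B) y x"
proof -
  let ?n = "dim_row Z" and ?m = "dim_row W" and ?n' = "dim_row Z'" and ?m' = "dim_row W'"
  let ?L = "\<lambda>a b. Lvip Q Z' W' y x a b"
  have L: "Lvip Q Z W (astar B y) (astar A x) p q = (\<Sum>b<?m'. \<Sum>a<?n'. cnj (B $$ (b, q)) * A $$ (a, p) * ?L a b)"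
    if pq: "p < ?n" "q < ?m" for p q
  proof -
    have "Lvip Q Z W (astar B y) (astar A x) p q
        = vip (\<lambda>w. \<Sum>b<?m'. scaleC (cnj (B $$ (b, q))) (Lact Q W' w y b)) (\<lambda>w. \<Sum>a<?n'. scaleC (cnj (A $$ (a, p))) (Lact Q Z' w x a))"
      unfolding Lvip_def using A B pq
      by (simp add: astar_Lact[OF D_Xi[OF Z(1)] D_Xi[OF Z(2)] A] astar_Lact[OF D_Xi[OF W(1)] D_Xi[OF W(2)] B])
        (simp add: astar_def)
    also have "\<dots> = (\<Sum>b<?m'. \<Sum>a<?n'. cnj (B $$ (b, q)) * cnj (cnj (A $$ (a, p))) * ?L a b)"
      unfolding Lvip_def by (rule vip_sum_sum) (auto intro: sq_sum_Lact Z W)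
    finally show ?thesis by simp
  qed
  let ?t = "\<lambda>p q a b. A $$ (a, p) * P $$ (p, q) * cnj (B $$ (b, q)) * ?L a b"
  have "kform Z W P (astar B y) (astar A x) = (\<Sum>p<?n. \<Sum>q<?m. \<Sum>b<?m'. \<Sum>a<?n'. ?t p q a b)"
    unfolding kform_def by (intro sum.cong refl) (simp add: L sum_distrib_left mult_ac)
  also have "\<dots> = (\<Sum>b<?m'. \<Sum>a<?n'. \<Sum>p<?n. \<Sum>q<?m. ?t p q a b)" by (rule sum_swap_pairs)
  also have "\<dots> = (\<Sum>a<?n'. \<Sum>b<?m'. \<Sum>p<?n. \<Sum>q<?m. ?t p q a b)" by (rule sum.swap)
  also have "\<dots> = (\<Sum>a<?n'. \<Sum>b<?m'. \<Sum>q<?m. \<Sum>p<?n. ?t p q a b)" by (intro sum.cong refl sum.swap)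
  also have "\<dots> = kform Z' W' (A * P * mat_adjoint B) y x"
    unfolding kform_def using A B P
    by (intro sum.cong refl) (simp add: times_mat_def scalar_prod_def mat_adjoint_entry sum_distrib_right
        sum_distrib_left atLeast0LessThan[symmetric])
  finally show ?thesis .
qed

text \<open>\<open>\<sigma>\<close> stands for \<open>y \<mapsto> S(W)\<^sup>* y\<close>. The value \<open>\<sigma> = 0\<close> gives the kernel \<open>k \<otimes> I\<close>.\<close>

definition represents :: "'v mat set \<Rightarrow> ('v, 'h::chilbert) nc_ker \<Rightarrow> ('v mat \<Rightarrow> (nat \<Rightarrow> 'h) \<Rightarrow> nat \<Rightarrow> 'u::chilbert) \<Rightarrow> bool" where
  "represents \<Omega> K \<sigma> \<longleftrightarrow> (\<forall>Z\<in>\<Omega>. \<forall>W\<in>\<Omega>. \<forall>P\<in>carrier_mat (dim_row Z) (dim_row W).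
    K Z W P \<in> carrier_mat (dim_row Z) (dim_row W) \<and>
    (\<forall>y x. pair (dim_row Z) (dim_row W) (K Z W P) y x = kform Z W P y x - kform Z W P (\<sigma> W y) (\<sigma> Z x)))"

text \<open>The relation \<open>A S(Z) = S(W) A\<close> of an nc function in adjoint form, as a
  condition on \<open>\<sigma>\<close>.\<close>

definition intertwines :: "'v mat set \<Rightarrow> ('v mat \<Rightarrow> (nat \<Rightarrow> 'h::chilbert) \<Rightarrow> nat \<Rightarrow> 'u::chilbert) \<Rightarrow> bool" where
  "intertwines \<Omega> \<sigma> \<longleftrightarrow> (\<forall>Z\<in>\<Omega>. \<forall>W\<in>\<Omega>. \<forall>A\<in>carrier_mat (dim_row W) (dim_row Z).
    lmult s A Z = rmult s W A \<longrightarrow> (\<forall>y. \<forall>j<dim_row Z. \<sigma> Z (astar A y) j = astar A (\<sigma> W y) j))"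

text \<open>Points are listed with repetitions, matching \<open>cp_nc_kernel\<close>; scalar
  coefficients are absorbed into the rows \<open>v i\<close>.\<close>

definition contr :: "'v mat set \<Rightarrow> ('v mat \<Rightarrow> (nat \<Rightarrow> 'h::chilbert) \<Rightarrow> nat \<Rightarrow> 'u::chilbert) \<Rightarrow> bool" where
  "contr \<Omega> \<sigma> \<longleftrightarrow> (\<forall>Zs v y. set Zs \<subseteq> \<Omega> \<longrightarrow>
    norm (\<Sum>i<length Zs. phi (Zs ! i) (v i) (\<sigma> (Zs ! i) (y i))) \<le> norm (\<Sum>i<length Zs. phi (Zs ! i) (v i) (y i)))"

section \<open>Complete positivity as contractivity on feature vectors\<close>

lemma nc_kernelI:
  assumes \<Omega>: "\<Omega> \<subseteq> D" and rep: "represents \<Omega> K \<sigma>" and int: "intertwines \<Omega> \<sigma>"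
  shows "nc_kernel s \<Omega> K"
proof -
  have car: "K Z W P \<in> carrier_mat (dim_row Z) (dim_row W)"
    and pr: "pair (dim_row Z) (dim_row W) (K Z W P) y x = kform Z W P y x - kform Z W P (\<sigma> W y) (\<sigma> Z x)"
    if "Z \<in> \<Omega>" "W \<in> \<Omega>" "P \<in> carrier_mat (dim_row Z) (dim_row W)" for Z W P y x
    using rep that unfolding represents_def by blast+
  show ?thesis unfolding nc_kernel_def
  proof (intro conjI ballI allI impI)
    fix Z W and P :: "complex mat" assume ZW: "Z \<in> \<Omega>" "W \<in> \<Omega>" and P: "P \<in> carrier_mat (dim_row Z) (dim_row W)"
    let ?n = "dim_row Z" and ?m = "dim_row W"
    show "K Z W P \<in> carrier_mat ?n ?m" by (rule car[OF ZW P])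
    show "K Z W (P + P') = K Z W P + K Z W P'" if P': "P' \<in> carrier_mat ?n ?m" for P'
    proof (rule pair_eqI)
      show "pair ?n ?m (K Z W (P + P')) y x = pair ?n ?m (K Z W P + K Z W P') y x" for y x
        using P P' car[OF ZW] by (simp add: pr[OF ZW] kform_add pair_add)
    qed (use car[OF ZW] P P' in auto)
    show "K Z W (c \<cdot>\<^sub>m P) = map_mat (op_scale c) (K Z W P)" for c
    proof (rule pair_eqI)
      show "pair ?n ?m (K Z W (c \<cdot>\<^sub>m P)) y x = pair ?n ?m (map_mat (op_scale c) (K Z W P)) y x" for y x
        using P car[OF ZW] by (simp add: pr[OF ZW] kform_scale pair_scale right_diff_distrib)
    qed (use car[OF ZW] P in auto)
  next
    fix Z Z' W W' and A B P :: "complex mat"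
    assume Z: "Z \<in> \<Omega>" "Z' \<in> \<Omega>" and W: "W \<in> \<Omega>" "W' \<in> \<Omega>"
      and A: "A \<in> carrier_mat (dim_row Z') (dim_row Z)" and B: "B \<in> carrier_mat (dim_row W') (dim_row W)"
      and P: "P \<in> carrier_mat (dim_row Z) (dim_row W)"
      and AB: "lmult s A Z = rmult s Z' A \<and> lmult s B W = rmult s W' B"
    have APB: "A * P * mat_adjoint B \<in> carrier_mat (dim_row Z') (dim_row W')"
      using A B P by (intro carrier_matI) auto
    have iZ: "\<sigma> Z (astar A x) j = astar A (\<sigma> Z' x) j" if "j < dim_row Z" for x j
      using int Z A AB that unfolding intertwines_def by blast
    have iW: "\<sigma> W (astar B y) j = astar B (\<sigma> W' y) j" if "j < dim_row W" for y j
      using int W B AB that unfolding intertwines_def by blast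
    have D: "Z \<in> D" "Z' \<in> D" "W \<in> D" "W' \<in> D" using \<Omega> Z W by auto
    show "rmult op_scale (lmult op_scale A (K Z W P)) (mat_adjoint B) = K Z' W' (A * P * mat_adjoint B)"
    proof (rule pair_eqI)
      fix y x
      have "kform Z W P (\<sigma> W (astar B y)) (\<sigma> Z (astar A x)) = kform Z W P (astar B (\<sigma> W' y)) (astar A (\<sigma> Z' x))"
        by (intro kform_cong iZ iW)
      thus "pair (dim_row Z') (dim_row W') (rmult op_scale (lmult op_scale A (K Z W P)) (mat_adjoint B)) y x
          = pair (dim_row Z') (dim_row W') (K Z' W' (A * P * mat_adjoint B)) y x"
        using AB A B P
        by (simp add: pair_conj[OF car[OF Z(1) W(1) P] A B] pr[OF Z(1) W(1) P] pr[OF Z(2) W(2) APB]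
            kform_intertwine[OF D A _ B _ P])
    qed (use A B car[OF Z(2) W(2) APB] in auto)
  qed
qed

lemma sum_phi_norm:
  "(\<Sum>i<l. \<Sum>j<l. cinner (phi (Zs j) (v j) (y j)) (phi (Zs i) (v i) (y i)))
    = of_real ((norm (\<Sum>i<l. phi (Zs i) (v i) (y i)))\<^sup>2)"
  unfolding cinner_self[symmetric] cinner_sum_left unfolding cinner_sum_right by (rule sum.swap)

text \<open>Each rank-one part of \<open>P\<close>, cut into the blocks \<open>v k i\<close>,
  contributes the defect of one sum of feature vectors. Contractivity therefore makes every summand
  nonnegative.\<close>

lemma block_form:
  assumes \<Omega>: "\<Omega> \<subseteq> D" and rep: "represents \<Omega> K \<sigma>" and Zs: "set Zs \<subseteq> \<Omega>"
    and P: "\<And>r t. r < blk_offset Zs (length Zs) \<Longrightarrow> t < blk_offset Zs (length Zs) \<Longrightarrow>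
      P $$ (r, t) = (\<Sum>k<N. \<gamma> k r * cnj (\<gamma> k t))"
    and x: "x \<in> carrier_vec (blk_offset Zs (length Zs))"
  defines "v \<equiv> \<lambda>k i p. cnj (\<gamma> k (blk_offset Zs i + p))" and "y \<equiv> \<lambda>i p. x $ (blk_offset Zs i + p)"
  shows "vec_cinner (opmat_apply (kernel_block K Zs P) x) x =
    of_real (\<Sum>k<N. (norm (\<Sum>i<length Zs. phi (Zs ! i) (v k i) (y i)))\<^sup>2
      - (norm (\<Sum>i<length Zs. phi (Zs ! i) (v k i) (\<sigma> (Zs ! i) (y i))))\<^sup>2)"
proof -
  let ?l = "length Zs"
  have Zi: "Zs ! i \<in> \<Omega>" "Zs ! i \<in> D" if "i < ?l" for i using Zs \<Omega> that nth_mem by blast+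
  have kf: "kform (Zs ! i) (Zs ! j) (blk Zs P i j) y' x'
      = (\<Sum>k<N. cinner (phi (Zs ! j) (v k j) y') (phi (Zs ! i) (v k i) x'))"
    if ij: "i < ?l" "j < ?l" for i j and y' x' :: "nat \<Rightarrow> 'x::chilbert"
  proof -
    have "kform (Zs ! i) (Zs ! j) (blk Zs P i j) y' x' =
      (\<Sum>p<dim_row (Zs ! i). \<Sum>q<dim_row (Zs ! j). \<Sum>k<N. cnj (v k i p) * v k j q * Lvip Q (Zs ! i) (Zs ! j) y' x' p q)"
      unfolding kform_def by (intro sum.cong refl) (simp add: blk_def P blk_offset_less ij v_def sum_distrib_right)
    also have "\<dots> = (\<Sum>p<dim_row (Zs ! i). \<Sum>k<N. \<Sum>q<dim_row (Zs ! j). cnj (v k i p) * v k j q * Lvip Q (Zs ! i) (Zs ! j) y' x' p q)"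
      by (intro sum.cong refl sum.swap)
    also have "\<dots> = (\<Sum>k<N. \<Sum>p<dim_row (Zs ! i). \<Sum>q<dim_row (Zs ! j). cnj (v k i p) * v k j q * Lvip Q (Zs ! i) (Zs ! j) y' x' p q)"
      by (rule sum.swap)
    finally show ?thesis by (simp add: kform_rank_one Zi ij)
  qed
  have tot: "(\<Sum>i<?l. \<Sum>j<?l. kform (Zs ! i) (Zs ! j) (blk Zs P i j) (z j) (z i))
      = of_real (\<Sum>k<N. (norm (\<Sum>i<?l. phi (Zs ! i) (v k i) (z i)))\<^sup>2)" for z :: "nat \<Rightarrow> nat \<Rightarrow> 'x::chilbert"
  proof -
    have "(\<Sum>i<?l. \<Sum>j<?l. kform (Zs ! i) (Zs ! j) (blk Zs P i j) (z j) (z i))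
        = (\<Sum>i<?l. \<Sum>j<?l. \<Sum>k<N. cinner (phi (Zs ! j) (v k j) (z j)) (phi (Zs ! i) (v k i) (z i)))"
      by (intro sum.cong refl) (simp add: kf)
    also have "\<dots> = (\<Sum>i<?l. \<Sum>k<N. \<Sum>j<?l. cinner (phi (Zs ! j) (v k j) (z j)) (phi (Zs ! i) (v k i) (z i)))"
      by (intro sum.cong refl sum.swap)
    also have "\<dots> = (\<Sum>k<N. \<Sum>i<?l. \<Sum>j<?l. cinner (phi (Zs ! j) (v k j) (z j)) (phi (Zs ! i) (v k i) (z i)))"
      by (rule sum.swap)
    finally show ?thesis unfolding sum_phi_norm by simp
  qed
  have "vec_cinner (opmat_apply (kernel_block K Zs P) x) x = (\<Sum>i<?l. \<Sum>j<?l.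
      kform (Zs ! i) (Zs ! j) (blk Zs P i j) (y j) (y i)
      - kform (Zs ! i) (Zs ! j) (blk Zs P i j) (\<sigma> (Zs ! j) (y j)) (\<sigma> (Zs ! i) (y i)))"
    unfolding kernel_block_form[OF x] y_def using rep Zi unfolding represents_def
    by (intro sum.cong refl) (simp add: blk_def)
  also have "\<dots> = of_real (\<Sum>k<N. (norm (\<Sum>i<?l. phi (Zs ! i) (v k i) (y i)))\<^sup>2)
      - of_real (\<Sum>k<N. (norm (\<Sum>i<?l. phi (Zs ! i) (v k i) (\<sigma> (Zs ! i) (y i))))\<^sup>2)"
    unfolding sum_subtractf tot ..
  finally show ?thesis by (simp add: sum_subtractf)
qed

lemma cp_nc_kernelI:
  fixes K :: "('v, 'h::chilbert) nc_ker"
  assumes \<Omega>: "\<Omega> \<subseteq> D" and rep: "represents \<Omega> K \<sigma>" and int: "intertwines \<Omega> \<sigma>" and contr: "contr \<Omega> \<sigma>"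
  shows "cp_nc_kernel s \<Omega> K"
  unfolding cp_nc_kernel_def
proof (intro conjI allI impI ballI nc_kernelI[OF \<Omega> rep int])
  fix Zs :: "'v mat list" and P :: "complex mat"
  let ?N = "blk_offset Zs (length Zs)"
  assume Zs: "set Zs \<subseteq> \<Omega>" and P: "P \<in> carrier_mat ?N ?N"
    and pos: "opmat_positive (ampl P :: (complex, complex) cblop mat)"
  obtain \<gamma> where \<gamma>: "\<And>r t. r < ?N \<Longrightarrow> t < ?N \<Longrightarrow> P $$ (r, t) = (\<Sum>k<?N. \<gamma> k r * cnj (\<gamma> k t))"
    using ampl_positive_decomp[OF P pos] by blast
  show "opmat_positive (kernel_block K Zs P)"
    unfolding opmat_positive_def
  proof (intro conjI ballI)
    fix x :: "'h vec" assume "x \<in> carrier_vec (dim_col (kernel_block K Zs P))"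
    hence x: "x \<in> carrier_vec ?N" by (simp add: kernel_block_def)
    show "vec_cinner (opmat_apply (kernel_block K Zs P) x) x \<in> \<real>\<^sub>\<ge>\<^sub>0"
    proof (subst block_form[where \<gamma>=\<gamma> and N="?N", OF \<Omega> rep Zs _ x])
      show "P $$ (r, t) = (\<Sum>k<?N. \<gamma> k r * cnj (\<gamma> k t))" if "r < ?N" "t < ?N" for r t
        using that by (rule \<gamma>)
      show "complex_of_real (\<Sum>k<?N.
          (norm (\<Sum>i<length Zs. phi (Zs ! i) (\<lambda>p. cnj (\<gamma> k (blk_offset Zs i + p))) (\<lambda>p. x $ (blk_offset Zs i + p))))\<^sup>2 -
          (norm (\<Sum>i<length Zs. phi (Zs ! i) (\<lambda>p. cnj (\<gamma> k (blk_offset Zs i + p))) (\<sigma> (Zs ! i) (\<lambda>p. x $ (blk_offset Zs i + p)))))\<^sup>2)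
          \<in> \<real>\<^sub>\<ge>\<^sub>0"
        unfolding nonneg_Reals_of_real_iff
        using contr Zs unfolding contr_def by (intro sum_nonneg) (simp add: power_mono)
    qed
  qed (simp add: kernel_block_def)
qed

text \<open>One rank-one matrix suffices: the rows \<open>v i\<close> are glued into a single row
  \<open>u\<close>, and positivity of the resulting block matrix is the required inequality.\<close>

lemma contr_if_cp:
  fixes \<sigma> :: "'v mat \<Rightarrow> (nat \<Rightarrow> 'a::chilbert) \<Rightarrow> nat \<Rightarrow> 'u::chilbert"
  assumes \<Omega>: "\<Omega> \<subseteq> D" and rep: "represents \<Omega> K \<sigma>" and cp: "cp_nc_kernel s \<Omega> K"
    and cong: "\<And>W y y' j. W \<in> \<Omega> \<Longrightarrow> (\<And>l. l < dim_row W \<Longrightarrow> y l = y' l) \<Longrightarrow> \<sigma> W y = \<sigma> W y'"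
  shows "contr \<Omega> \<sigma>"
  unfolding contr_def
proof (intro allI impI)
  fix Zs :: "'v mat list" and v :: "nat \<Rightarrow> nat \<Rightarrow> complex" and y :: "nat \<Rightarrow> nat \<Rightarrow> 'a"
  assume Zs: "set Zs \<subseteq> \<Omega>"
  let ?N = "blk_offset Zs (length Zs)" and ?l = "length Zs"
  define u where "u r = (let i = blk_index Zs r in v i (r - blk_offset Zs i))" for r
  define x where "x = vec ?N (\<lambda>r. let i = blk_index Zs r in y i (r - blk_offset Zs i))"
  define P where "P = mat ?N ?N (\<lambda>(r, t). cnj (u r) * u t)"
  have x: "x \<in> carrier_vec ?N" by (simp add: x_def)
  have uv: "u (blk_offset Zs i + p) = v i p" if "p < dim_row (Zs ! i)" for i p
    using that by (simp add: u_def blk_index)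
  have xy: "x $ (blk_offset Zs i + p) = y i p" if "i < ?l" "p < dim_row (Zs ! i)" for i p
    using that by (simp add: x_def blk_index blk_offset_less)
  have Zi: "Zs ! i \<in> \<Omega>" if "i < ?l" for i using Zs that nth_mem by blast
  have "opmat_positive (kernel_block K Zs P)"
    using cp Zs ampl_rank_one_positive unfolding cp_nc_kernel_def P_def by auto
  hence "vec_cinner (opmat_apply (kernel_block K Zs P) x) x \<in> \<real>\<^sub>\<ge>\<^sub>0"
    using x unfolding opmat_positive_def by (simp add: kernel_block_def)
  moreover have "vec_cinner (opmat_apply (kernel_block K Zs P) x) x =
      of_real (\<Sum>k<1::nat. (norm (\<Sum>i<?l. phi (Zs ! i) (\<lambda>p. cnj (cnj (u (blk_offset Zs i + p)))) (\<lambda>p. x $ (blk_offset Zs i + p))))\<^sup>2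
      - (norm (\<Sum>i<?l. phi (Zs ! i) (\<lambda>p. cnj (cnj (u (blk_offset Zs i + p)))) (\<sigma> (Zs ! i) (\<lambda>p. x $ (blk_offset Zs i + p)))))\<^sup>2)"
    by (rule block_form[OF \<Omega> rep Zs _ x]) (simp add: P_def)
  moreover have "(\<Sum>i<?l. phi (Zs ! i) (\<lambda>p. cnj (cnj (u (blk_offset Zs i + p)))) (\<lambda>p. x $ (blk_offset Zs i + p)))
      = (\<Sum>i<?l. phi (Zs ! i) (v i) (y i))"
    unfolding phi_def by (intro sum.cong refl arg_cong[where f=vell2] ext ev_cong) (auto simp: uv xy)
  moreover have "(\<Sum>i<?l. phi (Zs ! i) (\<lambda>p. cnj (cnj (u (blk_offset Zs i + p)))) (\<sigma> (Zs ! i) (\<lambda>p. x $ (blk_offset Zs i + p))))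
      = (\<Sum>i<?l. phi (Zs ! i) (v i) (\<sigma> (Zs ! i) (y i)))"
    unfolding phi_def
  proof (intro sum.cong refl arg_cong[where f=vell2] ext ev_cong)
    fix i l assume i: "i \<in> {..<?l}"
    have "\<sigma> (Zs ! i) (\<lambda>p. x $ (blk_offset Zs i + p)) = \<sigma> (Zs ! i) (y i)"
      using i by (intro cong Zi xy) auto
    thus "\<sigma> (Zs ! i) (\<lambda>p. x $ (blk_offset Zs i + p)) l = \<sigma> (Zs ! i) (y i) l" by simp
  qed (simp add: uv)
  ultimately have "(norm (\<Sum>i<?l. phi (Zs ! i) (v i) (\<sigma> (Zs ! i) (y i))))\<^sup>2 \<le> (norm (\<Sum>i<?l. phi (Zs ! i) (v i) (y i)))\<^sup>2"
    by (simp add: nonneg_Reals_of_real_iff del: of_real_diff of_real_power)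
  thus "norm (\<Sum>i<?l. phi (Zs ! i) (v i) (\<sigma> (Zs ! i) (y i))) \<le> norm (\<Sum>i<?l. phi (Zs ! i) (v i) (y i))"
    by (rule power2_le_imp_le) simp
qed

end

section \<open>The reproducing kernel Hilbert space and its multipliers\<close>

definition single :: "nat \<Rightarrow> 'x::zero \<Rightarrow> nat \<Rightarrow> 'x" where
  "single i t p = (if p = i then t else 0)"

lemma op_of_vec_eq_iff [simp]: "op_of_vec x = op_of_vec y \<longleftrightarrow> x = y"
proof
  assume "op_of_vec x = op_of_vec y"
  hence "cblop_apply (op_of_vec x) 1 = cblop_apply (op_of_vec y) 1" by simp
  thus "x = y" by (simp add: op_of_vec.rep_eq scaleC_one)
qed simp

lemma op_of_vec_add: "op_of_vec (x + y) = op_of_vec x + op_of_vec y"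
  by (rule cblop_eqI) (simp add: op_of_vec.rep_eq plus_cblop.rep_eq scaleC_add_right)

lemma op_of_vec_scale: "op_of_vec (scaleC c x) = op_scale c (op_of_vec x)"
  by (rule cblop_eqI) (simp add: op_of_vec.rep_eq op_scale.rep_eq scaleC_scaleC mult.commute)

lemma op_of_vec_zero: "op_of_vec 0 = 0"
  by (rule cblop_eqI) (simp add: op_of_vec.rep_eq zero_cblop.rep_eq scaleC_zero_right)

lemma op_of_vec_sum: "op_of_vec (sum f A) = (\<Sum>i\<in>A. op_of_vec (f i))"
  by (induction A rule: infinite_finite_induct) (auto simp: op_of_vec_zero op_of_vec_add)

lemma op_comp_of_vec: "op_comp T (op_of_vec x) = op_of_vec (cblop_apply T x)"
  by (rule cblop_eqI) (simp add: op_of_vec.rep_eq op_comp.rep_eq cblop_scale)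

definition adjact :: "('v mat \<Rightarrow> ('u::chilbert, 'y::chilbert) cblop mat) \<Rightarrow> 'v mat \<Rightarrow> (nat \<Rightarrow> 'y) \<Rightarrow> nat \<Rightarrow> 'u" where
  "adjact S W y b = (\<Sum>q<dim_row W. cblop_apply (op_adj (S W $$ (q, b))) (y q))"

lemma adjact_single:
  assumes "i < dim_row W"
  shows "adjact S W (single i t) k = cblop_apply (op_adj (S W $$ (i, k))) t"
proof -
  have "adjact S W (single i t) k = (\<Sum>q<dim_row W. if q = i then cblop_apply (op_adj (S W $$ (i, k))) t else 0)"
    unfolding adjact_def by (intro sum.cong refl) (auto simp: single_def cblop_zero)
  thus ?thesis using assms by simp
qed

lemma vec_cinner_opmat_apply:
  assumes "S W \<in> carrier_mat (dim_row W) (dim_row W)" "dim_vec x = dim_row W"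
  shows "vec_cinner (opmat_apply (S W) x) y = (\<Sum>b<dim_row W. cinner (x $ b) (adjact S W (\<lambda>q. y $ q) b))"
  using assms unfolding vec_cinner_def opmat_apply_def adjact_def
  by (simp add: cinner_sum_left cinner_sum_right op_adj_right) (rule sum.swap)

lemma opmat_apply_mult:
  assumes "A \<in> carrier_mat n m" "B \<in> carrier_mat m l" "dim_vec x = l"
  shows "opmat_apply (opmat_mult A B) x = opmat_apply A (opmat_apply B x)"
  using assms unfolding opmat_apply_def
  by (intro eq_vecI) (auto simp: sum_cblop_apply op_comp.rep_eq cblop_sum intro: sum.swap)

context nc_row_ball
begin

section \<open>Linearity and bounds of the feature vectors\<close>

lemma phi_cong:
  "(\<And>l. l < dim_row W \<Longrightarrow> y l = z l) \<Longrightarrow> (\<And>l. l < dim_row W \<Longrightarrow> u l = v l) \<Longrightarrow> phi W u y = phi W v z"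
  unfolding phi_def by (intro arg_cong[where f=vell2] ext ev_cong)

lemma phi_lincomb_y:
  assumes "W \<in> D" "finite F"
  shows "phi W v (\<lambda>j. \<Sum>i\<in>F. scaleC (c i) (y i j)) = (\<Sum>i\<in>F. scaleC (c i) (phi W v (y i)))"
  unfolding phi_def ev_lincomb_y[abs_def] by (intro vell2_lincomb assms sq_sum_ev)

lemma phi_lincomb_v:
  assumes "W \<in> D" "finite F"
  shows "phi W (\<lambda>j. \<Sum>i\<in>F. c i * v i j) y = (\<Sum>i\<in>F. scaleC (c i) (phi W (v i) y))"
  unfolding phi_def ev_lincomb_v[abs_def] by (intro vell2_lincomb assms sq_sum_ev)

lemma phi_scale_v: "W \<in> D \<Longrightarrow> phi W (\<lambda>j. c * v j) y = scaleC c (phi W v y)"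
  using phi_lincomb_v[of W "{()}" "\<lambda>_. c" "\<lambda>_. v" y] by simp

lemma phi_expand_v:
  assumes "W \<in> D"
  shows "phi W v y = (\<Sum>j<dim_row W. scaleC (v j) (phi W (unit_fun j) y))"
proof -
  have "phi W v y = phi W (\<lambda>l. \<Sum>j<dim_row W. v j * unit_fun j l) y"
    by (intro phi_cong) (auto simp: unit_fun_def if_distrib[of "\<lambda>c. _ * c"] cong: if_cong)
  thus ?thesis by (simp add: phi_lincomb_v assms)
qed

lemma phi_expand_y:
  assumes "W \<in> D"
  shows "phi W v y = (\<Sum>i<dim_row W. phi W v (single i (y i)))"
proof -
  have "phi W v y = phi W v (\<lambda>l. \<Sum>i<dim_row W. scaleC 1 (single i (y i) l))"
    by (intro phi_cong) (auto simp: single_def scaleC_one)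
  thus ?thesis unfolding phi_lincomb_y[OF assms finite_lessThan] by (simp add: scaleC_one)
qed

lemma norm_phi_unit:
  assumes "W \<in> D" "j < dim_row W"
  shows "(norm (phi W (unit_fun j) y))\<^sup>2 \<le> (\<Sum>p<dim_row W. (norm (y p))\<^sup>2) / (1 - (opmat_norm (Q W))\<^sup>2)"
proof -
  have "ev Q W (unit_fun j) y = (\<lambda>w. Lact Q W w y j)"
    using assms(2)
    by (simp add: ev_def fun_eq_iff unit_fun_def if_distrib[of "\<lambda>c. scaleC c _"] scaleC_one scaleC_zero_left cong: if_cong)
  thus ?thesis using norm_Lact_le[OF assms] by (simp add: phi_def norm_vell2 sq_sum_Lact assms)
qed

text \<open>The adjoint of \<open>A\<close> commutes with words and can then be absorbed into the
  row, which carries the feature vector from the point \<open>Z\<close> to the point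
  \<open>W\<close>.\<close>

lemma phi_astar:
  assumes Z: "Z \<in> D" and W: "W \<in> D"
    and A: "A \<in> carrier_mat (dim_row W) (dim_row Z)" "lmult s A Z = rmult s W A"
  shows "phi Z v (astar A y) = phi W (\<lambda>i. \<Sum>p<dim_row Z. v p * cnj (A $$ (i, p))) y"
proof -
  have "ev Q Z v (astar A y) w = ev Q W (\<lambda>i. \<Sum>p<dim_row Z. v p * cnj (A $$ (i, p))) y w" for w
  proof -
    have "ev Q Z v (astar A y) w = (\<Sum>p<dim_row Z. \<Sum>i<dim_row W. scaleC (v p * cnj (A $$ (i, p))) (Lact Q W w y i))"
      unfolding ev_def using A
      by (simp add: astar_Lact[OF D_Xi[OF Z] D_Xi[OF W] A]) (simp add: astar_def scaleC_sum_right scaleC_scaleC)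
    also have "\<dots> = (\<Sum>i<dim_row W. \<Sum>p<dim_row Z. scaleC (v p * cnj (A $$ (i, p))) (Lact Q W w y i))"
      by (rule sum.swap)
    finally show ?thesis by (simp add: ev_def scaleC_sum_left)
  qed
  thus ?thesis unfolding phi_def by presburger
qed

text \<open>\<open>phi\<close> is packed into an operator in \<open>t\<close> so that its adjoint
  can supply the entries \<open>fval\<close>.\<close>

definition Phi :: "'v mat \<Rightarrow> nat \<Rightarrow> nat \<Rightarrow> ('h::chilbert, ('r list \<Rightarrow> 'h) ell2) cblop" where
  "Phi W j i = Abs_cblop (\<lambda>t. phi W (unit_fun j) (single i t))"

lemma Phi_apply:
  fixes t :: "'h::chilbert"
  assumes W: "W \<in> D" and j: "j < dim_row W"
  shows "cblop_apply (Phi W j i) t = phi W (unit_fun j) (single i t)"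
proof -
  have "cblop_apply (Phi W j i) = (\<lambda>t :: 'h. phi W (unit_fun j) (single i t))"
    unfolding Phi_def
  proof (rule cblop_apply_Abs)
    show "phi W (unit_fun j) (single i (x + y)) = phi W (unit_fun j) (single i x) + phi W (unit_fun j) (single i y)" for x y :: 'h
    proof -
      have "single i (x + y) = (\<lambda>l. \<Sum>b\<in>{True, False}. scaleC 1 (single i (if b then x else y) l))"
        by (auto simp: single_def scaleC_one)
      hence "phi W (unit_fun j) (single i (x + y)) = phi W (unit_fun j) (\<lambda>l. \<Sum>b\<in>{True, False}. scaleC 1 (single i (if b then x else y) l))"
        by simp
      also have "\<dots> = (\<Sum>b\<in>{True, False}. scaleC 1 (phi W (unit_fun j) (single i (if b then x else y))))"
        by (rule phi_lincomb_y[OF W]) simp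
      finally show ?thesis by (simp add: scaleC_one)
    qed
    show "phi W (unit_fun j) (single i (scaleC c x)) = scaleC c (phi W (unit_fun j) (single i x))" for c and x :: 'h
    proof -
      have "single i (scaleC c x) = (\<lambda>l. \<Sum>b\<in>{()}. scaleC c (single i x l))"
        by (auto simp: single_def scaleC_zero_right)
      hence "phi W (unit_fun j) (single i (scaleC c x)) = phi W (unit_fun j) (\<lambda>l. \<Sum>b\<in>{()}. scaleC c (single i x l))"
        by (rule arg_cong)
      also have "\<dots> = (\<Sum>b\<in>{()}. scaleC c (phi W (unit_fun j) (single i x)))"
        by (rule phi_lincomb_y[OF W]) simp
      finally show ?thesis by simp
    qed
    define r where "r = 1 - (opmat_norm (Q W))\<^sup>2"
    have r: "r > 0" using norm_Q_less[OF W] by (simp add: r_def)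
    show "norm (phi W (unit_fun j) (single i x)) \<le> sqrt (1 / r) * norm x" for x :: 'h
    proof (rule power2_le_imp_le)
      have "(\<Sum>p<dim_row W. (norm (single i x p))\<^sup>2) = (\<Sum>p<dim_row W. if p = i then (norm x)\<^sup>2 else 0)"
        by (intro sum.cong) (auto simp: single_def)
      also have "\<dots> \<le> (norm x)\<^sup>2" by simp
      finally have "(\<Sum>p<dim_row W. (norm (single i x p))\<^sup>2) / r \<le> (norm x)\<^sup>2 / r"
        using r by (intro divide_right_mono) auto
      thus "(norm (phi W (unit_fun j) (single i x)))\<^sup>2 \<le> (sqrt (1 / r) * norm x)\<^sup>2"
        using norm_phi_unit[OF W j, of "single i x"] r unfolding r_def[symmetric] by (simp add: power_mult_distrib)
    qed (use r in simp)
  qed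
  thus ?thesis by simp
qed

lemma phi_single_scale:
  "W \<in> D \<Longrightarrow> j < dim_row W \<Longrightarrow>
    phi W (unit_fun j) (single i (scaleC c t)) = scaleC c (phi W (unit_fun j) (single i t))"
  by (simp add: Phi_apply[symmetric] cblop_scale)

text \<open>\<open>felt \<xi>\<close> is the function \<open>f\<close> with \<open>\<langle>f(W) v\<^sup>*, y\<rangle> = \<langle>\<xi>, \<phi>(W, v, y)\<rangle>\<close>; it determines \<open>\<xi>\<close> up to the
  orthogonal complement of \<open>closed_span\<close>.\<close>

definition fval :: "('r list \<Rightarrow> 'h::chilbert) ell2 \<Rightarrow> 'v mat \<Rightarrow> nat \<Rightarrow> nat \<Rightarrow> 'h" where
  "fval \<xi> W i j = cblop_apply (op_adj (Phi W j i)) \<xi>"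

lemma cinner_fval:
  "W \<in> D \<Longrightarrow> j < dim_row W \<Longrightarrow> cinner (fval \<xi> W i j) t = cinner \<xi> (phi W (unit_fun j) (single i t))"
  unfolding fval_def by (simp add: op_adj_left Phi_apply)

definition felt :: "('r list \<Rightarrow> 'h::chilbert) ell2 \<Rightarrow> ('v, 'h) nc_fun" where
  "felt \<xi> = (\<lambda>W\<in>D. mat (dim_row W) (dim_row W) (\<lambda>(i, j). op_of_vec (fval \<xi> W i j)))"

lemma felt_pairing:
  assumes "W \<in> D"
  shows "(\<Sum>i<dim_row W. cinner (\<Sum>j<dim_row W. scaleC (cnj (v j)) (fval \<xi> W i j)) (y i)) = cinner \<xi> (phi W v y)"
proof -
  have "cinner \<xi> (phi W v y) = (\<Sum>j<dim_row W. \<Sum>i<dim_row W. cnj (v j) * cinner \<xi> (phi W (unit_fun j) (single i (y i))))"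
    by (subst phi_expand_v[OF assms], subst phi_expand_y[OF assms])
      (simp add: cinner_sum_right cinner_scaleC_right sum_distrib_left)
  also have "\<dots> = (\<Sum>i<dim_row W. \<Sum>j<dim_row W. cnj (v j) * cinner \<xi> (phi W (unit_fun j) (single i (y i))))"
    by (rule sum.swap)
  finally show ?thesis using assms by (simp add: cinner_sum_left cinner_scaleC_left cinner_fval)
qed

lemma felt_reproducing:
  assumes W: "W \<in> D" and v: "v \<in> carrier_vec (dim_row W)" and y: "y \<in> carrier_vec (dim_row W)"
  shows "vec_cinner (opmat_apply (felt \<xi> W) (conjugate v)) y = cinner \<xi> (phi W (\<lambda>q. v $ q) (\<lambda>q. y $ q))"
  using assms unfolding felt_pairing[OF W, symmetric]
  by (simp add: vec_cinner_def opmat_apply_def felt_def op_of_vec.rep_eq)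

lemma felt_eqI:
  assumes "\<And>W v y. W \<in> D \<Longrightarrow> cinner \<xi> (phi W v y) = cinner \<eta> (phi W v y)"
  shows "felt \<xi> = felt \<eta>"
proof -
  have "fval \<xi> W i j = fval \<eta> W i j" if "W \<in> D" "j < dim_row W" for W i j
    by (rule cinner_ext_left) (simp add: cinner_fval that assms)
  thus ?thesis unfolding felt_def by (intro restrict_ext eq_matI) auto
qed

lemma felt_eqD:
  assumes "felt \<xi> = felt \<eta>" "W \<in> D"
  shows "cinner \<xi> (phi W v y) = cinner \<eta> (phi W v y)"
proof -
  have "fval \<xi> W i j = fval \<eta> W i j" if "i < dim_row W" "j < dim_row W" for i j
    using arg_cong[OF fun_cong[OF assms(1), of W], of "\<lambda>M. M $$ (i, j)"] that assms(2)
    by (simp add: felt_def)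
  thus ?thesis unfolding felt_pairing[OF assms(2), symmetric] by simp
qed

text \<open>The double orthogonal complement of the feature vectors, that is the closure of their
  linear span, described without limits.\<close>

definition closed_span :: "('r list \<Rightarrow> 'h::chilbert) ell2 set" where
  "closed_span = {\<xi>. \<forall>z. (\<forall>W\<in>D. \<forall>v y. cinner (phi W v y) z = 0) \<longrightarrow> cinner \<xi> z = 0}"

lemma felt_inj:
  assumes "\<xi> \<in> closed_span" "\<eta> \<in> closed_span" "felt \<xi> = felt \<eta>"
  shows "\<xi> = \<eta>"
proof -
  have "cinner (phi W v y) (\<xi> - \<eta>) = 0" if "W \<in> D" for W v y
    using felt_eqD[OF assms(3) that, of v y] cinner_commute[of "phi W v y"] by (simp add: cinner_diff_right)
  hence "cinner \<xi> (\<xi> - \<eta>) = 0" "cinner \<eta> (\<xi> - \<eta>) = 0" using assms unfolding closed_span_def by auto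
  hence "cinner (\<xi> - \<eta>) (\<xi> - \<eta>) = 0" by (simp add: cinner_diff_left)
  thus ?thesis by (simp add: cinner_self)
qed

text \<open>Riesz representation of \<open>\<xi>\<close> on the feature vectors plays the part of
  the orthogonal projection onto \<open>closed_span\<close>.\<close>

lemma felt_project:
  fixes \<xi> :: "('r list \<Rightarrow> 'h::chilbert) ell2"
  shows "\<exists>\<eta>\<in>closed_span. felt \<eta> = felt \<xi> \<and> norm \<eta> \<le> norm \<xi>"
proof -
  define h where "h = (\<lambda>(W, v, y :: nat \<Rightarrow> 'h). phi W v y)"
  define I where "I = {(W, v :: nat \<Rightarrow> complex, y :: nat \<Rightarrow> 'h). W \<in> D}"
  have "cmod (\<Sum>i\<in>F. c i * cinner (h i) \<xi>) \<le> norm \<xi> * norm (\<Sum>i\<in>F. scaleC (c i) (h i))" for F c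
    using cauchy_schwarz[of "\<Sum>i\<in>F. scaleC (c i) (h i)" \<xi>]
    by (simp add: cinner_sum_left cinner_scaleC_left mult.commute)
  from riesz_family[where h=h and I=I, OF this] obtain p where p: "norm p \<le> norm \<xi>"
    "\<And>i. i \<in> I \<Longrightarrow> cinner (h i) p = cinner (h i) \<xi>" "\<And>z. (\<forall>i\<in>I. cinner (h i) z = 0) \<Longrightarrow> cinner p z = 0"
    by auto
  have "p \<in> closed_span" unfolding closed_span_def using p(3) by (auto simp: h_def I_def)
  moreover have "felt p = felt \<xi>"
  proof (rule felt_eqI)
    fix W v y assume "W \<in> D"
    hence "cinner (phi W v y) p = cinner (phi W v y) \<xi>" using p(2)[of "(W, v, y)"] by (simp add: h_def I_def)
    thus "cinner p (phi W v y) = cinner \<xi> (phi W v y)"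
      using cinner_commute[of p "phi W v y"] cinner_commute[of \<xi> "phi W v y"] by simp
  qed
  ultimately show ?thesis using p(1) by blast
qed

lemma closed_span_add: "\<xi> \<in> closed_span \<Longrightarrow> \<eta> \<in> closed_span \<Longrightarrow> \<xi> + \<eta> \<in> closed_span"
  unfolding closed_span_def by (simp add: cinner_add_left)

lemma closed_span_scale: "\<xi> \<in> closed_span \<Longrightarrow> scaleC c \<xi> \<in> closed_span"
  unfolding closed_span_def by (simp add: cinner_scaleC_left)

lemma closed_span_zero: "0 \<in> closed_span"
  unfolding closed_span_def by (simp add: cinner_zero_left)

lemma closed_span_phi: "W \<in> D \<Longrightarrow> phi W v y \<in> closed_span"
  unfolding closed_span_def by blast

lemma closed_span_limit:
  fixes \<xi> :: "('r list \<Rightarrow> 'h::chilbert) ell2"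
  assumes "\<And>n. X n \<in> closed_span" "X \<longlonglongrightarrow> \<xi>"
  shows "\<xi> \<in> closed_span"
  unfolding closed_span_def
proof (intro CollectI allI impI)
  fix z :: "('r list \<Rightarrow> 'h) ell2" assume z: "\<forall>W\<in>D. \<forall>v y. cinner (phi W v y) z = 0"
  have "(\<lambda>n. cinner (X n) z) \<longlonglongrightarrow> cinner \<xi> z" by (intro tendsto_cinner assms(2) tendsto_const)
  moreover have "cinner (X n) z = 0" for n using assms(1)[of n] z unfolding closed_span_def by blast
  ultimately show "cinner \<xi> z = 0" by (simp add: LIMSEQ_const_iff)
qed

section \<open>The space \<open>H(K)\<close> as an isometric image of
  \<open>closed_span\<close>\<close>

lemma fval_add: "fval (\<xi> + \<eta>) W i j = fval \<xi> W i j + fval \<eta> W i j"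
  by (simp add: fval_def cblop_add)

lemma fval_scale: "fval (scaleC c \<xi>) W i j = scaleC c (fval \<xi> W i j)"
  by (simp add: fval_def cblop_scale)

lemma felt_add: "fun_add D (felt \<xi>) (felt \<eta>) = felt (\<xi> + \<eta>)"
  unfolding fun_add_def felt_def by (intro restrict_ext eq_matI) (auto simp: fval_add op_of_vec_add)

lemma felt_scale: "fun_scale D c (felt \<xi>) = felt (scaleC c \<xi>)"
  unfolding fun_scale_def felt_def by (intro restrict_ext eq_matI) (auto simp: fval_scale op_of_vec_scale)

lemma felt_zero: "fun_zero D = felt 0"
  unfolding fun_zero_def felt_def by (intro restrict_ext eq_matI) (auto simp: fval_def cblop_zero op_of_vec_zero)

definition rep :: "('v, 'h::chilbert) nc_fun \<Rightarrow> ('r list \<Rightarrow> 'h) ell2" where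
  "rep f = (SOME \<xi>. \<xi> \<in> closed_span \<and> felt \<xi> = f)"

lemma rep_felt: "\<xi> \<in> closed_span \<Longrightarrow> rep (felt \<xi>) = \<xi>"
  unfolding rep_def by (rule some_equality) (auto intro: felt_inj)

definition rip :: "('v, 'h::chilbert) nc_fun \<Rightarrow> ('v, 'h) nc_fun \<Rightarrow> complex" where
  "rip f g = cinner (rep f) (rep g)"

lemma rip_felt: "\<xi> \<in> closed_span \<Longrightarrow> \<eta> \<in> closed_span \<Longrightarrow> rip (felt \<xi>) (felt \<eta>) = cinner \<xi> \<eta>"
  by (simp add: rip_def rep_felt)

text \<open>\<open>felt\<close> is linear and isometric on \<open>closed_span\<close> for
  \<open>rip\<close>, so completeness is inherited from a closed subspace.\<close>

lemma hilbert_function_space_felt: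
  "hilbert_function_space D (felt ` (closed_span :: ('r list \<Rightarrow> 'h::chilbert) ell2 set)) rip"
proof -
  let ?M = "closed_span :: ('r list \<Rightarrow> 'h) ell2 set"
  let ?d = "\<lambda>f g :: ('v, 'h) nc_fun. let h = fun_add D f (fun_scale D (- 1) g) in sqrt (Re (rip h h))"
  have d: "?d (felt \<xi>) (felt \<eta>) = norm (\<xi> - \<eta>)" if "\<xi> \<in> ?M" "\<eta> \<in> ?M" for \<xi> \<eta>
  proof -
    have "\<xi> + scaleC (- 1) \<eta> \<in> ?M" using that by (intro closed_span_add closed_span_scale)
    thus ?thesis unfolding Let_def felt_scale felt_add by (simp add: rip_felt scaleC_minus_one norm_eq_sqrt_cinner)
  qed
  have complete: "\<exists>f\<in>felt ` ?M. (\<lambda>n. ?d (X n) f) \<longlonglongrightarrow> 0"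
    if X: "range X \<subseteq> felt ` ?M" and cau: "\<forall>e>0. \<exists>M. \<forall>m\<ge>M. \<forall>n\<ge>M. ?d (X m) (X n) < e" for X
  proof -
    have "\<exists>\<xi>. \<xi> \<in> ?M \<and> X n = felt \<xi>" for n using X by blast
    then obtain x where x: "\<And>n. x n \<in> ?M" "\<And>n. X n = felt (x n)" by metis
    have "Cauchy x" using cau unfolding x(2) d[OF x(1) x(1)] Cauchy_iff by blast
    then obtain \<xi> where lim: "x \<longlonglongrightarrow> \<xi>" using Cauchy_convergent convergent_def by blast
    have \<xi>: "\<xi> \<in> ?M" by (rule closed_span_limit[OF x(1) lim])
    have "(\<lambda>n. norm (x n - \<xi>)) \<longlonglongrightarrow> 0" using lim by (simp add: LIM_zero_iff tendsto_norm_zero)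
    hence "(\<lambda>n. ?d (X n) (felt \<xi>)) \<longlonglongrightarrow> 0" unfolding x(2) d[OF x(1) \<xi>] .
    thus ?thesis using \<xi> by blast
  qed
  show ?thesis unfolding hilbert_function_space_def
  proof (intro conjI)
    show "felt ` ?M \<subseteq> extensional D" by (auto simp: felt_def)
    show "fun_zero D \<in> felt ` ?M" unfolding felt_zero using closed_span_zero by blast
    show "\<forall>f\<in>felt ` ?M. \<forall>g\<in>felt ` ?M. fun_add D f g \<in> felt ` ?M"
      by (auto simp: felt_add intro: closed_span_add)
    show "\<forall>c. \<forall>f\<in>felt ` ?M. fun_scale D c f \<in> felt ` ?M"
      by (auto simp: felt_scale intro: closed_span_scale)
    show "\<forall>f\<in>felt ` ?M. \<forall>g\<in>felt ` ?M. \<forall>h\<in>felt ` ?M. rip (fun_add D f g) h = rip f h + rip g h"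
      by (auto simp: felt_add rip_felt closed_span_add cinner_add_left)
    show "\<forall>c. \<forall>f\<in>felt ` ?M. \<forall>g\<in>felt ` ?M. rip (fun_scale D c f) g = c * rip f g"
      by (auto simp: felt_scale rip_felt closed_span_scale cinner_scaleC_left)
    show "\<forall>f\<in>felt ` ?M. \<forall>g\<in>felt ` ?M. rip f g = cnj (rip g f)"
      by (auto simp: rip_felt intro: cinner_commute)
    show "\<forall>f\<in>felt ` ?M. rip f f \<in> \<real>\<^sub>\<ge>\<^sub>0"
      by (auto simp: rip_felt cinner_self simp del: of_real_power)
    show "\<forall>f\<in>felt ` ?M. rip f f = 0 \<longrightarrow> f = fun_zero D"
      by (auto simp: rip_felt cinner_self felt_zero)
    show "let d = ?d in \<forall>X :: nat \<Rightarrow> ('v, 'h) nc_fun. range X \<subseteq> felt ` ?M \<and> (\<forall>e>0. \<exists>M. \<forall>m\<ge>M. \<forall>n\<ge>M. d (X m) (X n) < e) \<longrightarrow>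
        (\<exists>f\<in>felt ` ?M. (\<lambda>n. d (X n) f) \<longlonglongrightarrow> 0)"
      unfolding Let_def using complete unfolding Let_def by blast
  qed
qed

text \<open>Paired with \<open>t\<close>, both sides are the inner product of \<open>\<xi>\<close>
  with the same feature vector, by \<open>phi_astar\<close>.\<close>

lemma felt_nc_function: "nc_function s op_scale D (felt \<xi>)"
  unfolding nc_function_def graded_def
proof (intro conjI allI ballI impI)
  show "felt \<xi> Z \<in> carrier_mat n n" if "Z \<in> D \<inter> carrier_mat n n" for n Z
    using that by (auto simp: felt_def)
  fix Z W A assume Z: "Z \<in> D" and W: "W \<in> D" and A: "A \<in> carrier_mat (dim_row W) (dim_row Z)"
    and int: "lmult s A Z = rmult s W A"
  show "lmult op_scale A (felt \<xi> Z) = rmult op_scale (felt \<xi> W) A"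
  proof (rule eq_matI)
    fix i j assume "i < dim_row (rmult op_scale (felt \<xi> W) A)" "j < dim_col (rmult op_scale (felt \<xi> W) A)"
    hence ij: "i < dim_row W" "j < dim_row Z" using A W by (auto simp: felt_def)
    have "(\<Sum>k<dim_row Z. scaleC (A $$ (i, k)) (fval \<xi> Z k j)) = (\<Sum>k<dim_row W. scaleC (A $$ (k, j)) (fval \<xi> W i k))"
    proof (rule cinner_ext_left)
      fix t
      have "cinner (\<Sum>k<dim_row Z. scaleC (A $$ (i, k)) (fval \<xi> Z k j)) t
          = cinner \<xi> (\<Sum>k<dim_row Z. phi Z (unit_fun j) (single k (scaleC (cnj (A $$ (i, k))) t)))"
        using ij by (simp add: cinner_sum_left cinner_sum_right cinner_scaleC_left cinner_fval Z
            phi_single_scale cinner_scaleC_right)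
      also have "(\<Sum>k<dim_row Z. phi Z (unit_fun j) (single k (scaleC (cnj (A $$ (i, k))) t)))
          = phi Z (unit_fun j) (\<lambda>k. scaleC (cnj (A $$ (i, k))) t)"
        by (rule phi_expand_y[OF Z, symmetric])
      also have "\<dots> = phi Z (unit_fun j) (astar A (single i t))"
        using ij A by (intro phi_cong)
          (auto simp: astar_def single_def if_distrib[of "scaleC _"] scaleC_zero_right cong: if_cong)
      also have "\<dots> = phi W (\<lambda>k. \<Sum>p<dim_row Z. unit_fun j p * cnj (A $$ (k, p))) (single i t)"
        by (rule phi_astar[OF Z W A int])
      also have "\<dots> = phi W (\<lambda>k. cnj (A $$ (k, j))) (single i t)"
        using ij by (intro phi_cong) (auto simp: unit_fun_def if_distrib[of "\<lambda>c. c * _"] cong: if_cong)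
      also have "\<dots> = (\<Sum>k<dim_row W. scaleC (cnj (A $$ (k, j))) (phi W (unit_fun k) (single i t)))"
        by (rule phi_expand_v[OF W])
      finally show "cinner (\<Sum>k<dim_row Z. scaleC (A $$ (i, k)) (fval \<xi> Z k j)) t
          = cinner (\<Sum>k<dim_row W. scaleC (A $$ (k, j)) (fval \<xi> W i k)) t"
        by (simp add: cinner_sum_left cinner_sum_right cinner_scaleC_left cinner_scaleC_right cinner_fval W)
    qed
    thus "lmult op_scale A (felt \<xi> Z) $$ (i, j) = rmult op_scale (felt \<xi> W) A $$ (i, j)"
      using ij A Z W by (simp add: lmult_def rmult_def felt_def op_of_vec_scale[symmetric] op_of_vec_sum[symmetric])
  qed (use A Z W in \<open>auto simp: felt_def\<close>)
qed

lemma ball_kernel_dim: "ball_kernel Q Z W P \<in> carrier_mat (dim_row Z) (dim_row W)"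
  by (simp add: ball_kernel_def)

text \<open>The matrix in the kernel element is of rank one, so \<open>kform_rank_one\<close>
  identifies its entries with those of a feature vector. The reproducing property of
  \<open>H(K)\<close> then reduces to \<open>felt_reproducing\<close>.\<close>

lemma kernel_elt_eq_felt:
  assumes W: "W \<in> D" and v: "v \<in> carrier_vec (dim_row W)" and y: "y \<in> carrier_vec (dim_row W)"
  shows "kernel_elt D (ker_ampl (ball_kernel Q)) W v y = felt (phi W (\<lambda>q. v $ q) (\<lambda>q. y $ q))"
  unfolding kernel_elt_def felt_def
proof (intro restrict_ext eq_matI)
  let ?\<xi> = "phi W (\<lambda>q. v $ q) (\<lambda>q. y $ q)"
  let ?M = "\<lambda>Z. mat (dim_row Z) (dim_row Z) (\<lambda>(i, j). op_of_vec (fval ?\<xi> Z i j))"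
  fix Z i j assume Z: "Z \<in> D"
    and "i < dim_row (?M Z)"
    and "j < dim_col (?M Z)"
  hence ij: "i < dim_row Z" "j < dim_row Z" by auto
  define P where "P = outer_mat (unit_vec (dim_row Z) j) v"
  have P: "P \<in> carrier_mat (dim_row Z) (dim_row W)" using v by (simp add: P_def outer_mat_def)
  have dims: "dim_row (ball_kernel Q Z W P) = dim_row Z" "dim_col (ball_kernel Q Z W P) = dim_row W"
    using ball_kernel_dim by auto
  have "opmat_apply (ker_ampl (ball_kernel Q) Z W P) y $ i = fval ?\<xi> Z i j"
  proof (rule cinner_ext_left)
    fix t
    have "cinner (opmat_apply (ker_ampl (ball_kernel Q) Z W P) y $ i) t
        = (\<Sum>q<dim_row W. ball_kernel Q Z W P $$ (i, q) * cinner (y $ q) t)"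
      using ij by (simp add: opmat_apply_def ker_ampl_def dims op_scale.rep_eq op_id.rep_eq cinner_sum_left cinner_scaleC_left)
    also have "\<dots> = (\<Sum>p<dim_row Z. if p = i then \<Sum>q<dim_row W. ball_kernel Q Z W P $$ (i, q) * cinner (y $ q) t else 0)"
      using ij by simp
    also have "\<dots> = (\<Sum>p<dim_row Z. \<Sum>q<dim_row W. ball_kernel Q Z W P $$ (p, q) * cinner (y $ q) (single i t p))"
      by (intro sum.cong refl) (auto simp: single_def)
    also have "\<dots> = kform Z W P (\<lambda>q. y $ q) (single i t)" by (rule ball_kernel_form[OF Z W P])
    also have "\<dots> = (\<Sum>p<dim_row Z. \<Sum>q<dim_row W. cnj (unit_fun j p) * v $ q * Lvip Q Z W (\<lambda>q. y $ q) (single i t) p q)"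
      unfolding kform_def using v ij by (intro sum.cong refl) (auto simp: P_def outer_mat_def unit_fun_def unit_vec_def)
    also have "\<dots> = cinner ?\<xi> (phi Z (unit_fun j) (single i t))"
      by (rule kform_rank_one[OF Z W])
    finally show "cinner (opmat_apply (ker_ampl (ball_kernel Q) Z W P) y $ i) t
        = cinner (fval ?\<xi> Z i j) t"
      using ij by (simp add: cinner_fval Z)
  qed
  thus "mat (dim_row Z) (dim_row Z) (\<lambda>(i, j). op_of_vec (opmat_apply (ker_ampl (ball_kernel Q) Z W (outer_mat (unit_vec (dim_row Z) j) v)) y $ i)) $$ (i, j)
      = ?M Z $$ (i, j)"
    using ij by (simp add: P_def)
qed auto

lemma nc_rkhs_felt:
  "nc_rkhs s D (ker_ampl (ball_kernel Q) :: ('v, 'h::chilbert) nc_ker) (felt ` closed_span) rip"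
  unfolding nc_rkhs_def
proof (intro conjI ballI hilbert_function_space_felt)
  fix W and v :: "complex vec" and y :: "'h vec"
  assume W: "W \<in> D" and v: "v \<in> carrier_vec (dim_row W)" and y: "y \<in> carrier_vec (dim_row W)"
  note ke = kernel_elt_eq_felt[OF this]
  show "kernel_elt D (ker_ampl (ball_kernel Q)) W v y \<in> felt ` closed_span"
    unfolding ke using closed_span_phi[OF W] by blast
  show "vec_cinner (opmat_apply (f W) (conjugate v)) y = rip f (kernel_elt D (ker_ampl (ball_kernel Q)) W v y)"
    if "f \<in> felt ` closed_span" for f
    using that unfolding ke by (auto simp: felt_reproducing[OF W v y] rip_felt closed_span_phi[OF W])
qed (auto intro: felt_nc_function)

section \<open>Multipliers and contractions of feature vectors\<close>

lemma contr_finite_sum: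
  fixes \<sigma> :: "'v mat \<Rightarrow> (nat \<Rightarrow> 'h::chilbert) \<Rightarrow> nat \<Rightarrow> 'u::chilbert"
  assumes \<Omega>: "\<Omega> \<subseteq> D" and contr: "contr \<Omega> \<sigma>" and F: "finite F" "\<And>i. i \<in> F \<Longrightarrow> fst i \<in> \<Omega>"
  shows "norm (\<Sum>i\<in>F. scaleC (c i) (case i of (W, v, y) \<Rightarrow> phi W v (\<sigma> W y)))
    \<le> norm (\<Sum>i\<in>F. scaleC (c i) (case i of (W, v, y) \<Rightarrow> phi W v y))"
proof -
  obtain xs where xs: "set xs = F" "distinct xs" using finite_distinct_list[OF F(1)] by blast
  have bij: "bij_betw (\<lambda>k. xs ! k) {..<length xs} F" by (rule bij_betw_nth) (use xs in auto)
  define Zs where "Zs = map fst xs"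
  define v where "v k j = c (xs ! k) * fst (snd (xs ! k)) j" for k j
  define y where "y k = snd (snd (xs ! k))" for k
  have Zs: "set Zs \<subseteq> \<Omega>" "length Zs = length xs" using F(2) xs by (auto simp: Zs_def)
  have mem: "Zs ! k \<in> D" if "k < length xs" for k using Zs \<Omega> that by (metis nth_mem subsetD)
  have a: "(\<Sum>i\<in>F. scaleC (c i) (case i of (W, v, y) \<Rightarrow> phi W v (\<sigma> W y)))
      = (\<Sum>k<length xs. phi (Zs ! k) (v k) (\<sigma> (Zs ! k) (y k)))"
    unfolding sum.reindex_bij_betw[OF bij, symmetric] v_def
    by (intro sum.cong refl) (use mem in \<open>auto simp: phi_scale_v Zs_def y_def split: prod.splits\<close>)
  have b: "(\<Sum>i\<in>F. scaleC (c i) (case i of (W, v, y) \<Rightarrow> phi W v y))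
      = (\<Sum>k<length xs. phi (Zs ! k) (v k) (y k))"
    unfolding sum.reindex_bij_betw[OF bij, symmetric] v_def
    by (intro sum.cong refl) (use mem in \<open>auto simp: phi_scale_v Zs_def y_def split: prod.splits\<close>)
  show ?thesis unfolding a b using contr[unfolded contr_def, rule_format, OF Zs(1), of v y] Zs(2) by simp
qed

lemma graded_carrier: "graded D S \<Longrightarrow> W \<in> D \<Longrightarrow> S W \<in> carrier_mat (dim_row W) (dim_row W)"
  using D_square unfolding graded_def by blast

text \<open>The contraction \<open>V\<close> acts on feature vectors as the adjoint of
  multiplication by \<open>S\<close> should; its adjoint \<open>T\<close> induces the multiplication
  under \<open>felt\<close>.\<close>

lemma contractive_multiplierI:
  fixes S :: "'v mat \<Rightarrow> ('u::chilbert, 'y::chilbert) cblop mat"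
  assumes S: "graded D S" and contr: "contr D (adjact S)"
  shows "contractive_multiplier s D (ker_ampl (ball_kernel Q)) (ker_ampl (ball_kernel Q)) S"
proof -
  define g where "g = (\<lambda>(W, v, y :: nat \<Rightarrow> 'y). if W \<in> D then phi W v y else 0)"
  define h where "h = (\<lambda>(W, v, y :: nat \<Rightarrow> 'y). if W \<in> D then phi W v (adjact S W y) else 0)"
  have "norm (\<Sum>i\<in>F. scaleC (c i) (h i)) \<le> norm (\<Sum>i\<in>F. scaleC (c i) (g i))" if F: "finite F" for F c
  proof -
    let ?F = "{i\<in>F. fst i \<in> D}"
    have "(\<Sum>i\<in>F. scaleC (c i) (h i)) = (\<Sum>i\<in>?F. scaleC (c i) (case i of (W, v, y) \<Rightarrow> phi W v (adjact S W y)))"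
      by (rule sum.mono_neutral_cong_right) (use F in \<open>auto simp: h_def scaleC_zero_right split: if_splits\<close>)
    moreover have "(\<Sum>i\<in>F. scaleC (c i) (g i)) = (\<Sum>i\<in>?F. scaleC (c i) (case i of (W, v, y) \<Rightarrow> phi W v y))"
      by (rule sum.mono_neutral_cong_right) (use F in \<open>auto simp: g_def scaleC_zero_right split: if_splits\<close>)
    ultimately show ?thesis
      by (simp only:) (rule contr_finite_sum[OF subset_refl contr], use F in auto)
  qed
  from contraction_extension[where g=g and h=h, OF this] obtain V where V: "\<And>i. cblop_apply V (g i) = h i"
    "\<And>x. norm (cblop_apply V x) \<le> norm x" by blast
  have Vphi: "cblop_apply V (phi W v y) = phi W v (adjact S W y)" if "W \<in> D" for W v y
    using V(1)[of "(W, v, y)"] that by (simp add: g_def h_def)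
  define T where "T = op_adj V"
  have T_le: "norm (cblop_apply T \<xi>) \<le> norm \<xi>" for \<xi>
  proof -
    have "cmod (cinner \<xi> (cblop_apply V (cblop_apply T \<xi>))) \<le> norm \<xi> * norm (cblop_apply T \<xi>)"
      by (rule order_trans[OF cauchy_schwarz]) (simp add: V(2) mult_left_mono)
    hence "norm (cblop_apply T \<xi>) * norm (cblop_apply T \<xi>) \<le> norm \<xi> * norm (cblop_apply T \<xi>)"
      unfolding T_def by (simp add: op_adj_left[symmetric] cinner_self power2_eq_square norm_mult)
    thus ?thesis by (cases "cblop_apply T \<xi> = 0") auto
  qed
  have mult: "(\<lambda>W\<in>D. opmat_mult (S W) (felt \<xi> W)) = felt (cblop_apply T \<xi>)" for \<xi> :: "('r list \<Rightarrow> 'u) ell2"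
    unfolding felt_def[of "cblop_apply T \<xi>"]
  proof (intro restrict_ext eq_matI)
    fix W i j assume W: "W \<in> D"
      and "i < dim_row (mat (dim_row W) (dim_row W) (\<lambda>(i, j). op_of_vec (fval (cblop_apply T \<xi>) W i j)))"
      and "j < dim_col (mat (dim_row W) (dim_row W) (\<lambda>(i, j). op_of_vec (fval (cblop_apply T \<xi>) W i j)))"
    hence ij: "i < dim_row W" "j < dim_row W" by auto
    note SW = graded_carrier[OF S W]
    have "(\<Sum>k<dim_row W. cblop_apply (S W $$ (i, k)) (fval \<xi> W k j)) = fval (cblop_apply T \<xi>) W i j"
    proof (rule cinner_ext_left)
      fix t
      have "cinner (\<Sum>k<dim_row W. cblop_apply (S W $$ (i, k)) (fval \<xi> W k j)) t
          = cinner \<xi> (\<Sum>k<dim_row W. phi W (unit_fun j) (single k (adjact S W (single i t) k)))"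
        using ij by (simp add: cinner_sum_left cinner_sum_right op_adj_right cinner_fval W adjact_single)
      also have "(\<Sum>k<dim_row W. phi W (unit_fun j) (single k (adjact S W (single i t) k)))
          = cblop_apply V (phi W (unit_fun j) (single i t))"
        unfolding Vphi[OF W] by (rule phi_expand_y[OF W, symmetric])
      finally show "cinner (\<Sum>k<dim_row W. cblop_apply (S W $$ (i, k)) (fval \<xi> W k j)) t
          = cinner (fval (cblop_apply T \<xi>) W i j) t"
        using ij by (simp add: cinner_fval W T_def op_adj_left)
    qed
    thus "opmat_mult (S W) (felt \<xi> W) $$ (i, j)
        = mat (dim_row W) (dim_row W) (\<lambda>(i, j). op_of_vec (fval (cblop_apply T \<xi>) W i j)) $$ (i, j)"
      using ij W SW by (simp add: felt_def op_comp_of_vec op_of_vec_sum[symmetric])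
  qed (use graded_carrier[OF S] in \<open>auto simp: felt_def\<close>)
  show ?thesis
    unfolding contractive_multiplier_def
  proof (rule exI[of _ "felt ` closed_span"], rule exI[of _ rip], rule exI[of _ "felt ` closed_span"], rule exI[of _ rip],
      intro conjI ballI nc_rkhs_felt)
    fix f assume "f \<in> felt ` (closed_span :: ('r list \<Rightarrow> 'u) ell2 set)"
    then obtain \<xi> :: "('r list \<Rightarrow> 'u) ell2" where \<xi>: "\<xi> \<in> closed_span" "f = felt \<xi>" by blast
    \<comment> \<open>\<open>T\<close> may lead out of \<open>closed_span\<close>; the projection
      represents the same function and does not increase the norm.\<close>
    obtain \<eta> where \<eta>: "\<eta> \<in> closed_span" "felt \<eta> = felt (cblop_apply T \<xi>)" "norm \<eta> \<le> norm (cblop_apply T \<xi>)"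
      using felt_project by blast
    have "norm \<eta> \<le> norm \<xi>" using \<eta>(3) T_le[of \<xi>] by linarith
    thus "let g = \<lambda>W\<in>D. opmat_mult (S W) (f W)
        in g \<in> felt ` closed_span \<and> sqrt (Re (rip g g)) \<le> sqrt (Re (rip f f))"
      unfolding \<xi>(2) mult \<eta>(2)[symmetric] Let_def using \<eta>(1) \<xi>(1)
      by (simp add: rip_felt cinner_self)
  qed
qed

text \<open>The two spaces are given abstractly, so only the reproducing property is used. For the
  sums \<open>fs\<close>, \<open>es\<close> of kernel elements and \<open>g\<close> the product of
  \<open>S\<close> and \<open>fs\<close>, it gives \<open>ip g es = a\<close> with \<open>a\<close>
  the squared norm of \<open>fs\<close>, while \<open>g\<close> has squared norm at most
  \<open>a\<close>. Then \<open>0 \<le> ip (g - es) (g - es) \<le> a - 2 a + b\<close> yields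
  \<open>a \<le> b\<close>.\<close>

lemma contr_if_multiplier:
  fixes S :: "'v mat \<Rightarrow> ('u::chilbert, 'y::chilbert) cblop mat"
  assumes S: "graded D S"
    and mult: "contractive_multiplier s D (ker_ampl (ball_kernel Q)) (ker_ampl (ball_kernel Q)) S"
  shows "contr D (adjact S)"
  unfolding contr_def
proof (intro allI impI)
  fix Zs :: "'v mat list" and v :: "nat \<Rightarrow> nat \<Rightarrow> complex" and y :: "nat \<Rightarrow> nat \<Rightarrow> 'y"
  assume Zs: "set Zs \<subseteq> D"
  let ?l = "length Zs"
  let ?KU = "ker_ampl (ball_kernel Q) :: ('v, 'u) nc_ker" and ?KY = "ker_ampl (ball_kernel Q) :: ('v, 'y) nc_ker"
  have Zi: "Zs ! i \<in> D" if "i < ?l" for i using Zs that nth_mem by blast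
  obtain F' ip' F ip where rk': "nc_rkhs s D ?KU F' ip'" and rk: "nc_rkhs s D ?KY F ip"
    and M: "\<And>f. f \<in> F' \<Longrightarrow> (\<lambda>W\<in>D. opmat_mult (S W) (f W)) \<in> F"
    and M_le: "\<And>f. f \<in> F' \<Longrightarrow> sqrt (Re (ip (\<lambda>W\<in>D. opmat_mult (S W) (f W)) (\<lambda>W\<in>D. opmat_mult (S W) (f W)))) \<le> sqrt (Re (ip' f f))"
    using mult unfolding contractive_multiplier_def Let_def by blast
  have H': "hilbert_function_space D F' ip'" and H: "hilbert_function_space D F ip"
    using rk rk' unfolding nc_rkhs_def by auto
  define vv where "vv i = vec (dim_row (Zs ! i)) (v i)" for i
  define yv where "yv i = vec (dim_row (Zs ! i)) (y i)" for i
  define sv where "sv i = vec (dim_row (Zs ! i)) (adjact S (Zs ! i) (y i))" for i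
  define e where "e i = kernel_elt D ?KY (Zs ! i) (vv i) (yv i)" for i
  define f where "f i = kernel_elt D ?KU (Zs ! i) (vv i) (sv i)" for i
  have car: "vv i \<in> carrier_vec (dim_row (Zs ! i))" "yv i \<in> carrier_vec (dim_row (Zs ! i))"
    "sv i \<in> carrier_vec (dim_row (Zs ! i))" for i by (auto simp: vv_def yv_def sv_def)
  have phi_e: "e i = felt (phi (Zs ! i) (v i) (y i))" if "i < ?l" for i
    unfolding e_def kernel_elt_eq_felt[OF Zi[OF that] car(1,2)]
    by (rule arg_cong[where f=felt], rule phi_cong) (auto simp: vv_def yv_def)
  have phi_f: "f i = felt (phi (Zs ! i) (v i) (adjact S (Zs ! i) (y i)))" if "i < ?l" for i
    unfolding f_def kernel_elt_eq_felt[OF Zi[OF that] car(1,3)]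
    by (rule arg_cong[where f=felt], rule phi_cong) (auto simp: vv_def sv_def)
  have eF: "e i \<in> F" and rep_e: "g \<in> F \<Longrightarrow> ip g (e i) = vec_cinner (opmat_apply (g (Zs ! i)) (conjugate (vv i))) (yv i)"
    if "i < ?l" for i g
    using rk Zi[OF that] car unfolding nc_rkhs_def e_def by auto
  have fF: "f i \<in> F'" and rep_f: "g \<in> F' \<Longrightarrow> ip' g (f i) = vec_cinner (opmat_apply (g (Zs ! i)) (conjugate (vv i))) (sv i)"
    if "i < ?l" for i g
    using rk' Zi[OF that] car unfolding nc_rkhs_def f_def by auto
  \<comment> \<open>Functions add only through \<open>fun_add D\<close>, so finite sums are obtained
    by induction, together with their inner products.\<close>
  have hfs_sum: "\<exists>t\<in>G. \<forall>k\<in>G. jp t k = (\<Sum>i<n. jp (u i) k) \<and> jp k t = (\<Sum>i<n. jp k (u i))"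
    if G: "hilbert_function_space D G jp" and u: "\<And>i. i < n \<Longrightarrow> u i \<in> G"
    for G :: "('v, 'z::chilbert) nc_fun set" and jp u and n :: nat
    using u
  proof (induction n)
    have ax: "fun_zero D \<in> G" "\<And>a b. a \<in> G \<Longrightarrow> b \<in> G \<Longrightarrow> jp a b = cnj (jp b a)"
      "\<And>c a b. a \<in> G \<Longrightarrow> b \<in> G \<Longrightarrow> jp (fun_scale D c a) b = c * jp a b"
      using G unfolding hilbert_function_space_def by blast+
    case 0
    have "fun_scale D 0 (fun_zero D) = (fun_zero D :: ('v, 'z) nc_fun)"
      unfolding fun_scale_def fun_zero_def
      by (intro restrict_ext eq_matI) (auto intro!: cblop_eqI simp: op_scale.rep_eq zero_cblop.rep_eq scaleC_zero_left)
    hence "jp (fun_zero D) k = 0" if "k \<in> G" for k using ax(3)[OF ax(1) that, of 0] by simp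
    hence "jp (fun_zero D) k = 0 \<and> jp k (fun_zero D) = 0" if "k \<in> G" for k
      using ax(2)[OF that ax(1)] that by simp
    thus ?case using ax(1) by auto
  next
    case (Suc n)
    have ax: "\<And>a b. a \<in> G \<Longrightarrow> b \<in> G \<Longrightarrow> fun_add D a b \<in> G" "\<And>a b. a \<in> G \<Longrightarrow> b \<in> G \<Longrightarrow> jp a b = cnj (jp b a)"
      "\<And>a b c. a \<in> G \<Longrightarrow> b \<in> G \<Longrightarrow> c \<in> G \<Longrightarrow> jp (fun_add D a b) c = jp a c + jp b c"
      using G unfolding hilbert_function_space_def by blast+
    obtain t where t: "t \<in> G" "\<And>k. k \<in> G \<Longrightarrow> jp t k = (\<Sum>i<n. jp (u i) k)" "\<And>k. k \<in> G \<Longrightarrow> jp k t = (\<Sum>i<n. jp k (u i))"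
      using Suc by auto
    have un: "u n \<in> G" using Suc.prems by simp
    have 1: "jp (fun_add D t (u n)) k = (\<Sum>i<Suc n. jp (u i) k)" if "k \<in> G" for k
      using ax(3)[OF t(1) un that] t(2)[OF that] by simp
    have 2: "jp k (fun_add D t (u n)) = (\<Sum>i<Suc n. jp k (u i))" if "k \<in> G" for k
    proof -
      have "jp k (fun_add D t (u n)) = cnj (\<Sum>i<Suc n. jp (u i) k)"
        using ax(2)[OF that ax(1)[OF t(1) un]] 1[OF that] by simp
      also have "\<dots> = (\<Sum>i<Suc n. jp k (u i))"
        unfolding cnj_sum using Suc.prems ax(2)[OF that] by (intro sum.cong refl) auto
      finally show ?thesis .
    qed
    show ?case using ax(1)[OF t(1) un] 1 2 by blast
  qed
  obtain fs where fs: "fs \<in> F'" "\<And>k. k \<in> F' \<Longrightarrow> ip' fs k = (\<Sum>i<?l. ip' (f i) k)" "\<And>k. k \<in> F' \<Longrightarrow> ip' k fs = (\<Sum>i<?l. ip' k (f i))"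
    using hfs_sum[OF H', of ?l f] fF by blast
  obtain es where es: "es \<in> F" "\<And>k. k \<in> F \<Longrightarrow> ip es k = (\<Sum>i<?l. ip (e i) k)" "\<And>k. k \<in> F \<Longrightarrow> ip k es = (\<Sum>i<?l. ip k (e i))"
    using hfs_sum[OF H, of ?l e] eF by blast
  define g where "g = (\<lambda>W\<in>D. opmat_mult (S W) (fs W))"
  have gF: "g \<in> F" unfolding g_def by (rule M[OF fs(1)])
  define a where "a = (norm (\<Sum>i<?l. phi (Zs ! i) (v i) (adjact S (Zs ! i) (y i))))\<^sup>2"
  define b where "b = (norm (\<Sum>i<?l. phi (Zs ! i) (v i) (y i)))\<^sup>2"
  have ff: "ip' (f i) (f j) = cinner (phi (Zs ! i) (v i) (adjact S (Zs ! i) (y i))) (phi (Zs ! j) (v j) (adjact S (Zs ! j) (y j)))"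
    if ij: "i < ?l" "j < ?l" for i j
  proof -
    have "ip' (f i) (f j) = cinner (phi (Zs ! i) (v i) (adjact S (Zs ! i) (y i))) (phi (Zs ! j) (\<lambda>q. vv j $ q) (\<lambda>q. sv j $ q))"
      by (subst rep_f[OF ij(2) fF[OF ij(1)]], subst phi_f[OF ij(1)]) (rule felt_reproducing[OF Zi[OF ij(2)] car(1,3)])
    also have "phi (Zs ! j) (\<lambda>q. vv j $ q) (\<lambda>q. sv j $ q) = phi (Zs ! j) (v j) (adjact S (Zs ! j) (y j))"
      by (rule phi_cong) (auto simp: vv_def sv_def)
    finally show ?thesis .
  qed
  have ee: "ip (e i) (e j) = cinner (phi (Zs ! i) (v i) (y i)) (phi (Zs ! j) (v j) (y j))"
    if ij: "i < ?l" "j < ?l" for i j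
  proof -
    have "ip (e i) (e j) = cinner (phi (Zs ! i) (v i) (y i)) (phi (Zs ! j) (\<lambda>q. vv j $ q) (\<lambda>q. yv j $ q))"
      by (subst rep_e[OF ij(2) eF[OF ij(1)]], subst phi_e[OF ij(1)]) (rule felt_reproducing[OF Zi[OF ij(2)] car(1,2)])
    also have "phi (Zs ! j) (\<lambda>q. vv j $ q) (\<lambda>q. yv j $ q) = phi (Zs ! j) (v j) (y j)"
      by (rule phi_cong) (auto simp: vv_def yv_def)
    finally show ?thesis .
  qed
  have fsfs: "ip' fs fs = of_real a"
    using fs fF unfolding a_def cinner_self[symmetric] cinner_sum_left unfolding cinner_sum_right
    by (simp add: ff) (rule sum.swap)
  have eses: "ip es es = of_real b"
    using es eF unfolding b_def cinner_self[symmetric] cinner_sum_left unfolding cinner_sum_right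
    by (simp add: ee) (rule sum.swap)
  have ge: "ip g (e i) = ip' fs (f i)" if i: "i < ?l" for i
  proof -
    have gr: "graded D fs" using rk' fs(1) unfolding nc_rkhs_def nc_function_def by blast
    have dv: "dim_vec (conjugate (vv i)) = dim_row (Zs ! i)" by (simp add: vv_def)
    note SZ = graded_carrier[OF S Zi[OF i]] and fZ = graded_carrier[OF gr Zi[OF i]]
    have "ip g (e i) = vec_cinner (opmat_apply (S (Zs ! i)) (opmat_apply (fs (Zs ! i)) (conjugate (vv i)))) (yv i)"
      unfolding rep_e[OF i gF] using Zi[OF i] by (simp add: g_def opmat_apply_mult[OF SZ fZ dv])
    also have "\<dots> = (\<Sum>b<dim_row (Zs ! i). cinner (opmat_apply (fs (Zs ! i)) (conjugate (vv i)) $ b) (adjact S (Zs ! i) (\<lambda>q. yv i $ q) b))"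
      by (rule vec_cinner_opmat_apply[of S "Zs ! i", OF SZ]) (use fZ in simp)
    also have "\<dots> = vec_cinner (opmat_apply (fs (Zs ! i)) (conjugate (vv i))) (sv i)"
      unfolding vec_cinner_def using fZ by (simp add: sv_def adjact_def yv_def)
    finally show ?thesis unfolding rep_f[OF i fs(1)] .
  qed
  have ges: "ip g es = of_real a" using es(3)[OF gF] ge fs(3)[OF fs(1)] fsfs by simp
  have gg: "Re (ip g g) \<le> a" using M_le[OF fs(1)] unfolding g_def[symmetric] fsfs by simp
  have ax: "\<And>a b. a \<in> F \<Longrightarrow> b \<in> F \<Longrightarrow> fun_add D a b \<in> F" "\<And>a b. a \<in> F \<Longrightarrow> b \<in> F \<Longrightarrow> ip a b = cnj (ip b a)"
    "\<And>a b c. a \<in> F \<Longrightarrow> b \<in> F \<Longrightarrow> c \<in> F \<Longrightarrow> ip (fun_add D a b) c = ip a c + ip b c"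
    "\<And>c a. a \<in> F \<Longrightarrow> fun_scale D c a \<in> F"
    "\<And>c a b. a \<in> F \<Longrightarrow> b \<in> F \<Longrightarrow> ip (fun_scale D c a) b = c * ip a b" "\<And>a. a \<in> F \<Longrightarrow> ip a a \<in> \<real>\<^sub>\<ge>\<^sub>0"
    using H unfolding hilbert_function_space_def by blast+
  define m where "m = fun_scale D (- 1) es"
  have mF: "m \<in> F" unfolding m_def by (intro ax es(1))
  have esg: "ip es g = of_real a" using ax(2)[OF es(1) gF] ges by simp
  have m1: "ip m k = - ip es k" if "k \<in> F" for k unfolding m_def using ax(5)[OF es(1) that] by simp
  have m2: "ip k m = - ip k es" if "k \<in> F" for k
    using ax(2)[OF that mF] ax(2)[OF that es(1)] m1[OF that] by simp
  let ?h = "fun_add D g m"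
  have hF: "?h \<in> F" by (intro ax gF mF)
  have k: "ip k ?h = ip k g - ip k es" if "k \<in> F" for k
    using ax(2)[OF that hF] ax(3)[OF gF mF that] m1[OF that] ax(2)[OF that gF] ax(2)[OF that es(1)] by simp
  have "ip ?h ?h = (ip g g - ip g es) - (ip es g - ip es es)"
    using ax(3)[OF gF mF hF] m1[OF hF] k[OF gF] k[OF es(1)] by simp
  hence "0 \<le> Re (ip g g) - a - (a - b)"
    using ax(6)[OF hF] unfolding ges esg eses by (simp add: nonneg_Reals_iff)
  hence "a \<le> b" using gg by linarith
  thus "norm (\<Sum>i<?l. phi (Zs ! i) (v i) (adjact S (Zs ! i) (y i))) \<le> norm (\<Sum>i<?l. phi (Zs ! i) (v i) (y i))"
    unfolding a_def b_def by (rule power2_le_imp_le) simp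
qed

section \<open>Transfer functions\<close>

lemma ev_expand: "ev Q W v y w = (\<Sum>j<dim_row W. scaleC (ev Q W v (unit_fun j) w) (y j))"
proof -
  have "ev Q W v y w = (\<Sum>p<dim_row W. \<Sum>j<dim_row W. scaleC (v p * Lact Q W w (unit_fun j) p) (y j))"
    unfolding ev_def by (intro sum.cong refl) (simp add: Lact_expand[of _ W w y] scaleC_sum_right scaleC_scaleC)
  also have "\<dots> = (\<Sum>j<dim_row W. \<Sum>p<dim_row W. scaleC (v p * Lact Q W w (unit_fun j) p) (y j))"
    by (rule sum.swap)
  finally show ?thesis by (simp add: ev_def scaleC_sum_left scaleC_complex_def)
qed

lemma Qst_diff: "Qst Q W b (\<lambda>l. H l - H' l) j = Qst Q W b H j - Qst Q W b H' j"
  by (simp add: Qst_def scaleC_diff_right sum_subtractf)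

text \<open>The bound over finite sets of letters passes to all letters, which \<open>vell2\<close>
  gathers into one vector.\<close>

lemma Qst_vell2_bound:
  assumes W: "W \<in> D"
  shows "(\<Sum>j<dim_row W. (norm (vell2 (\<lambda>b. Qst Q W b H j)))\<^sup>2)
    \<le> (opmat_norm (Q W))\<^sup>2 * (\<Sum>l<dim_row W. (norm (H l))\<^sup>2)"
proof -
  have s: "(\<lambda>b. (norm (Qst Q W b H j))\<^sup>2) summable_on UNIV" if "j < dim_row W" for j
    using Qst_sq_sum[OF W that] unfolding sq_sum_def .
  have hs: "((\<lambda>b. \<Sum>j<dim_row W. (norm (Qst Q W b H j))\<^sup>2) has_sum (\<Sum>j<dim_row W. (norm (vell2 (\<lambda>b. Qst Q W b H j)))\<^sup>2)) UNIV"
  proof -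
    have "((\<lambda>b. \<Sum>j\<in>J. (norm (Qst Q W b H j))\<^sup>2) has_sum (\<Sum>j\<in>J. (norm (vell2 (\<lambda>b. Qst Q W b H j)))\<^sup>2)) UNIV"
      if "J \<subseteq> {..<dim_row W}" for J
    proof -
      have "finite J" using that finite_subset by blast
      thus ?thesis using that
      proof (induction J)
        case (insert j J)
        hence j: "j < dim_row W" by simp
        have "((\<lambda>b. (norm (Qst Q W b H j))\<^sup>2) has_sum (norm (vell2 (\<lambda>b. Qst Q W b H j)))\<^sup>2) UNIV"
          using s[OF j] has_sum_infsum by (simp add: norm_vell2 Qst_sq_sum[OF W j])
        from has_sum_add[OF this insert.IH] insert show ?case by simp
      qed simp
    qed
    thus ?thesis by blast
  qed
  show ?thesis by (rule has_sum_le_finite_sums[OF hs]) (rule Qst_bound[OF W])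
qed

lemma Qst_vell2_diff:
  assumes "W \<in> D" "j < dim_row W"
  shows "vell2 (\<lambda>b. Qst Q W b (\<lambda>l. H l - H' l) j) = vell2 (\<lambda>b. Qst Q W b H j) - vell2 (\<lambda>b. Qst Q W b H' j)"
  unfolding Qst_diff by (intro vell2_diff Qst_sq_sum assms)

text \<open>The state space equations of the transfer function with colligation \<open>V\<close>, in adjoint form:
  \<open>H(W)\<^sup>*y\<close> is the state and \<open>S(W)\<^sup>*y\<close> the output.\<close>

definition solves :: "('y::chilbert \<times> ('r \<Rightarrow> 'x::chilbert) ell2, 'u::chilbert \<times> 'x) cblop \<Rightarrow> 'v mat \<Rightarrow>
    (nat \<Rightarrow> 'y) \<Rightarrow> (nat \<Rightarrow> 'x) \<Rightarrow> (nat \<Rightarrow> 'u) \<Rightarrow> bool" where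
  "solves V W y H g \<longleftrightarrow> (\<forall>j<dim_row W. cblop_apply V (y j, vell2 (\<lambda>b. Qst Q W b H j)) = (g j, H j))"

definition contractive :: "('a::chilbert, 'b::chilbert) cblop \<Rightarrow> bool" where
  "contractive V \<longleftrightarrow> (\<forall>x. norm (cblop_apply V x) \<le> norm x)"

lemma contractive_sq: "contractive V \<Longrightarrow> cblop_apply V (a, x) = (g, h) \<Longrightarrow> (norm g)\<^sup>2 + (norm h)\<^sup>2 \<le> (norm a)\<^sup>2 + (norm x)\<^sup>2"
  unfolding norm_sq_Pair[symmetric] contractive_def by (metis norm_ge_zero power_mono)

lemma contractive_sq_zero:
  assumes "contractive V" "cblop_apply V (0, x) = (g, h)"
  shows "(norm h)\<^sup>2 \<le> (norm x)\<^sup>2"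
proof -
  have "(norm h)\<^sup>2 \<le> (norm g)\<^sup>2 + (norm h)\<^sup>2" by simp
  also have "\<dots> \<le> (norm x)\<^sup>2" using contractive_sq[OF assms] by simp
  finally show ?thesis .
qed

text \<open>\<open>V\<close> is contractive, so the squared norm of the difference of two states is
  at most \<open>r\<close> times itself, with \<open>r < 1\<close>. Only the first
  \<open>dim_row W\<close> values of the inputs are compared.\<close>

lemma solves_unique:
  assumes V: "contractive V" and W: "W \<in> D" and sol: "solves V W y H g" "solves V W y' H' g'"
    and yy: "\<And>j. j < dim_row W \<Longrightarrow> y j = y' j" and j: "j < dim_row W"
  shows "H j = H' j \<and> g j = g' j"
proof -
  define r where "r = (opmat_norm (Q W))\<^sup>2"
  define d where "d l = H l - H' l" for l
  have "(norm (d j))\<^sup>2 \<le> (norm (vell2 (\<lambda>b. Qst Q W b d j)))\<^sup>2" if j: "j < dim_row W" for j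
  proof -
    have "cblop_apply V ((y j, vell2 (\<lambda>b. Qst Q W b H j)) - (y' j, vell2 (\<lambda>b. Qst Q W b H' j))) = (g j, H j) - (g' j, H' j)"
      unfolding cblop_diff using sol j unfolding solves_def by simp
    hence "cblop_apply V (0, vell2 (\<lambda>b. Qst Q W b d j)) = (g j - g' j, d j)"
      unfolding d_def Qst_vell2_diff[OF W j] using yy[OF j] by simp
    from contractive_sq_zero[OF V this] show ?thesis .
  qed
  hence "(\<Sum>l<dim_row W. (norm (d l))\<^sup>2) \<le> (\<Sum>l<dim_row W. (norm (vell2 (\<lambda>b. Qst Q W b d l)))\<^sup>2)"
    by (intro sum_mono) auto
  also have "\<dots> \<le> r * (\<Sum>l<dim_row W. (norm (d l))\<^sup>2)" unfolding r_def by (rule Qst_vell2_bound[OF W])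
  finally have "(1 - r) * (\<Sum>l<dim_row W. (norm (d l))\<^sup>2) \<le> 0" by (simp add: left_diff_distrib)
  hence "(\<Sum>l<dim_row W. (norm (d l))\<^sup>2) \<le> 0"
    using norm_Q_less[OF W] unfolding r_def[symmetric] by (simp add: mult_le_0_iff)
  moreover have "0 \<le> (\<Sum>l<dim_row W. (norm (d l))\<^sup>2)" by (intro sum_nonneg) auto
  ultimately have "(\<Sum>l<dim_row W. (norm (d l))\<^sup>2) = 0" by simp
  hence "d l = 0" if "l < dim_row W" for l
    using that by (subst (asm) sum_nonneg_eq_0_iff) auto
  hence HH: "H l = H' l" if "l < dim_row W" for l using that by (simp add: d_def)
  have "Qst Q W b H j = Qst Q W b H' j" for b using Qst_cong[of W H H' Q b] HH by simp
  hence "vell2 (\<lambda>b. Qst Q W b H j) = vell2 (\<lambda>b. Qst Q W b H' j)" by simp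
  moreover have "(g j, H j) = cblop_apply V (y j, vell2 (\<lambda>b. Qst Q W b H j))" using sol(1) j unfolding solves_def by simp
  moreover have "(g' j, H' j) = cblop_apply V (y' j, vell2 (\<lambda>b. Qst Q W b H' j))" using sol(2) j unfolding solves_def by simp
  ultimately have "(g j, H j) = (g' j, H' j)" using yy[OF j] by simp
  thus ?thesis by simp
qed

text \<open>Banach iteration for the state component, restricted to the coordinates below
  \<open>dim_row W\<close>; the output is read off from the fixed point.\<close>

lemma solves_exists:
  assumes V: "contractive V" and W: "W \<in> D"
  shows "\<exists>H g. solves V W y H g"
proof -
  let ?m = "dim_row W"
  define r where "r = opmat_norm (Q W)"
  have r: "0 \<le> r" "r < 1" using W opmat_norm_nonneg by (auto simp: r_def nc_ball_def)
  define \<Phi> where "\<Phi> H j = snd (cblop_apply V (y j, vell2 (\<lambda>b. Qst Q W b H j)))" for H j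
  have step: "(\<Sum>j<?m. (norm (\<Phi> H j - \<Phi> H' j))\<^sup>2) \<le> r\<^sup>2 * (\<Sum>l<?m. (norm (H l - H' l))\<^sup>2)" for H H'
  proof -
    have "(norm (\<Phi> H j - \<Phi> H' j))\<^sup>2 \<le> (norm (vell2 (\<lambda>b. Qst Q W b (\<lambda>l. H l - H' l) j)))\<^sup>2" if j: "j < ?m" for j
    proof -
      obtain p q p' q' where pq: "cblop_apply V (y j, vell2 (\<lambda>b. Qst Q W b H j)) = (p, q)"
        "cblop_apply V (y j, vell2 (\<lambda>b. Qst Q W b H' j)) = (p', q')" by (metis surj_pair)
      have "cblop_apply V ((y j, vell2 (\<lambda>b. Qst Q W b H j)) - (y j, vell2 (\<lambda>b. Qst Q W b H' j))) = (p - p', q - q')"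
        unfolding cblop_diff pq by simp
      hence "cblop_apply V (0, vell2 (\<lambda>b. Qst Q W b (\<lambda>l. H l - H' l) j)) = (p - p', q - q')"
        by (simp add: Qst_vell2_diff[OF W j])
      from contractive_sq_zero[OF V this] show ?thesis unfolding \<Phi>_def pq by simp
    qed
    hence "(\<Sum>j<?m. (norm (\<Phi> H j - \<Phi> H' j))\<^sup>2) \<le> (\<Sum>j<?m. (norm (vell2 (\<lambda>b. Qst Q W b (\<lambda>l. H l - H' l) j)))\<^sup>2)"
      by (intro sum_mono) auto
    also have "\<dots> \<le> r\<^sup>2 * (\<Sum>l<?m. (norm (H l - H' l))\<^sup>2)" unfolding r_def by (rule Qst_vell2_bound[OF W])
    finally show ?thesis .
  qed
  define X where "X n = (\<Phi> ^^ n) (\<lambda>_. 0)" for n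
  have X_Suc: "X (Suc n) = \<Phi> (X n)" for n by (simp add: X_def)
  define N where "N = (\<Sum>j<?m. (norm (X 1 j - X 0 j))\<^sup>2)"
  have N0: "0 \<le> N" unfolding N_def by (intro sum_nonneg) auto
  have geo: "(\<Sum>j<?m. (norm (X (Suc n) j - X n j))\<^sup>2) \<le> (r\<^sup>2) ^ n * N" for n
  proof (induction n)
    case (Suc n)
    have "(\<Sum>j<?m. (norm (X (Suc (Suc n)) j - X (Suc n) j))\<^sup>2) \<le> r\<^sup>2 * (\<Sum>j<?m. (norm (X (Suc n) j - X n j))\<^sup>2)"
      unfolding X_Suc[of "Suc n"] X_Suc[of n] by (rule step)
    also have "\<dots> \<le> r\<^sup>2 * ((r\<^sup>2) ^ n * N)" by (intro mult_left_mono Suc) auto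
    finally show ?case by (simp add: mult.assoc)
  qed (simp add: N_def)
  have conv: "\<exists>L. (\<lambda>n. X n j) \<longlonglongrightarrow> L" if j: "j < ?m" for j
  proof -
    have le: "norm (X (Suc n) j - X n j) \<le> r ^ n * sqrt N" for n
    proof (rule power2_le_imp_le)
      have "(norm (X (Suc n) j - X n j))\<^sup>2 \<le> (\<Sum>j<?m. (norm (X (Suc n) j - X n j))\<^sup>2)"
        using j by (intro member_le_sum) auto
      also have "\<dots> \<le> (r\<^sup>2) ^ n * N" by (rule geo)
      also have "(r\<^sup>2) ^ n * N = (r ^ n * sqrt N)\<^sup>2"
        using N0 by (simp add: power_mult_distrib power_mult[symmetric] mult.commute)
      finally show "(norm (X (Suc n) j - X n j))\<^sup>2 \<le> (r ^ n * sqrt N)\<^sup>2" .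
    qed (use r N0 in simp)
    have "summable (\<lambda>n. r ^ n * sqrt N)" using r by (intro summable_mult2 summable_geometric) simp
    hence "summable (\<lambda>n. X (Suc n) j - X n j)" by (rule summable_comparison_test') (rule le)
    hence "(\<lambda>n. \<Sum>k<n. X (Suc k) j - X k j) \<longlonglongrightarrow> (\<Sum>k. X (Suc k) j - X k j)" by (rule summable_LIMSEQ)
    moreover have "(\<Sum>k<n. X (Suc k) j - X k j) = X n j" for n
      by (subst sum_lessThan_telescope) (simp add: X_def)
    ultimately show ?thesis by auto
  qed
  define L where "L j = lim (\<lambda>n. X n j)" for j
  have L: "(\<lambda>n. X n j) \<longlonglongrightarrow> L j" if "j < ?m" for j
    using conv[OF that] unfolding L_def by (simp add: convergent_LIMSEQ_iff convergent_def[symmetric])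
  have fixpt: "\<Phi> L j = L j" if j: "j < ?m" for j
  proof (rule LIMSEQ_unique)
    show "(\<lambda>n. X (Suc n) j) \<longlonglongrightarrow> L j" using L[OF j] by (rule LIMSEQ_Suc)
    have lim0: "(\<lambda>n. r\<^sup>2 * (\<Sum>l<?m. (norm (X n l - L l))\<^sup>2)) \<longlonglongrightarrow> r\<^sup>2 * (\<Sum>l<?m. (norm (L l - L l))\<^sup>2)"
      by (intro tendsto_intros L) auto
    have "(\<lambda>n. (norm (X (Suc n) j - \<Phi> L j))\<^sup>2) \<longlonglongrightarrow> 0"
    proof (rule tendsto_sandwich[of "\<lambda>_. 0" _ _ "\<lambda>n. r\<^sup>2 * (\<Sum>l<?m. (norm (X n l - L l))\<^sup>2)"])
      have "(norm (X (Suc n) j - \<Phi> L j))\<^sup>2 \<le> r\<^sup>2 * (\<Sum>l<?m. (norm (X n l - L l))\<^sup>2)" for n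
      proof -
        have "(norm (X (Suc n) j - \<Phi> L j))\<^sup>2 \<le> (\<Sum>j<?m. (norm (\<Phi> (X n) j - \<Phi> L j))\<^sup>2)"
          unfolding X_Suc using j by (intro member_le_sum) auto
        also have "\<dots> \<le> r\<^sup>2 * (\<Sum>l<?m. (norm (X n l - L l))\<^sup>2)" by (rule step)
        finally show ?thesis .
      qed
      thus "\<forall>\<^sub>F n in sequentially. (norm (X (Suc n) j - \<Phi> L j))\<^sup>2 \<le> r\<^sup>2 * (\<Sum>l<?m. (norm (X n l - L l))\<^sup>2)" by simp
      show "(\<lambda>n. r\<^sup>2 * (\<Sum>l<?m. (norm (X n l - L l))\<^sup>2)) \<longlonglongrightarrow> 0" using lim0 by simp
    qed auto
    hence "(\<lambda>n. sqrt ((norm (X (Suc n) j - \<Phi> L j))\<^sup>2)) \<longlonglongrightarrow> sqrt 0" by (rule tendsto_real_sqrt)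
    hence "(\<lambda>n. X (Suc n) j - \<Phi> L j) \<longlonglongrightarrow> 0" by (simp add: tendsto_norm_zero_iff)
    thus "(\<lambda>n. X (Suc n) j) \<longlonglongrightarrow> \<Phi> L j" by (simp add: LIM_zero_iff)
  qed
  have "solves V W y L (\<lambda>j. fst (cblop_apply V (y j, vell2 (\<lambda>b. Qst Q W b L j))))"
    unfolding solves_def using fixpt unfolding \<Phi>_def by (metis prod.collapse)
  thus ?thesis by blast
qed

lemma solves_lincomb:
  assumes W: "W \<in> D" and F: "finite F" and sol: "\<And>i. i \<in> F \<Longrightarrow> solves V W (y i) (H i) (g i)"
  shows "solves V W (\<lambda>j. \<Sum>i\<in>F. scaleC (c i) (y i j)) (\<lambda>j. \<Sum>i\<in>F. scaleC (c i) (H i j)) (\<lambda>j. \<Sum>i\<in>F. scaleC (c i) (g i j))"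
  unfolding solves_def
proof (intro allI impI)
  fix j assume j: "j < dim_row W"
  have "vell2 (\<lambda>b. Qst Q W b (\<lambda>j. \<Sum>i\<in>F. scaleC (c i) (H i j)) j) = (\<Sum>i\<in>F. scaleC (c i) (vell2 (\<lambda>b. Qst Q W b (H i) j)))"
    unfolding Qst_lincomb by (intro vell2_lincomb F Qst_sq_sum W j)
  hence "cblop_apply V (\<Sum>i\<in>F. scaleC (c i) (y i j), vell2 (\<lambda>b. Qst Q W b (\<lambda>j. \<Sum>i\<in>F. scaleC (c i) (H i j)) j))
      = (\<Sum>i\<in>F. scaleC (c i) (cblop_apply V (y i j, vell2 (\<lambda>b. Qst Q W b (H i) j))))"
    by (simp add: sum_Pair[symmetric] scaleC_Pair[symmetric] cblop_sum cblop_scale)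
  also have "\<dots> = (\<Sum>i\<in>F. scaleC (c i) (g i j, H i j))"
    using sol j unfolding solves_def by (intro sum.cong refl) auto
  finally show "cblop_apply V (\<Sum>i\<in>F. scaleC (c i) (y i j), vell2 (\<lambda>b. Qst Q W b (\<lambda>j. \<Sum>i\<in>F. scaleC (c i) (H i j)) j))
      = (\<Sum>i\<in>F. scaleC (c i) (g i j), \<Sum>i\<in>F. scaleC (c i) (H i j))"
    by (simp add: sum_Pair scaleC_Pair)
qed

text \<open>\<open>V\<close> acts on each coordinate separately while the adjoint of
  \<open>A\<close> mixes coordinates and commutes with the letters. Together with uniqueness this
  gives the nc property of the transfer function.\<close>

lemma solves_astar:
  assumes Z: "Z \<in> D" and W: "W \<in> D" and A: "A \<in> carrier_mat (dim_row W) (dim_row Z)" "lmult s A Z = rmult s W A"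
    and sol: "solves V W y H g"
  shows "solves V Z (astar A y) (astar A H) (astar A g)"
  unfolding solves_def
proof (intro allI impI)
  fix j assume j: "j < dim_row Z"
  have dA: "dim_row A = dim_row W" using A by simp
  have "vell2 (\<lambda>b. Qst Q Z b (astar A H) j) = vell2 (\<lambda>b. \<Sum>i<dim_row W. scaleC (cnj (A $$ (i, j))) (Qst Q W b H i))"
    by (simp add: astar_Qst[OF D_Xi[OF Z] D_Xi[OF W] A j]) (simp add: astar_def dA)
  also have "\<dots> = (\<Sum>i<dim_row W. scaleC (cnj (A $$ (i, j))) (vell2 (\<lambda>b. Qst Q W b H i)))"
    by (intro vell2_lincomb) (auto intro: Qst_sq_sum[OF W])
  finally have "cblop_apply V (astar A y j, vell2 (\<lambda>b. Qst Q Z b (astar A H) j))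
      = (\<Sum>i<dim_row W. scaleC (cnj (A $$ (i, j))) (cblop_apply V (y i, vell2 (\<lambda>b. Qst Q W b H i))))"
    by (simp add: astar_def dA sum_Pair[symmetric] scaleC_Pair[symmetric] cblop_sum cblop_scale)
  also have "\<dots> = (\<Sum>i<dim_row W. scaleC (cnj (A $$ (i, j))) (g i, H i))"
    using sol unfolding solves_def by (intro sum.cong refl) auto
  finally show "cblop_apply V (astar A y j, vell2 (\<lambda>b. Qst Q Z b (astar A H) j)) = (astar A g j, astar A H j)"
    by (simp add: astar_def dA sum_Pair scaleC_Pair)
qed

text \<open>In the energy inequality for \<open>V\<close> the state on the input side is damped by
  the norm of \<open>Q W\<close>, so it is dominated by the state on the output side.\<close>

lemma solves_norm:
  assumes V: "contractive V" and W: "W \<in> D" and sol: "solves V W y H g"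
  shows "(\<Sum>j<dim_row W. (norm (g j))\<^sup>2) \<le> (\<Sum>j<dim_row W. (norm (y j))\<^sup>2)"
proof -
  have "(\<Sum>j<dim_row W. (norm (g j))\<^sup>2 + (norm (H j))\<^sup>2) \<le> (\<Sum>j<dim_row W. (norm (y j))\<^sup>2 + (norm (vell2 (\<lambda>b. Qst Q W b H j)))\<^sup>2)"
    using sol unfolding solves_def by (intro sum_mono contractive_sq[OF V]) auto
  moreover have "(opmat_norm (Q W))\<^sup>2 * (\<Sum>l<dim_row W. (norm (H l))\<^sup>2) \<le> 1 * (\<Sum>l<dim_row W. (norm (H l))\<^sup>2)"
    using norm_Q_less[OF W] by (intro mult_right_mono sum_nonneg) auto
  ultimately show ?thesis using Qst_vell2_bound[OF W, of H] by (simp add: sum.distrib)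
qed

text \<open>For each word \<open>w\<close>, \<open>V\<close> maps \<open>Y w\<close> together with
  all \<open>X (w @ [b])\<close> to \<open>(S w, X w)\<close>. Summed over \<open>w\<close>, the
  states on the input side run over the nonempty words and those on the output side over all words.
  They cancel up to the nonnegative term at the empty word, leaving the inequality for
  \<open>S\<close> and \<open>Y\<close>.\<close>

lemma contr_solves:
  fixes \<sigma> :: "'v mat \<Rightarrow> (nat \<Rightarrow> 'y::chilbert) \<Rightarrow> nat \<Rightarrow> 'u::chilbert"
    and V :: "('y \<times> ('r \<Rightarrow> 'x::chilbert) ell2, 'u \<times> 'x) cblop"
  assumes V: "contractive V" and sol: "\<And>W y. W \<in> D \<Longrightarrow> \<exists>H. solves V W y H (\<sigma> W y)"
  shows "contr D \<sigma>"
  unfolding contr_def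
proof (intro allI impI)
  fix Zs :: "'v mat list" and v :: "nat \<Rightarrow> nat \<Rightarrow> complex" and y :: "nat \<Rightarrow> nat \<Rightarrow> 'y"
  assume Zs: "set Zs \<subseteq> D"
  let ?l = "length Zs"
  have Zi: "Zs ! i \<in> D" if "i < ?l" for i using Zs that nth_mem by blast
  have "\<forall>i. \<exists>H. i < ?l \<longrightarrow> solves V (Zs ! i) (y i) H (\<sigma> (Zs ! i) (y i))" using sol Zi by blast
  then obtain H where H: "\<And>i. i < ?l \<Longrightarrow> solves V (Zs ! i) (y i) (H i) (\<sigma> (Zs ! i) (y i))" by metis
  define E where "E i j w = ev Q (Zs ! i) (v i) (unit_fun j) w" for i j w
  define Y where "Y w = (\<Sum>i<?l. ev Q (Zs ! i) (v i) (y i) w)" for w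
  define S where "S w = (\<Sum>i<?l. ev Q (Zs ! i) (v i) (\<sigma> (Zs ! i) (y i)) w)" for w
  define X where "X w = (\<Sum>i<?l. ev Q (Zs ! i) (v i) (H i) w)" for w
  have sq: "sq_sum Y" "sq_sum S" "sq_sum X"
    unfolding Y_def S_def X_def by (intro sq_sum_sum sq_sum_ev Zi, simp)+
  have X_snoc: "X (w @ [b]) = (\<Sum>i<?l. \<Sum>j<dim_row (Zs ! i). scaleC (E i j w) (Qst Q (Zs ! i) b (H i) j))" for w b
    unfolding X_def ev_snoc E_def by (intro sum.cong refl) (rule ev_expand)
  have inX: "(\<lambda>b. (norm (X (w @ [b])))\<^sup>2) summable_on UNIV" for w
    using infsum_split(1)[OF _ inj_snoc_split, of "\<lambda>w. (norm (X w))\<^sup>2" w] sq(3) unfolding sq_sum_def by simp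
  have key: "(norm (S w))\<^sup>2 + (norm (X w))\<^sup>2 \<le> (norm (Y w))\<^sup>2 + (\<Sum>\<^sub>\<infinity>b. (norm (X (w @ [b])))\<^sup>2)" for w
  proof -
    have sX: "sq_sum (\<lambda>b. X (w @ [b]))" using inX[of w] unfolding sq_sum_def .
    have "vell2 (\<lambda>b. X (w @ [b]))
        = vell2 (\<lambda>b. \<Sum>i<?l. scaleC 1 (\<Sum>j<dim_row (Zs ! i). scaleC (E i j w) (Qst Q (Zs ! i) b (H i) j)))"
      by (simp add: X_snoc scaleC_one)
    also have "\<dots> = (\<Sum>i<?l. scaleC 1 (vell2 (\<lambda>b. \<Sum>j<dim_row (Zs ! i). scaleC (E i j w) (Qst Q (Zs ! i) b (H i) j))))"
      by (intro vell2_lincomb sq_sum_lincomb) (auto intro: Qst_sq_sum Zi)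
    also have "\<dots> = (\<Sum>i<?l. \<Sum>j<dim_row (Zs ! i). scaleC (E i j w) (vell2 (\<lambda>b. Qst Q (Zs ! i) b (H i) j)))"
      unfolding scaleC_one by (intro sum.cong refl vell2_lincomb) (auto intro: Qst_sq_sum Zi)
    finally have "cblop_apply V (Y w, vell2 (\<lambda>b. X (w @ [b])))
        = (\<Sum>i<?l. \<Sum>j<dim_row (Zs ! i). scaleC (E i j w) (cblop_apply V (y i j, vell2 (\<lambda>b. Qst Q (Zs ! i) b (H i) j))))"
      by (simp add: Y_def ev_expand[of _ _ "y _"] E_def[symmetric] sum_Pair[symmetric] scaleC_Pair[symmetric] cblop_sum cblop_scale)
    also have "\<dots> = (\<Sum>i<?l. \<Sum>j<dim_row (Zs ! i). scaleC (E i j w) (\<sigma> (Zs ! i) (y i) j, H i j))"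
      using H unfolding solves_def by (intro sum.cong refl) auto
    also have "\<dots> = (S w, X w)"
      by (simp add: S_def X_def ev_expand[of _ _ "\<sigma> _ _"] ev_expand[of _ _ "H _"] E_def[symmetric] sum_Pair scaleC_Pair)
    finally have "cblop_apply V (Y w, vell2 (\<lambda>b. X (w @ [b]))) = (S w, X w)" .
    from contractive_sq[OF V this] show ?thesis by (simp add: norm_vell2[OF sX])
  qed
  have sums: "(\<lambda>w. (norm (S w))\<^sup>2) summable_on UNIV" "(\<lambda>w. (norm (X w))\<^sup>2) summable_on UNIV" "(\<lambda>w. (norm (Y w))\<^sup>2) summable_on UNIV"
    using sq unfolding sq_sum_def by auto
  have out: "(\<lambda>w. \<Sum>\<^sub>\<infinity>b. (norm (X (w @ [b])))\<^sup>2) summable_on UNIV"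
    using infsum_split(2)[OF sums(2) inj_snoc_split] by simp
  have tot: "(\<Sum>\<^sub>\<infinity>w. (norm (X w))\<^sup>2) = (norm (X []))\<^sup>2 + (\<Sum>\<^sub>\<infinity>w. \<Sum>\<^sub>\<infinity>b. (norm (X (w @ [b])))\<^sup>2)"
    using infsum_split(3)[OF sums(2) inj_snoc_split] by simp
  have "(\<Sum>\<^sub>\<infinity>w. (norm (S w))\<^sup>2) + (\<Sum>\<^sub>\<infinity>w. (norm (X w))\<^sup>2) = (\<Sum>\<^sub>\<infinity>w. (norm (S w))\<^sup>2 + (norm (X w))\<^sup>2)"
    by (rule infsum_add[symmetric]) (intro sums)+
  also have "\<dots> \<le> (\<Sum>\<^sub>\<infinity>w. (norm (Y w))\<^sup>2 + (\<Sum>\<^sub>\<infinity>b. (norm (X (w @ [b])))\<^sup>2))"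
    by (intro infsum_mono summable_on_add sums out key)
  also have "\<dots> = (\<Sum>\<^sub>\<infinity>w. (norm (Y w))\<^sup>2) + (\<Sum>\<^sub>\<infinity>w. \<Sum>\<^sub>\<infinity>b. (norm (X (w @ [b])))\<^sup>2)"
    by (intro infsum_add sums out)
  finally have "(\<Sum>\<^sub>\<infinity>w. (norm (S w))\<^sup>2) \<le> (\<Sum>\<^sub>\<infinity>w. (norm (Y w))\<^sup>2)"
    unfolding tot using zero_le_power2[of "norm (X [])"] by linarith
  hence le: "(norm (vell2 S))\<^sup>2 \<le> (norm (vell2 Y))\<^sup>2" by (simp add: norm_vell2 sq)
  have vsum: "vell2 (\<lambda>w. \<Sum>i<?l. ev Q (Zs ! i) (v i) (z i) w) = (\<Sum>i<?l. phi (Zs ! i) (v i) (z i))" for z :: "nat \<Rightarrow> nat \<Rightarrow> 'z::chilbert"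
  proof -
    have "sq_sum (ev Q (Zs ! i) (v i) (z i))" if "i \<in> {..<?l}" for i
      using that by (intro sq_sum_ev Zi) simp
    from vell2_lincomb[OF finite_lessThan this, where c="\<lambda>_. 1"] show ?thesis by (simp add: scaleC_one phi_def)
  qed
  show "norm (\<Sum>i<?l. phi (Zs ! i) (v i) (\<sigma> (Zs ! i) (y i))) \<le> norm (\<Sum>i<?l. phi (Zs ! i) (v i) (y i))"
    using power2_le_imp_le[OF le norm_ge_zero] unfolding S_def[abs_def] Y_def[abs_def] vsum .
qed

section \<open>Interpolation\<close>

lemma intertwines_if_nc_function:
  fixes S :: "'v mat \<Rightarrow> ('u::chilbert, 'y::chilbert) cblop mat"
  assumes \<Omega>: "\<Omega> \<subseteq> D" and S: "nc_function s op_scale D S"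
  shows "intertwines \<Omega> (adjact S)"
  unfolding intertwines_def
proof (intro ballI allI impI)
  fix Z W A y j assume "Z \<in> \<Omega>" "W \<in> \<Omega>" and A: "A \<in> carrier_mat (dim_row W) (dim_row Z)"
    and int: "lmult s A Z = rmult s W A" and j: "j < dim_row Z"
  hence ZW: "Z \<in> D" "W \<in> D" using \<Omega> by auto
  have gr: "graded D S" and eq: "lmult op_scale A (S Z) = rmult op_scale (S W) A"
    using S ZW A int unfolding nc_function_def by blast+
  note dims = graded_carrier[OF gr ZW(1)] graded_carrier[OF gr ZW(2)]
  have ent: "(\<Sum>q<dim_row Z. scaleC (A $$ (i, q)) (cblop_apply (S Z $$ (q, j)) u))
      = (\<Sum>k<dim_row W. scaleC (A $$ (k, j)) (cblop_apply (S W $$ (i, k)) u))" if i: "i < dim_row W" for i u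
  proof -
    have "cblop_apply (lmult op_scale A (S Z) $$ (i, j)) u = cblop_apply (rmult op_scale (S W) A $$ (i, j)) u"
      unfolding eq ..
    thus ?thesis using i j A dims by (simp add: lmult_def rmult_def sum_cblop_apply op_scale.rep_eq)
  qed
  show "adjact S Z (astar A y) j = astar A (adjact S W y) j"
  proof (rule cinner_ext)
    fix u
    have "cinner u (adjact S Z (astar A y) j)
        = (\<Sum>q<dim_row Z. \<Sum>i<dim_row W. cinner (scaleC (A $$ (i, q)) (cblop_apply (S Z $$ (q, j)) u)) (y i))"
      using A by (simp add: adjact_def astar_def cinner_sum_right cblop_sum cblop_scale cinner_scaleC_right
          cinner_scaleC_left op_adj_right)
    also have "\<dots> = (\<Sum>i<dim_row W. cinner (\<Sum>q<dim_row Z. scaleC (A $$ (i, q)) (cblop_apply (S Z $$ (q, j)) u)) (y i))"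
      by (subst sum.swap) (simp add: cinner_sum_left)
    also have "\<dots> = (\<Sum>i<dim_row W. cinner (\<Sum>k<dim_row W. scaleC (A $$ (k, j)) (cblop_apply (S W $$ (i, k)) u)) (y i))"
      by (intro sum.cong refl) (simp add: ent)
    also have "\<dots> = (\<Sum>i<dim_row W. \<Sum>k<dim_row W. cinner (scaleC (A $$ (k, j)) (cblop_apply (S W $$ (i, k)) u)) (y i))"
      by (simp add: cinner_sum_left)
    also have "\<dots> = (\<Sum>k<dim_row W. \<Sum>i<dim_row W. cinner (scaleC (A $$ (k, j)) (cblop_apply (S W $$ (i, k)) u)) (y i))"
      by (rule sum.swap)
    also have "\<dots> = cinner u (astar A (adjact S W y) j)"
      using A by (simp add: adjact_def astar_def cinner_sum_right cinner_scaleC_right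
          cinner_scaleC_left op_adj_right sum_distrib_left)
    finally show "cinner u (adjact S Z (astar A y) j) = cinner u (astar A (adjact S W y) j)" .
  qed
qed

lemma adjact_cong: "(\<And>l. l < dim_row W \<Longrightarrow> y l = y' l) \<Longrightarrow> adjact S W y = adjact S W y'"
  by (auto simp: adjact_def fun_eq_iff)

lemma nc_function_if_intertwines:
  fixes S :: "'v mat \<Rightarrow> ('u::chilbert, 'y::chilbert) cblop mat"
  assumes gr: "graded D S" and int: "intertwines D (adjact S)"
  shows "nc_function s op_scale D S"
  unfolding nc_function_def
proof (intro conjI gr ballI impI)
  fix Z W A assume Z: "Z \<in> D" and W: "W \<in> D" and A: "A \<in> carrier_mat (dim_row W) (dim_row Z)"
    and eq: "lmult s A Z = rmult s W A"
  note dims = graded_carrier[OF gr Z] graded_carrier[OF gr W]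
  show "lmult op_scale A (S Z) = rmult op_scale (S W) A"
  proof (rule eq_matI)
    fix i j assume "i < dim_row (rmult op_scale (S W) A)" "j < dim_col (rmult op_scale (S W) A)"
    hence ij: "i < dim_row W" "j < dim_row Z" using A dims by auto
    show "lmult op_scale A (S Z) $$ (i, j) = rmult op_scale (S W) A $$ (i, j)"
    proof (rule cblop_eqI, rule cinner_ext_left)
      fix u t
      have "cinner (cblop_apply (lmult op_scale A (S Z) $$ (i, j)) u) t = cinner u (adjact S Z (\<lambda>q. scaleC (cnj (A $$ (i, q))) t) j)"
        using ij A dims by (simp add: lmult_def sum_cblop_apply op_scale.rep_eq adjact_def cinner_sum_left
            cinner_sum_right cinner_scaleC_left cinner_scaleC_right cblop_scale op_adj_right)
      also have "adjact S Z (\<lambda>q. scaleC (cnj (A $$ (i, q))) t) = adjact S Z (astar A (single i t))"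
        using ij A by (intro adjact_cong)
          (auto simp: astar_def single_def if_distrib[of "scaleC _"] scaleC_zero_right cong: if_cong)
      also have "adjact S Z (astar A (single i t)) j = astar A (adjact S W (single i t)) j"
        using int Z W A eq ij unfolding intertwines_def by blast
      also have "cinner u (astar A (adjact S W (single i t)) j) = cinner (cblop_apply (rmult op_scale (S W) A $$ (i, j)) u) t"
        using ij A dims by (simp add: rmult_def sum_cblop_apply op_scale.rep_eq astar_def adjact_single cinner_sum_left
            cinner_sum_right cinner_scaleC_left cinner_scaleC_right op_adj_right)
      finally show "cinner (cblop_apply (lmult op_scale A (S Z) $$ (i, j)) u) t
          = cinner (cblop_apply (rmult op_scale (S W) A $$ (i, j)) u) t" .
    qed
  qed (use A dims in auto)
qed

text \<open>The adjoint of \<open>S(W)\<close> is assembled from the outputs for inputs with one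
  nonzero coordinate. Uniqueness of solutions makes the output linear in the input and compatible
  with intertwiners.\<close>

lemma transfer_function:
  fixes V :: "('y::chilbert \<times> ('r \<Rightarrow> 'x::chilbert) ell2, 'u::chilbert \<times> 'x) cblop"
  assumes V: "contractive V"
  shows "\<exists>S :: 'v mat \<Rightarrow> ('u, 'y) cblop mat. nc_function s op_scale D S \<and>
    contractive_multiplier s D (ker_ampl (ball_kernel Q)) (ker_ampl (ball_kernel Q)) S \<and>
    (\<forall>W\<in>D. \<forall>y. \<exists>H. solves V W y H (adjact S W y))"
proof -
  have "\<forall>W y. \<exists>H g. W \<in> D \<longrightarrow> solves V W y H g" using solves_exists[OF V] by blast
  then obtain H g where sol: "\<And>W y. W \<in> D \<Longrightarrow> solves V W y (H W y) (g W y)" by metis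
  \<comment> \<open>The outputs describe the adjoint, so entry \<open>(q, b)\<close> of
    \<open>S W\<close> is the adjoint of the map from input coordinate \<open>q\<close> to output
    coordinate \<open>b\<close>.\<close>
  define S where "S W = mat (dim_row W) (dim_row W) (\<lambda>(q, b). op_adj (Abs_cblop (\<lambda>t. g W (single q t) b)))" for W
  have gr: "graded D S" unfolding graded_def S_def by auto
  have uniq: "g W y j = g' j" if "W \<in> D" "solves V W y' H' g'" "\<And>j. j < dim_row W \<Longrightarrow> y j = y' j" "j < dim_row W" for W y y' H' g' j
    using solves_unique[OF V that(1) sol[OF that(1)] that(2)] that(3,4) by blast
  have glin: "g W y j = (\<Sum>i\<in>F. scaleC (c i) (g W (z i) j))"
    if "W \<in> D" "finite F" "\<And>j. j < dim_row W \<Longrightarrow> y j = (\<Sum>i\<in>F. scaleC (c i) (z i j))" "j < dim_row W"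
    for W F and c :: "'z \<Rightarrow> complex" and z y j
    by (rule uniq[OF that(1) solves_lincomb[OF that(1,2) sol[OF that(1)]] that(3,4)])
  have entry: "cblop_apply (Abs_cblop (\<lambda>t. g W (single q t) b)) = (\<lambda>t. g W (single q t) b)"
    if W: "W \<in> D" and qb: "q < dim_row W" "b < dim_row W" for W q b
  proof (rule cblop_apply_Abs)
    show "g W (single q (x + y)) b = g W (single q x) b + g W (single q y) b" for x y
      using glin[OF W, of "{True, False}" "single q (x + y)" "\<lambda>_. 1" "\<lambda>b. single q (if b then x else y)" b] qb(2)
      by (auto simp: single_def[abs_def] scaleC_one)
    show "g W (single q (scaleC c x)) b = scaleC c (g W (single q x) b)" for c x
      using glin[OF W, of "{()}" "single q (scaleC c x)" "\<lambda>_. c" "\<lambda>_. single q x" b] qb(2)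
      by (auto simp: single_def[abs_def] scaleC_zero_right)
    show "norm (g W (single q x) b) \<le> 1 * norm x" for x
    proof (rule power2_le_imp_le)
      have "(norm (g W (single q x) b))\<^sup>2 \<le> (\<Sum>j<dim_row W. (norm (g W (single q x) j))\<^sup>2)"
        using qb(2) by (intro member_le_sum) auto
      also have "\<dots> \<le> (\<Sum>j<dim_row W. (norm (single q x j))\<^sup>2)" by (rule solves_norm[OF V W sol[OF W]])
      also have "\<dots> = (\<Sum>j<dim_row W. if j = q then (norm x)\<^sup>2 else 0)"
        by (intro sum.cong refl) (auto simp: single_def)
      also have "\<dots> = (norm x)\<^sup>2" using qb(1) by simp
      finally show "(norm (g W (single q x) b))\<^sup>2 \<le> (1 * norm x)\<^sup>2" by simp
    qed simp
  qed
  have adj: "adjact S W y b = g W y b" if W: "W \<in> D" and b: "b < dim_row W" for W y b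
  proof -
    have "adjact S W y b = (\<Sum>q<dim_row W. g W (single q (y q)) b)"
      using b by (simp add: adjact_def S_def entry[OF W])
    also have "\<dots> = (\<Sum>q<dim_row W. scaleC 1 (g W (single q (y q)) b))" by (simp add: scaleC_one)
    also have "\<dots> = g W y b"
      by (rule glin[OF W finite_lessThan _ b, symmetric]) (simp add: single_def scaleC_one)
    finally show ?thesis .
  qed
  have sol': "solves V W y (H W y) (adjact S W y)" if "W \<in> D" for W y
    using sol[OF that, of y] unfolding solves_def by (simp add: adj that)
  have "intertwines D (adjact S)"
    unfolding intertwines_def
  proof (intro ballI allI impI)
    fix Z W A y j assume Z: "Z \<in> D" and W: "W \<in> D" and A: "A \<in> carrier_mat (dim_row W) (dim_row Z)"
      "lmult s A Z = rmult s W A" and j: "j < dim_row Z"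
    show "adjact S Z (astar A y) j = astar A (adjact S W y) j"
      using solves_unique[OF V Z sol'[OF Z, of "astar A y"] solves_astar[OF Z W A sol'[OF W, of y]] refl j] by blast
  qed
  hence "nc_function s op_scale D S" by (rule nc_function_if_intertwines[OF gr])
  moreover have "contr D (adjact S)" using sol' by (intro contr_solves[OF V]) blast
  hence "contractive_multiplier s D (ker_ampl (ball_kernel Q)) (ker_ampl (ball_kernel Q)) S"
    by (rule contractive_multiplierI[OF gr])
  ultimately show ?thesis using sol' by blast
qed

text \<open>The state space consists of the Gram vectors \<open>h\<close> of the defect kernel on
  triples \<open>(W, v, y)\<close>. Splitting the norms of \<open>Y\<close> and \<open>S\<close> at
  the first letter and subtracting turns the words that begin with \<open>b\<close> into the defect
  of the triple shifted by \<open>b\<close>; this is the isometry.\<close>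

lemma lurking_isometry:
  fixes \<sigma> :: "'v mat \<Rightarrow> (nat \<Rightarrow> 'y::chilbert) \<Rightarrow> nat \<Rightarrow> 'u::chilbert"
  assumes \<Omega>: "\<Omega> \<subseteq> D" and contr: "contr \<Omega> \<sigma>"
  shows "\<exists>V :: ('y \<times> ('r \<Rightarrow> ('v mat \<times> (nat \<Rightarrow> complex) \<times> (nat \<Rightarrow> 'y)) ell2) ell2,
      'u \<times> ('v mat \<times> (nat \<Rightarrow> complex) \<times> (nat \<Rightarrow> 'y)) ell2) cblop.
    contractive V \<and> (\<forall>W\<in>\<Omega>. \<forall>y. \<exists>H. solves V W y H (\<sigma> W y))"
proof -
  define I where "I = {i :: 'v mat \<times> (nat \<Rightarrow> complex) \<times> (nat \<Rightarrow> 'y). fst i \<in> \<Omega>}"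
  define fY where "fY = (\<lambda>(W, v, y :: nat \<Rightarrow> 'y). ev Q W v y)"
  define fS where "fS = (\<lambda>(W, v, y :: nat \<Rightarrow> 'y). ev Q W v (\<sigma> W y))"
  \<comment> \<open>Only the row changes, so shifted triples stay over
    \<open>\<Omega>\<close>.\<close>
  define sh where "sh = (\<lambda>b (W, v, y :: nat \<Rightarrow> 'y). (W, shiftv Q W b v, y))"
  define \<kappa> where "\<kappa> i j = cinner (vell2 (fY i)) (vell2 (fY j)) - cinner (vell2 (fS i)) (vell2 (fS j))" for i j
  have sqY: "sq_sum (fY i)" and sqS: "sq_sum (fS i)" if "i \<in> I" for i
    using that \<Omega> by (auto simp: I_def fY_def fS_def split: prod.splits intro!: sq_sum_ev)
  have shI: "sh b i \<in> I" if "i \<in> I" for b i using that by (auto simp: I_def sh_def split: prod.splits)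
  have sh_fY: "fY (sh b i) = (\<lambda>w. fY i (b # w))" and sh_fS: "fS (sh b i) = (\<lambda>w. fS i (b # w))" for b i
    by (auto simp: fY_def fS_def sh_def ev_Cons split: prod.splits)
  have gram: "(\<Sum>i\<in>F. \<Sum>j\<in>F. c i * cnj (c j) * \<kappa> (u i) (u j))
      = of_real ((norm (\<Sum>i\<in>F. scaleC (c i) (vell2 (fY (u i)))))\<^sup>2 - (norm (\<Sum>i\<in>F. scaleC (c i) (vell2 (fS (u i)))))\<^sup>2)"
    for F c u
    unfolding \<kappa>_def of_real_diff cinner_self[symmetric] cinner_lincomb by (simp add: right_diff_distrib sum_subtractf)
  have "psd I \<kappa>"
  proof (rule psdI_real)
    fix F c assume F: "finite F" "F \<subseteq> I"
    have FI: "fst i \<in> \<Omega>" if "i \<in> F" for i using F(2) that unfolding I_def by blast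
    have "norm (\<Sum>i\<in>F. scaleC (c i) (vell2 (fS i))) \<le> norm (\<Sum>i\<in>F. scaleC (c i) (vell2 (fY i)))"
      using contr_finite_sum[OF \<Omega> contr F(1) FI, of c]
      by (simp add: phi_def[symmetric] fY_def fS_def case_prod_beta)
    hence "0 \<le> (norm (\<Sum>i\<in>F. scaleC (c i) (vell2 (fY i))))\<^sup>2 - (norm (\<Sum>i\<in>F. scaleC (c i) (vell2 (fS i))))\<^sup>2"
      by (simp add: power_mono)
    thus "\<exists>r\<ge>0. (\<Sum>i\<in>F. \<Sum>j\<in>F. c i * cnj (c j) * \<kappa> i j) = complex_of_real r"
      using gram[of c "\<lambda>i. i" F] by blast
  qed
  then obtain h :: "'v mat \<times> (nat \<Rightarrow> complex) \<times> (nat \<Rightarrow> 'y) \<Rightarrow> ('v mat \<times> (nat \<Rightarrow> complex) \<times> (nat \<Rightarrow> 'y)) ell2"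
    where h: "\<And>i j. i \<in> I \<Longrightarrow> j \<in> I \<Longrightarrow> cinner (h i) (h j) = \<kappa> i j"
    using psd_gram by blast
  have h_norm: "(norm (\<Sum>i\<in>F. scaleC (c i) (h (u i))))\<^sup>2
      = (norm (\<Sum>i\<in>F. scaleC (c i) (vell2 (fY (u i)))))\<^sup>2 - (norm (\<Sum>i\<in>F. scaleC (c i) (vell2 (fS (u i)))))\<^sup>2"
    if "\<And>i. i \<in> F \<Longrightarrow> u i \<in> I" for F :: "('v mat \<times> (nat \<Rightarrow> complex) \<times> (nat \<Rightarrow> 'y)) set" and c u
  proof -
    have "complex_of_real ((norm (\<Sum>i\<in>F. scaleC (c i) (h (u i))))\<^sup>2) = (\<Sum>i\<in>F. \<Sum>j\<in>F. c i * cnj (c j) * \<kappa> (u i) (u j))"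
      unfolding cinner_self[symmetric] cinner_lincomb using that by (intro sum.cong refl) (simp add: h)
    thus ?thesis unfolding gram of_real_eq_iff .
  qed
  have cons: "(\<lambda>b. (norm (vell2 (\<lambda>w. f (b # w))))\<^sup>2) summable_on UNIV"
    "(norm (vell2 f))\<^sup>2 = (norm (f []))\<^sup>2 + (\<Sum>\<^sub>\<infinity>b. (norm (vell2 (\<lambda>w. f (b # w))))\<^sup>2)"
    if f: "sq_sum f" for f :: "'r list \<Rightarrow> 'z::chilbert"
  proof -
    note sp = infsum_split[OF f[unfolded sq_sum_def] inj_cons_split, unfolded prod.case]
    have sb: "sq_sum (\<lambda>w. f (b # w))" for b using sp(1) unfolding sq_sum_def .
    show "(\<lambda>b. (norm (vell2 (\<lambda>w. f (b # w))))\<^sup>2) summable_on UNIV"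
      "(norm (vell2 f))\<^sup>2 = (norm (f []))\<^sup>2 + (\<Sum>\<^sub>\<infinity>b. (norm (vell2 (\<lambda>w. f (b # w))))\<^sup>2)"
      unfolding norm_vell2[OF sb] norm_vell2[OF f] by (rule sp(2), rule sp(3))
  qed
  have shift_norm: "(\<lambda>b. (norm (\<Sum>i\<in>F. scaleC (c i) (h (sh b i))))\<^sup>2) summable_on UNIV"
    "(norm (\<Sum>i\<in>F. scaleC (c i) (fY i [])))\<^sup>2 + (\<Sum>\<^sub>\<infinity>b. (norm (\<Sum>i\<in>F. scaleC (c i) (h (sh b i))))\<^sup>2)
      = (norm (\<Sum>i\<in>F. scaleC (c i) (fS i [])))\<^sup>2 + (norm (\<Sum>i\<in>F. scaleC (c i) (h i)))\<^sup>2"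
    if F: "finite F" "F \<subseteq> I" for F c
  proof -
    define Y where "Y w = (\<Sum>i\<in>F. scaleC (c i) (fY i w))" for w
    define S where "S w = (\<Sum>i\<in>F. scaleC (c i) (fS i w))" for w
    have iI: "i \<in> I" if "i \<in> F" for i using that F by blast
    have sq: "sq_sum Y" "sq_sum S" unfolding Y_def S_def by (intro sq_sum_lincomb sqY sqS iI, assumption)+
    have vY: "(\<Sum>i\<in>F. scaleC (c i) (vell2 (fY i))) = vell2 Y" unfolding Y_def by (intro vell2_lincomb[symmetric] F sqY iI)
    have vS: "(\<Sum>i\<in>F. scaleC (c i) (vell2 (fS i))) = vell2 S" unfolding S_def by (intro vell2_lincomb[symmetric] F sqS iI)
    have vYb: "(\<Sum>i\<in>F. scaleC (c i) (vell2 (fY (sh b i)))) = vell2 (\<lambda>w. Y (b # w))" for b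
    proof -
      have "(\<Sum>i\<in>F. scaleC (c i) (vell2 (fY (sh b i)))) = vell2 (\<lambda>w. \<Sum>i\<in>F. scaleC (c i) (fY (sh b i) w))"
        by (intro vell2_lincomb[symmetric] F sqY shI iI)
      thus ?thesis by (simp add: sh_fY Y_def)
    qed
    have vSb: "(\<Sum>i\<in>F. scaleC (c i) (vell2 (fS (sh b i)))) = vell2 (\<lambda>w. S (b # w))" for b
    proof -
      have "(\<Sum>i\<in>F. scaleC (c i) (vell2 (fS (sh b i)))) = vell2 (\<lambda>w. \<Sum>i\<in>F. scaleC (c i) (fS (sh b i) w))"
        by (intro vell2_lincomb[symmetric] F sqS shI iI)
      thus ?thesis by (simp add: sh_fS S_def)
    qed
    have hb: "(norm (\<Sum>i\<in>F. scaleC (c i) (h (sh b i))))\<^sup>2 = (norm (vell2 (\<lambda>w. Y (b # w))))\<^sup>2 - (norm (vell2 (\<lambda>w. S (b # w))))\<^sup>2" for b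
      using h_norm[of F "sh b" c] shI iI unfolding vYb vSb by blast
    have h0: "(norm (\<Sum>i\<in>F. scaleC (c i) (h i)))\<^sup>2 = (norm (vell2 Y))\<^sup>2 - (norm (vell2 S))\<^sup>2"
      using h_norm[of F "\<lambda>i. i" c] iI unfolding vY vS by blast
    have diff: "((\<lambda>b. (norm (vell2 (\<lambda>w. Y (b # w))))\<^sup>2 - (norm (vell2 (\<lambda>w. S (b # w))))\<^sup>2) has_sum
        (\<Sum>\<^sub>\<infinity>b. (norm (vell2 (\<lambda>w. Y (b # w))))\<^sup>2) - (\<Sum>\<^sub>\<infinity>b. (norm (vell2 (\<lambda>w. S (b # w))))\<^sup>2)) UNIV"
      using has_sum_add[OF has_sum_infsum[OF cons(1)[OF sq(1)]] has_sum_uminusI[OF has_sum_infsum[OF cons(1)[OF sq(2)]]]]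
      by simp
    show "(\<lambda>b. (norm (\<Sum>i\<in>F. scaleC (c i) (h (sh b i))))\<^sup>2) summable_on UNIV"
      unfolding hb using diff by (rule has_sum_imp_summable)
    show "(norm (\<Sum>i\<in>F. scaleC (c i) (fY i [])))\<^sup>2 + (\<Sum>\<^sub>\<infinity>b. (norm (\<Sum>i\<in>F. scaleC (c i) (h (sh b i))))\<^sup>2)
      = (norm (\<Sum>i\<in>F. scaleC (c i) (fS i [])))\<^sup>2 + (norm (\<Sum>i\<in>F. scaleC (c i) (h i)))\<^sup>2"
      unfolding hb h0 infsumI[OF diff] Y_def[symmetric] S_def[symmetric]
      using cons(2)[OF sq(1)] cons(2)[OF sq(2)] by linarith
  qed
  have sqh: "sq_sum (\<lambda>b. h (sh b i))" if "i \<in> I" for i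
    using shift_norm(1)[of "{i}" "\<lambda>_. 1"] that unfolding sq_sum_def by (simp add: scaleC_one)
  \<comment> \<open>\<open>contraction_extension\<close> takes families over a whole type; triples
    outside \<open>I\<close> are sent to 0 on both sides.\<close>
  define g where "g i = (if i \<in> I then (fY i [], vell2 (\<lambda>b. h (sh b i))) else 0)" for i
  define t where "t i = (if i \<in> I then (fS i [], h i) else 0)" for i
  have "norm (\<Sum>i\<in>F. scaleC (c i) (t i)) \<le> norm (\<Sum>i\<in>F. scaleC (c i) (g i))" if F: "finite F" for F c
  proof -
    let ?F = "F \<inter> I"
    have F': "finite ?F" "?F \<subseteq> I" using F by auto
    have tF: "(\<Sum>i\<in>F. scaleC (c i) (t i)) = (\<Sum>i\<in>?F. scaleC (c i) (fS i []), \<Sum>i\<in>?F. scaleC (c i) (h i))"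
      unfolding sum_Pair[symmetric] scaleC_Pair[symmetric] t_def
      by (rule sum.mono_neutral_cong_right) (use F in \<open>auto simp: scaleC_zero_right\<close>)
    have "(\<Sum>i\<in>F. scaleC (c i) (g i)) = (\<Sum>i\<in>?F. scaleC (c i) (fY i []), \<Sum>i\<in>?F. scaleC (c i) (vell2 (\<lambda>b. h (sh b i))))"
      unfolding sum_Pair[symmetric] scaleC_Pair[symmetric] g_def
      by (rule sum.mono_neutral_cong_right) (use F in \<open>auto simp: scaleC_zero_right\<close>)
    also have "(\<Sum>i\<in>?F. scaleC (c i) (vell2 (\<lambda>b. h (sh b i)))) = vell2 (\<lambda>b. \<Sum>i\<in>?F. scaleC (c i) (h (sh b i)))"
      using F by (intro vell2_lincomb[symmetric] sqh) auto
    finally have gF: "(\<Sum>i\<in>F. scaleC (c i) (g i)) = (\<Sum>i\<in>?F. scaleC (c i) (fY i []), vell2 (\<lambda>b. \<Sum>i\<in>?F. scaleC (c i) (h (sh b i))))" .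
    have "sq_sum (\<lambda>b. \<Sum>i\<in>?F. scaleC (c i) (h (sh b i)))" by (intro sq_sum_lincomb sqh) auto
    hence "(norm (\<Sum>i\<in>F. scaleC (c i) (t i)))\<^sup>2 = (norm (\<Sum>i\<in>F. scaleC (c i) (g i)))\<^sup>2"
      unfolding tF gF norm_sq_Pair using shift_norm(2)[OF F', of c] by (simp add: norm_vell2)
    thus ?thesis by (simp add: power2_eq_iff_nonneg)
  qed
  from contraction_extension[where g=g and h=t, OF this]
  obtain V where V: "\<And>i. cblop_apply V (g i) = t i" "contractive V" unfolding contractive_def by blast
  have "\<exists>H. solves V W y H (\<sigma> W y)" if W: "W \<in> \<Omega>" for W y
  proof -
    have WD: "W \<in> D" using W \<Omega> by blast
    define e where "e v = (W, v, y)" for v :: "nat \<Rightarrow> complex"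
    have eI: "e v \<in> I" for v using W by (simp add: e_def I_def)
    \<comment> \<open>\<open>h\<close> is known only through its inner products. These are linear in
      the row, so the difference \<open>d\<close> is orthogonal to every \<open>h k\<close>, hence
      to itself. The states at unit rows therefore determine the others.\<close>
    have lin: "h (e v) = (\<Sum>l<dim_row W. scaleC (v l) (h (e (unit_fun l))))" for v
    proof -
      define d where "d = h (e v) - (\<Sum>l<dim_row W. scaleC (v l) (h (e (unit_fun l))))"
      have "\<kappa> (e v) k = (\<Sum>l<dim_row W. v l * \<kappa> (e (unit_fun l)) k)" for k
      proof -
        have "vell2 (fY (e v)) = (\<Sum>l<dim_row W. scaleC (v l) (vell2 (fY (e (unit_fun l)))))"
          "vell2 (fS (e v)) = (\<Sum>l<dim_row W. scaleC (v l) (vell2 (fS (e (unit_fun l)))))"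
          unfolding e_def fY_def fS_def prod.case phi_def[symmetric] by (rule phi_expand_v[OF WD])+
        thus ?thesis by (simp add: \<kappa>_def cinner_sum_left cinner_scaleC_left right_diff_distrib sum_subtractf)
      qed
      hence ort: "cinner d (h k) = 0" if "k \<in> I" for k
        using that by (simp add: d_def cinner_diff_left cinner_sum_left cinner_scaleC_left h eI)
      have "cinner d d = cinner d (h (e v)) - (\<Sum>l<dim_row W. cnj (v l) * cinner d (h (e (unit_fun l))))"
        by (subst (2) d_def) (simp add: cinner_diff_right cinner_sum_right cinner_scaleC_right)
      hence "d = 0" by (simp add: ort eI cinner_self)
      thus ?thesis by (simp add: d_def)
    qed
    have "solves V W y (\<lambda>l. h (e (unit_fun l))) (\<sigma> W y)"
      unfolding solves_def
    proof (intro allI impI)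
      fix j assume j: "j < dim_row W"
      have pick: "(\<Sum>p<dim_row W. scaleC (unit_fun j p) (z p)) = z j" for z :: "nat \<Rightarrow> 'z::chilbert"
        using j by (simp add: unit_fun_def if_distrib[of "\<lambda>c. scaleC c _"] scaleC_one scaleC_zero_left cong: if_cong)
      \<comment> \<open>Shifting the \<open>j\<close>-th unit row yields row \<open>j\<close> of the
        adjoint of \<open>Q_b(W)\<close>; by linearity the shifted state is that matrix applied to
        the states at unit rows.\<close>
      have Qh: "h (sh b (e (unit_fun j))) = Qst Q W b (\<lambda>l. h (e (unit_fun l))) j" for b
      proof -
        have sv: "shiftv Q W b (unit_fun j) l = (if b \<in> onb then cnj (Qc Q W b l j) else 0)" for l
          using j by (simp add: shiftv_def unit_fun_def if_distrib[of "\<lambda>c. c * _"] cong: if_cong)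
        have "h (sh b (e (unit_fun j))) = (\<Sum>l<dim_row W. scaleC (shiftv Q W b (unit_fun j) l) (h (e (unit_fun l))))"
          using lin[of "shiftv Q W b (unit_fun j)"] by (simp add: sh_def e_def)
        thus ?thesis using j by (simp add: Qst_def sv scaleC_zero_left)
      qed
      have "cblop_apply V (g (e (unit_fun j))) = t (e (unit_fun j))" by (rule V(1))
      thus "cblop_apply V (y j, vell2 (\<lambda>b. Qst Q W b (\<lambda>l. h (e (unit_fun l))) j)) = (\<sigma> W y j, h (e (unit_fun j)))"
        unfolding g_def t_def using eI
        by (simp add: Qh) (simp add: e_def fY_def fS_def ev_Nil pick)
    qed
    thus ?thesis by blast
  qed
  thus ?thesis using V(2) by blast
qed

section \<open>The kernels of the Pick condition and the final equivalence\<close>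

lemma represents_de_branges:
  fixes S :: "'v mat \<Rightarrow> ('u::chilbert, 'y::chilbert) cblop mat"
  assumes \<Omega>: "\<Omega> \<subseteq> D" and gr: "graded \<Omega> S"
  shows "represents \<Omega> (de_branges_kernel (ball_kernel Q) S) (adjact S)"
  unfolding represents_def
proof (intro ballI conjI allI)
  fix Z W and P :: "complex mat"
  assume ZW: "Z \<in> \<Omega>" "W \<in> \<Omega>" and P: "P \<in> carrier_mat (dim_row Z) (dim_row W)"
  have ZD: "Z \<in> D" and WD: "W \<in> D" using ZW \<Omega> by auto
  let ?n = "dim_row Z" and ?m = "dim_row W" and ?k = "ball_kernel Q Z W P"
  have "S Z \<in> carrier_mat ?n ?n" "S W \<in> carrier_mat ?m ?m"
    using gr ZW D_square[OF ZD] D_square[OF WD] unfolding graded_def by blast+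
  hence SZ: "dim_row (S Z) = ?n" "dim_col (S Z) = ?n" and SW: "dim_row (S W) = ?m" "dim_col (S W) = ?m"
    by blast+
  have k: "dim_row ?k = ?n" "dim_col ?k = ?m" using ball_kernel_dim by auto
  show "de_branges_kernel (ball_kernel Q) S Z W P \<in> carrier_mat ?n ?m"
    by (intro carrier_matI) (simp_all add: de_branges_kernel_def SZ SW k)
  fix y :: "nat \<Rightarrow> 'y" and x :: "nat \<Rightarrow> 'y"
  have ent: "cblop_apply (de_branges_kernel (ball_kernel Q) S Z W P $$ (i, j)) (y j) =
      scaleC (?k $$ (i, j)) (y j) - (\<Sum>b<?m. \<Sum>a<?n. scaleC (?k $$ (a, b)) (cblop_apply (S Z $$ (i, a)) (cblop_apply (op_adj (S W $$ (j, b))) (y j))))"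
    if "i < ?n" "j < ?m" for i j
    using that by (simp add: de_branges_kernel_def SZ SW k minus_cblop.rep_eq op_scale.rep_eq op_id.rep_eq
        sum_cblop_apply op_comp.rep_eq cblop_scale)
  let ?t = "\<lambda>i j a b. ?k $$ (a, b) * cinner (cblop_apply (op_adj (S W $$ (j, b))) (y j)) (cblop_apply (op_adj (S Z $$ (i, a))) (x i))"
  have "pair ?n ?m (de_branges_kernel (ball_kernel Q) S Z W P) y x
      = (\<Sum>i<?n. \<Sum>j<?m. ?k $$ (i, j) * cinner (y j) (x i)) - (\<Sum>i<?n. \<Sum>j<?m. \<Sum>b<?m. \<Sum>a<?n. ?t i j a b)"
    unfolding pair_def sum_subtractf[symmetric]
    by (intro sum.cong refl) (simp add: ent cinner_diff_left cinner_scaleC_left cinner_sum_left op_adj_right)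
  also have "(\<Sum>i<?n. \<Sum>j<?m. \<Sum>b<?m. \<Sum>a<?n. ?t i j a b) = (\<Sum>a<?n. \<Sum>b<?m. \<Sum>i<?n. \<Sum>j<?m. ?t i j a b)"
    by (subst sum_swap_pairs) (rule sum.swap)
  also have "\<dots> = (\<Sum>a<?n. \<Sum>b<?m. ?k $$ (a, b) * cinner (adjact S W y b) (adjact S Z x a))"
    unfolding adjact_def cinner_sum_left cinner_sum_right sum_distrib_left by (intro sum.cong refl sum.swap)
  finally show "pair ?n ?m (de_branges_kernel (ball_kernel Q) S Z W P) y x
      = kform Z W P y x - kform Z W P (adjact S W y) (adjact S Z x)"
    unfolding ball_kernel_form[OF ZD WD P] .
qed

lemma represents_ampl:
  "represents D (ker_ampl (ball_kernel Q) :: ('v, 'h::chilbert) nc_ker) (\<lambda>_ _ _. 0 :: complex)"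
  unfolding represents_def
proof (intro ballI conjI allI)
  fix Z W and P :: "complex mat"
  assume ZD: "Z \<in> D" and WD: "W \<in> D" and P: "P \<in> carrier_mat (dim_row Z) (dim_row W)"
  let ?n = "dim_row Z" and ?m = "dim_row W" and ?k = "ball_kernel Q Z W P"
  have k: "dim_row ?k = ?n" "dim_col ?k = ?m" using ball_kernel_dim by auto
  show "(ker_ampl (ball_kernel Q) Z W P :: ('h, 'h) cblop mat) \<in> carrier_mat ?n ?m"
    by (intro carrier_matI) (simp_all add: ker_ampl_def k)
  fix y x :: "nat \<Rightarrow> 'h"
  have "pair ?n ?m (ker_ampl (ball_kernel Q) Z W P) y x = kform Z W P y x"
    unfolding ball_kernel_form[OF ZD WD P, symmetric] pair_def
    by (intro sum.cong refl) (simp add: ker_ampl_def k op_scale.rep_eq op_id.rep_eq cinner_scaleC_left)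
  moreover have "kform Z W P (\<lambda>_. 0 :: complex) (\<lambda>_. 0) = 0"
    unfolding ball_kernel_form[OF ZD WD P, symmetric] by simp
  ultimately show "pair ?n ?m (ker_ampl (ball_kernel Q) Z W P) y x
      = kform Z W P y x - kform Z W P (\<lambda>_. 0 :: complex) (\<lambda>_. 0)" by simp
qed

lemma cp_ball_kernel: "cp_nc_kernel s D (ker_ampl (ball_kernel Q) :: ('v, 'h::chilbert) nc_ker)"
proof (rule cp_nc_kernelI[OF subset_refl represents_ampl])
  show "intertwines D (\<lambda>_ (_ :: nat \<Rightarrow> 'h) _. 0 :: complex)"
    by (simp add: intertwines_def astar_def scaleC_zero_right)
  have zero: "phi W v (\<lambda>_. 0 :: complex) = 0" if "W \<in> D" for W v
    using phi_lincomb_y[OF that, of "{}" v] by simp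
  have "(\<Sum>i<length Zs. phi (Zs ! i) (v i) (\<lambda>_. 0 :: complex)) = 0" if "set Zs \<subseteq> D" for Zs v
    using that nth_mem[of _ Zs] by (intro sum.neutral) (auto intro!: zero)
  thus "contr D (\<lambda>_ (_ :: nat \<Rightarrow> 'h) _. 0 :: complex)" by (simp add: contr_def)
qed

theorem complete_pick_ball_kernel:
  "complete_pick_nc_kernel TYPE('u::chilbert) TYPE('y::chilbert) s D (ball_kernel Q)"
  unfolding complete_pick_nc_kernel_def
proof (intro conjI allI impI D_nc_space closed_dsum_ball cp_ball_kernel)
  fix \<Omega> and S0 :: "'v mat \<Rightarrow> ('u, 'y) cblop mat"
  assume "\<Omega> \<subseteq> D \<and> graded \<Omega> S0"
  hence \<Omega>: "\<Omega> \<subseteq> D" and gr: "graded \<Omega> S0" by auto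
  note rep = represents_de_branges[OF \<Omega> gr]
  show "(\<exists>S. nc_function s op_scale D S \<and>
        contractive_multiplier s D (ker_ampl (ball_kernel Q)) (ker_ampl (ball_kernel Q)) S \<and> (\<forall>Z\<in>\<Omega>. S Z = S0 Z))
      \<longleftrightarrow> cp_nc_kernel s \<Omega> (de_branges_kernel (ball_kernel Q) S0)" (is "?L \<longleftrightarrow> ?R")
  proof
    assume ?L
    then obtain S where S: "nc_function s op_scale D S"
      "contractive_multiplier s D (ker_ampl (ball_kernel Q)) (ker_ampl (ball_kernel Q)) S"
      and ext: "\<And>Z. Z \<in> \<Omega> \<Longrightarrow> S Z = S0 Z" by blast
    have eq: "adjact S0 W = adjact S W" if "W \<in> \<Omega>" for W
      by (simp add: adjact_def fun_eq_iff ext[OF that])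
    have "contr D (adjact S)" using S by (intro contr_if_multiplier) (auto simp: nc_function_def)
    hence "contr \<Omega> (adjact S0)"
      using \<Omega> nth_mem unfolding contr_def by (simp add: eq subset_iff)
    \<comment> \<open>\<open>S0\<close> is only graded; its intertwining relations are inherited
      from the extension \<open>S\<close>.\<close>
    moreover have "intertwines \<Omega> (adjact S0)"
      using intertwines_if_nc_function[OF \<Omega> S(1)] unfolding intertwines_def by (simp add: eq)
    ultimately show ?R by (intro cp_nc_kernelI[OF \<Omega> rep])
  next
    assume ?R
    have "contr \<Omega> (adjact S0)" by (rule contr_if_cp[OF \<Omega> rep \<open>?R\<close>]) (rule adjact_cong)
    from lurking_isometry[OF \<Omega> this] obtain V :: "('y \<times> ('r \<Rightarrow> ('v mat \<times> (nat \<Rightarrow> complex) \<times> (nat \<Rightarrow> 'y)) ell2) ell2,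
      'u \<times> ('v mat \<times> (nat \<Rightarrow> complex) \<times> (nat \<Rightarrow> 'y)) ell2) cblop"
      where V: "contractive V" "\<And>W y. W \<in> \<Omega> \<Longrightarrow> \<exists>H. solves V W y H (adjact S0 W y)" by blast
    obtain S :: "'v mat \<Rightarrow> ('u, 'y) cblop mat" where S: "nc_function s op_scale D S"
      "contractive_multiplier s D (ker_ampl (ball_kernel Q)) (ker_ampl (ball_kernel Q)) S"
      and sol: "\<And>W y. W \<in> D \<Longrightarrow> \<exists>H. solves V W y H (adjact S W y)"
      using transfer_function[OF V(1)] by blast
    \<comment> \<open>Over \<open>\<Omega>\<close>, the adjoints of \<open>S\<close> and of
      \<open>S0\<close> both give outputs of the same colligation \<open>V\<close>, so
      \<open>solves_unique\<close> identifies them entry by entry.\<close>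
    have "S Z = S0 Z" if Z: "Z \<in> \<Omega>" for Z
    proof (rule eq_matI)
      have ZD: "Z \<in> D" using Z \<Omega> by blast
      have S0: "S0 Z \<in> carrier_mat (dim_row Z) (dim_row Z)"
        using gr Z D_square[OF ZD] unfolding graded_def by blast
      have SZ: "S Z \<in> carrier_mat (dim_row Z) (dim_row Z)"
        using S(1) ZD by (intro graded_carrier) (auto simp: nc_function_def)
      show "dim_row (S Z) = dim_row (S0 Z)" "dim_col (S Z) = dim_col (S0 Z)" using S0 SZ by auto
      fix i j assume "i < dim_row (S0 Z)" "j < dim_col (S0 Z)"
      hence ij: "i < dim_row Z" "j < dim_row Z" using S0 by auto
      have "cblop_apply (op_adj (S Z $$ (i, j))) t = cblop_apply (op_adj (S0 Z $$ (i, j))) t" for t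
      proof -
        obtain H H' where "solves V Z (single i t) H (adjact S Z (single i t))"
          "solves V Z (single i t) H' (adjact S0 Z (single i t))" using sol[OF ZD] V(2)[OF Z] by blast
        from solves_unique[OF V(1) ZD this refl ij(2)] show ?thesis by (simp add: adjact_single ij)
      qed
      hence "op_adj (S Z $$ (i, j)) = op_adj (S0 Z $$ (i, j))" by (rule cblop_eqI)
      thus "S Z $$ (i, j) = S0 Z $$ (i, j)" by (metis op_adj_op_adj)
    qed
    thus ?L using S by blast
  qed
qed

end

theorem corollary5p6:
  fixes scale :: "complex \<Rightarrow> 'v::ab_group_add \<Rightarrow> 'v"
    and \<Xi> :: "'v mat set"
    and Q0 :: "'v mat \<Rightarrow> ('r::chilbert, complex) cblop mat"
  assumes "vector_space scale"
    and "full_nc_subset scale \<Xi>"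
    and "nc_function scale op_scale \<Xi> Q0"
  shows "complete_pick_nc_kernel TYPE('u::chilbert) TYPE('y::chilbert) scale
    (nc_ball \<Xi> Q0) (ball_kernel Q0)"
proof -
  interpret nc_row_ball scale \<Xi> Q0 by (rule nc_row_ball.intro) (fact assms)+
  show ?thesis by (rule complete_pick_ball_kernel)
qed

end
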